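(* There is a foliation by surfaces (i.e. with $2$-dimensional leaves) on a smooth $4$-manifold that is topologically transitive and has a dense set of compact leaves, but is not sensitive to initial conditions. Moreover, this foliation is $C^\infty$ and transversally affine.
   Context: Manifolds are without boundary and second countable. Metrics may take the value $\infty$; a metric is compatible if its open balls generate the topology. A foliation is described by a locally finite foliated atlas $\phi_i\colon U_i\to\mathbb R^2\times Z_i$ with $Z_i$ a $2$-manifold and coordinate changes $\phi_i\phi_j^{-1}(x_j,z_j)=(x_i(x_j,z_j),z_i(z_j))$, $z_i$ depending only on $z_j$. "Dense set of compact leaves" means that the union of the leaves that are compact (in the leaf topology) is dense in the manifold. Pseudogroups: $\mathrm{Ph}(Z)$ is the set of homeomorphisms $f\colon\mathrm{dom} f\to\mathrm{im} f$ between open subsets of $Z$; the composition $gf$ has domain $f^{-1}(\mathrm{dom}\,g)$. A pseudo$*$group on $Z$ is a subset of $\mathrm{Ph}(Z)$ containing $\mathrm{id}_Z$ and closed under inversion, composition and restriction to open subsets of domains. A pseudogroup is a pseudo$*$group $\mathcal G$ such that if $f\in\mathrm{Ph}(Z)$ and every $x\in\mathrm{dom} f$ has an open neighborhood $V$ with $f|_V\in\mathcal G$, then $f\in\mathcal G$. $S\subset\mathcal G$ generates $\mathcal G$ if $\mathcal G$ is the smallest pseudogroup containing $S$. Holonomy pseudogroup: let $p_i$ be $\phi_i$ followed by the projection $\mathbb R^2\times Z_i\to Z_i$ and $Z=\coprod_i Z_i$; the holonomy pseudogroup is the pseudogroup on $Z$ generated by the maps $h_{i,j}\colon p_j(U_i\cap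 U_j)\to p_i(U_i\cap U_j)$, $h_{i,j}(z_j)=z_i(z_j)$. It is well defined up to equivalence of pseudogroups, and the properties below do not depend on the atlas. The foliation is transversally affine if it has an atlas such that the transversals $Z_i$ have an affine structure for which all $h_{i,j}$ are affine. A pseudogroup $\mathcal G$ on $Z$ is topologically transitive if for all non-empty open $U,V\subset Z$ some $g\in\mathcal G$ satisfies $g(U\cap\mathrm{dom}\,g)\cap V\ne\emptyset$. It is sensitive to initial conditions if for every compatible metric $d$ on $Z$ and every pseudo$*$group $\mathcal S\subset\mathcal G$ generating $\mathcal G$ there is $c>0$ such that for every $x\in Z$ and $r>0$ there are $s\in\mathcal S$ and $y$ with $x,y\in\mathrm{dom}\,s$, $d(x,y)<r$ and $d(sx,sy)\ge c$. A foliation is topologically transitive (equivalently, has a dense leaf), respectively sensitive to initial conditions, if its holonomy pseudogroup is. *)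

theory Defs
  imports "HOL-Analysis.Analysis"
begin

section \<open>Manifolds with a smooth or an affine structure\<close>

text \<open>\<open>Ck_on k S f\<close>: \<open>f\<close> is of class \<open>C\<^sup>k\<close> on \<open>S\<close>, that is, all iterated directional
  derivatives of order at most \<open>k\<close> exist and are continuous.  It is only used for open \<open>S\<close>.\<close>

primrec Ck_on ::
  "nat \<Rightarrow> 'a::euclidean_space set \<Rightarrow> ('a \<Rightarrow> 'b::euclidean_space) \<Rightarrow> bool" where
  "Ck_on 0 S f \<longleftrightarrow> continuous_on S f"
| "Ck_on (Suc k) S f \<longleftrightarrow>
     (\<forall>x\<in>S. f differentiable (at x)) \<and>
     (\<forall>v. Ck_on k S (\<lambda>x. frechet_derivative f (at x) v))"

definition smooth_on :: "'a::euclidean_space set \<Rightarrow> ('a \<Rightarrow> 'b::euclidean_space) \<Rightarrow> bool" where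
  "smooth_on S f \<longleftrightarrow> (\<forall>k. Ck_on k S f)"

text \<open>Affine maps between (possibly disconnected) open sets, in the sense of affine structures:
  near every point the map is the restriction of an affine map.\<close>

definition locally_affine_on ::
  "'a::euclidean_space set \<Rightarrow> ('a \<Rightarrow> 'b::euclidean_space) \<Rightarrow> bool" where
  "locally_affine_on S f \<longleftrightarrow>
     (\<forall>x\<in>S. \<exists>V A b. open V \<and> x \<in> V \<and> linear A \<and> (\<forall>y\<in>V \<inter> S. f y = A y + b))"

definition coord_chart :: "'m topology \<Rightarrow> 'm set \<times> ('m \<Rightarrow> 'e::euclidean_space) \<Rightarrow> bool" where
  "coord_chart X c \<longleftrightarrow>
     (case c of (U, a) \<Rightarrow>
        openin X U \<and> open (a ` U) \<and>
        homeomorphic_map (subtopology X U) (top_of_set (a ` U)) a)"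

text \<open>An atlas whose coordinate changes satisfy \<open>P\<close>; it is not required to be maximal.\<close>

definition atlas ::
  "('e set \<Rightarrow> ('e \<Rightarrow> 'e) \<Rightarrow> bool) \<Rightarrow> 'm topology \<Rightarrow>
   ('m set \<times> ('m \<Rightarrow> 'e::euclidean_space)) set \<Rightarrow> bool" where
  "atlas P X \<A> \<longleftrightarrow>
     (\<forall>c\<in>\<A>. coord_chart X c) \<and>
     (\<Union>(U, a)\<in>\<A>. U) = topspace X \<and>
     (\<forall>(U, a)\<in>\<A>. \<forall>(V, b)\<in>\<A>. P (a ` (U \<inter> V)) (b \<circ> inv_into U a))"

abbreviation smooth_atlas ::
  "'m topology \<Rightarrow> ('m set \<times> ('m \<Rightarrow> 'e::euclidean_space)) set \<Rightarrow> bool" where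
  "smooth_atlas \<equiv> atlas smooth_on"

abbreviation affine_atlas ::
  "'m topology \<Rightarrow> ('m set \<times> ('m \<Rightarrow> 'e::euclidean_space)) set \<Rightarrow> bool" where
  "affine_atlas \<equiv> atlas locally_affine_on"

text \<open>The expression in charts of a continuous map \<open>f\<close>, defined on the open set \<open>W\<close>,
  satisfies \<open>P\<close>.\<close>

definition in_charts ::
  "('e set \<Rightarrow> ('e \<Rightarrow> 'e') \<Rightarrow> bool) \<Rightarrow>
   ('m set \<times> ('m \<Rightarrow> 'e)) set \<Rightarrow> ('n set \<times> ('n \<Rightarrow> 'e')) set \<Rightarrow>
   'm set \<Rightarrow> ('m \<Rightarrow> 'n) \<Rightarrow> bool" where
  "in_charts P \<A> \<B> W f \<longleftrightarrow>
     (\<forall>(U, a)\<in>\<A>. \<forall>(V, b)\<in>\<B>.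
        P (a ` (U \<inter> W \<inter> f -` V)) (b \<circ> f \<circ> inv_into U a))"

text \<open>The product atlas on \<open>\<real>\<^sup>2 \<times> Z\<close>, given an atlas on \<open>Z\<close>.\<close>

definition plane_times_atlas ::
  "('z set \<times> ('z \<Rightarrow> real^2)) set \<Rightarrow>
   (((real^2) \<times> 'z) set \<times> ((real^2) \<times> 'z \<Rightarrow> (real^2) \<times> (real^2))) set" where
  "plane_times_atlas \<B> = (\<lambda>(V, b). (UNIV \<times> V, map_prod id b)) ` \<B>"

definition surface :: "'z topology \<Rightarrow> bool" where
  "surface X \<longleftrightarrow>
     Hausdorff_space X \<and> second_countable X \<and>
     (\<forall>x\<in>topspace X. \<exists>U (a :: 'z \<Rightarrow> real^2). x \<in> U \<and> coord_chart X (U, a))"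

definition smooth_4_manifold :: "'m topology \<Rightarrow> ('m set \<times> ('m \<Rightarrow> real^4)) set \<Rightarrow> bool" where
  "smooth_4_manifold M \<A> \<longleftrightarrow>
     Hausdorff_space M \<and> second_countable M \<and> smooth_atlas M \<A>"


section \<open>Pseudogroups\<close>

text \<open>A map between subsets of \<open>Z\<close> is a partial function \<open>f :: 'z \<rightharpoonup> 'z\<close> with domain \<open>dom f\<close> and
  image \<open>ran f\<close>.  The composition \<open>g \<circ>\<^sub>m f\<close> has domain \<open>f\<^sup>-\<^sup>1(dom g)\<close>, and \<open>f |` V\<close> is the
  restriction to \<open>V\<close>.\<close>

definition Ph :: "'z topology \<Rightarrow> ('z \<rightharpoonup> 'z) set" where
  "Ph X = {f. openin X (dom f) \<and> openin X (ran f) \<and>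
     homeomorphic_map (subtopology X (dom f)) (subtopology X (ran f)) (the \<circ> f)}"

definition partial_id :: "'z topology \<Rightarrow> ('z \<rightharpoonup> 'z)" where
  "partial_id X = Some |` topspace X"

definition partial_inv :: "('z \<rightharpoonup> 'z) \<Rightarrow> ('z \<rightharpoonup> 'z)" where
  "partial_inv f = (\<lambda>y. if y \<in> ran f then Some (THE x. f x = Some y) else None)"

definition pseudostargroup :: "'z topology \<Rightarrow> ('z \<rightharpoonup> 'z) set \<Rightarrow> bool" where
  "pseudostargroup X S \<longleftrightarrow>
     S \<subseteq> Ph X \<and>
     partial_id X \<in> S \<and>
     (\<forall>f\<in>S. partial_inv f \<in> S) \<and>
     (\<forall>f\<in>S. \<forall>g\<in>S. g \<circ>\<^sub>m f \<in> S) \<and>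
     (\<forall>f\<in>S. \<forall>V. openin X V \<and> V \<subseteq> dom f \<longrightarrow> f |` V \<in> S)"

definition pseudogroup :: "'z topology \<Rightarrow> ('z \<rightharpoonup> 'z) set \<Rightarrow> bool" where
  "pseudogroup X G \<longleftrightarrow>
     pseudostargroup X G \<and>
     (\<forall>f\<in>Ph X.
        (\<forall>x\<in>dom f. \<exists>V. openin X V \<and> x \<in> V \<and> V \<subseteq> dom f \<and> f |` V \<in> G) \<longrightarrow> f \<in> G)"

definition generates :: "'z topology \<Rightarrow> ('z \<rightharpoonup> 'z) set \<Rightarrow> ('z \<rightharpoonup> 'z) set \<Rightarrow> bool" where
  "generates X S G \<longleftrightarrow>
     pseudogroup X G \<and> S \<subseteq> G \<and> (\<forall>H. pseudogroup X H \<and> S \<subseteq> H \<longrightarrow> G \<subseteq> H)"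

definition topologically_transitive :: "'z topology \<Rightarrow> ('z \<rightharpoonup> 'z) set \<Rightarrow> bool" where
  "topologically_transitive X G \<longleftrightarrow>
     (\<forall>U V. openin X U \<and> U \<noteq> {} \<and> openin X V \<and> V \<noteq> {} \<longrightarrow>
        (\<exists>g\<in>G. \<exists>x\<in>U \<inter> dom g. the (g x) \<in> V))"

text \<open>Metrics may take the value \<open>\<infinity>\<close>.\<close>

definition compatible_metric :: "'z topology \<Rightarrow> ('z \<Rightarrow> 'z \<Rightarrow> ennreal) \<Rightarrow> bool" where
  "compatible_metric X d \<longleftrightarrow>
     (\<forall>x\<in>topspace X. \<forall>y\<in>topspace X. d x y = 0 \<longleftrightarrow> x = y) \<and>
     (\<forall>x\<in>topspace X. \<forall>y\<in>topspace X. d x y = d y x) \<and>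
     (\<forall>x\<in>topspace X. \<forall>y\<in>topspace X. \<forall>z\<in>topspace X. d x z \<le> d x y + d y z) \<and>
     X = topology_generated_by
           {{y \<in> topspace X. d x y < ennreal r} | x r. x \<in> topspace X \<and> 0 < r}"

definition sensitive :: "'z topology \<Rightarrow> ('z \<rightharpoonup> 'z) set \<Rightarrow> bool" where
  "sensitive X G \<longleftrightarrow>
     (\<forall>d S. compatible_metric X d \<and> pseudostargroup X S \<and> S \<subseteq> G \<and> generates X S G \<longrightarrow>
        (\<exists>c::real. 0 < c \<and>
           (\<forall>x\<in>topspace X. \<forall>r::real. 0 < r \<longrightarrow>
              (\<exists>s\<in>S. \<exists>y. x \<in> dom s \<and> y \<in> dom s \<and>
                 d x y < ennreal r \<and> ennreal c \<le> d (the (s x)) (the (s y))))))"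


section \<open>Foliations by surfaces\<close>

text \<open>A foliated atlas on \<open>M\<close> consists of homeomorphisms \<open>\<phi> i : U i \<rightarrow> \<real>\<^sup>2 \<times> Z i\<close> for \<open>i \<in> I\<close>.
  The last condition says that in a coordinate change
  \<open>(x\<^sub>j, z\<^sub>j) \<mapsto> (x\<^sub>i, z\<^sub>i)\<close> the coordinate \<open>z\<^sub>i\<close> is a function of \<open>z\<^sub>j\<close>
  alone, on the whole of \<open>U i \<inter> U j\<close>.\<close>

definition foliated_atlas ::
  "'m topology \<Rightarrow> 'i set \<Rightarrow> ('i \<Rightarrow> 'm set) \<Rightarrow> ('i \<Rightarrow> 'z topology) \<Rightarrow>
   ('i \<Rightarrow> 'm \<Rightarrow> (real^2) \<times> 'z) \<Rightarrow> bool" where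
  "foliated_atlas M I U Z \<phi> \<longleftrightarrow>
     (\<forall>i\<in>I. openin M (U i) \<and> surface (Z i) \<and>
        homeomorphic_map (subtopology M (U i)) (prod_topology euclidean (Z i)) (\<phi> i)) \<and>
     (\<Union>i\<in>I. U i) = topspace M \<and>
     (\<forall>x\<in>topspace M. \<exists>N. openin M N \<and> x \<in> N \<and> finite {i\<in>I. U i \<inter> N \<noteq> {}}) \<and>
     (\<forall>i\<in>I. \<forall>j\<in>I. \<exists>h. \<forall>x\<in>U i \<inter> U j. snd (\<phi> i x) = h (snd (\<phi> j x)))"

text \<open>The leaf topology on the underlying set of \<open>M\<close> is generated by the open subsets of the
  plaques \<open>(\<phi> i)\<^sup>-\<^sup>1(\<real>\<^sup>2 \<times> {z})\<close>; the leaves are its connected components.\<close>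

definition leaf_topology ::
  "'i set \<Rightarrow> ('i \<Rightarrow> 'm set) \<Rightarrow> ('i \<Rightarrow> 'z topology) \<Rightarrow>
   ('i \<Rightarrow> 'm \<Rightarrow> (real^2) \<times> 'z) \<Rightarrow> 'm topology" where
  "leaf_topology I U Z \<phi> = topology_generated_by
     {{x \<in> U i. fst (\<phi> i x) \<in> V \<and> snd (\<phi> i x) = z} | i V z.
        i \<in> I \<and> open V \<and> z \<in> topspace (Z i)}"

definition leaves ::
  "'i set \<Rightarrow> ('i \<Rightarrow> 'm set) \<Rightarrow> ('i \<Rightarrow> 'z topology) \<Rightarrow>
   ('i \<Rightarrow> 'm \<Rightarrow> (real^2) \<times> 'z) \<Rightarrow> 'm set set" where
  "leaves I U Z \<phi> = connected_components_of (leaf_topology I U Z \<phi>)"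

definition dense_compact_leaves ::
  "'m topology \<Rightarrow> 'i set \<Rightarrow> ('i \<Rightarrow> 'm set) \<Rightarrow> ('i \<Rightarrow> 'z topology) \<Rightarrow>
   ('i \<Rightarrow> 'm \<Rightarrow> (real^2) \<times> 'z) \<Rightarrow> bool" where
  "dense_compact_leaves M I U Z \<phi> \<longleftrightarrow>
     M closure_of \<Union>{L \<in> leaves I U Z \<phi>. compactin (leaf_topology I U Z \<phi>) L} = topspace M"

text \<open>The transition map \<open>h\<^sub>i\<^sub>j : p\<^sub>j(U\<^sub>i \<inter> U\<^sub>j) \<rightarrow> p\<^sub>i(U\<^sub>i \<inter> U\<^sub>j)\<close>, where \<open>p\<^sub>i = snd \<circ> \<phi> i\<close>.
  For a foliated atlas its value does not depend on the preimage chosen by \<open>inv_into\<close>.\<close>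

definition transition_map ::
  "('i \<Rightarrow> 'm set) \<Rightarrow> ('i \<Rightarrow> 'm \<Rightarrow> (real^2) \<times> 'z) \<Rightarrow> 'i \<Rightarrow> 'i \<Rightarrow> 'z \<Rightarrow> 'z" where
  "transition_map U \<phi> i j = (snd \<circ> \<phi> i) \<circ> inv_into (U i \<inter> U j) (snd \<circ> \<phi> j)"

definition transition_dom ::
  "('i \<Rightarrow> 'm set) \<Rightarrow> ('i \<Rightarrow> 'm \<Rightarrow> (real^2) \<times> 'z) \<Rightarrow> 'i \<Rightarrow> 'i \<Rightarrow> 'z set" where
  "transition_dom U \<phi> i j = (snd \<circ> \<phi> j) ` (U i \<inter> U j)"

text \<open>\<open>h\<^sub>i\<^sub>j\<close> as a partial map of the disjoint union of the transversals, whose points are the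
  pairs \<open>(k, z)\<close> with \<open>k \<in> I\<close> and \<open>z \<in> topspace (Z k)\<close>.\<close>

definition holonomy_map ::
  "('i \<Rightarrow> 'm set) \<Rightarrow> ('i \<Rightarrow> 'm \<Rightarrow> (real^2) \<times> 'z) \<Rightarrow> 'i \<Rightarrow> 'i \<Rightarrow> ('i \<times> 'z \<rightharpoonup> 'i \<times> 'z)" where
  "holonomy_map U \<phi> i j =
     (\<lambda>(k, z). if k = j \<and> z \<in> transition_dom U \<phi> i j
               then Some (i, transition_map U \<phi> i j z) else None)"

definition transversal :: "'i set \<Rightarrow> ('i \<Rightarrow> 'z topology) \<Rightarrow> ('i \<times> 'z) topology" where
  "transversal I Z = sum_topology Z I"

definition holonomy_pseudogroup ::
  "'i set \<Rightarrow> ('i \<Rightarrow> 'm set) \<Rightarrow> ('i \<Rightarrow> 'z topology) \<Rightarrow>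
   ('i \<Rightarrow> 'm \<Rightarrow> (real^2) \<times> 'z) \<Rightarrow> ('i \<times> 'z \<rightharpoonup> 'i \<times> 'z) set" where
  "holonomy_pseudogroup I U Z \<phi> =
     pseudogroup (transversal I Z) hull {holonomy_map U \<phi> i j | i j. i \<in> I \<and> j \<in> I}"

definition topologically_transitive_foliation ::
  "'i set \<Rightarrow> ('i \<Rightarrow> 'm set) \<Rightarrow> ('i \<Rightarrow> 'z topology) \<Rightarrow>
   ('i \<Rightarrow> 'm \<Rightarrow> (real^2) \<times> 'z) \<Rightarrow> bool" where
  "topologically_transitive_foliation I U Z \<phi> \<longleftrightarrow>
     topologically_transitive (transversal I Z) (holonomy_pseudogroup I U Z \<phi>)"

definition sensitive_foliation ::
  "'i set \<Rightarrow> ('i \<Rightarrow> 'm set) \<Rightarrow> ('i \<Rightarrow> 'z topology) \<Rightarrow>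
   ('i \<Rightarrow> 'm \<Rightarrow> (real^2) \<times> 'z) \<Rightarrow> bool" where
  "sensitive_foliation I U Z \<phi> \<longleftrightarrow>
     sensitive (transversal I Z) (holonomy_pseudogroup I U Z \<phi>)"

text \<open>The foliated charts are diffeomorphisms for the smooth structure \<open>\<A>\<close> of \<open>M\<close> and the smooth
  structures \<open>\<B> i\<close> of the transversals.\<close>

definition smooth_foliated_atlas ::
  "'m topology \<Rightarrow> ('m set \<times> ('m \<Rightarrow> real^4)) set \<Rightarrow>
   'i set \<Rightarrow> ('i \<Rightarrow> 'm set) \<Rightarrow> ('i \<Rightarrow> 'z topology) \<Rightarrow>
   ('i \<Rightarrow> ('z set \<times> ('z \<Rightarrow> real^2)) set) \<Rightarrow>
   ('i \<Rightarrow> 'm \<Rightarrow> (real^2) \<times> 'z) \<Rightarrow> bool" where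
  "smooth_foliated_atlas M \<A> I U Z \<B> \<phi> \<longleftrightarrow>
     foliated_atlas M I U Z \<phi> \<and>
     (\<forall>i\<in>I. smooth_atlas (Z i) (\<B> i) \<and>
        in_charts smooth_on \<A> (plane_times_atlas (\<B> i)) (U i) (\<phi> i) \<and>
        in_charts smooth_on (plane_times_atlas (\<B> i)) \<A>
          (UNIV \<times> topspace (Z i)) (inv_into (U i) (\<phi> i)))"

text \<open>The atlases \<open>\<B> i\<close> are affine structures of the transversals for which the maps \<open>h\<^sub>i\<^sub>j\<close> are
  affine.\<close>

definition transversally_affine ::
  "'i set \<Rightarrow> ('i \<Rightarrow> 'm set) \<Rightarrow> ('i \<Rightarrow> 'z topology) \<Rightarrow>
   ('i \<Rightarrow> ('z set \<times> ('z \<Rightarrow> real^2)) set) \<Rightarrow>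
   ('i \<Rightarrow> 'm \<Rightarrow> (real^2) \<times> 'z) \<Rightarrow> bool" where
  "transversally_affine I U Z \<B> \<phi> \<longleftrightarrow>
     (\<forall>i\<in>I. affine_atlas (Z i) (\<B> i)) \<and>
     (\<forall>i\<in>I. \<forall>j\<in>I.
        in_charts locally_affine_on (\<B> j) (\<B> i)
          (transition_dom U \<phi> i j) (transition_map U \<phi> i j))"

text \<open>Every Hausdorff second countable manifold has at most continuum many points, and a locally
  finite cover of it has only countably many nonempty members.  An existence statement therefore
  loses no generality by drawing the points of \<open>M\<close> and of the \<open>Z i\<close> from fixed types of the
  cardinality of the continuum and the indices from \<open>nat\<close>.  The topologies on these points are
  arbitrary, unrelated to the standard ones of these types.\<close>

type_synonym point4 = "nat \<Rightarrow> real"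

type_synonym point2 = "real^2"

end

theory Submission
  imports Defs
begin

text \<open>The transverse dynamics is the baker map \<open>B\<close> of the open unit square. Where \<open>x < 1/2\<close>
  it is \<open>(x, y) \<mapsto> (2x, y/2)\<close>, and where \<open>x > 1/2\<close> it is \<open>(x, y) \<mapsto> (2x - 1, (y + 1)/2)\<close>. The walls
  are deleted rather than identified: \<open>B\<close> is a locally affine homeomorphism from the square without
  the segment \<open>x = 1/2\<close> onto the square without the segment \<open>y = 1/2\<close>. The \<open>4\<close>-manifold is the
  suspension of this partial map times a circle: its points are triples \<open>(w, v, z)\<close> with \<open>w\<close> and \<open>v\<close>
  on the unit circle and \<open>z\<close> in the square, where \<open>z\<close> avoids the first wall if \<open>w = 1\<close>, and crossing
  \<open>w = 1\<close> in the positive direction changes \<open>z\<close> to \<open>B z\<close>. The leaves are the surfaces swept out by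
  \<open>w\<close> and \<open>v\<close>; two points \<open>z\<close> lie on the same leaf if and only if they lie on the same \<open>B\<close>-orbit.

  \<^item> A periodic orbit of \<open>B\<close> is a finite set that avoids both walls and is preserved by all holonomy
    maps, so it gives compact leaves (\<open>compact_leaf_of_finite_saturated\<close>). These leaves are tori.
  \<^item> In binary expansions \<open>B\<close> is the shift. An iterate of \<open>B\<close> maps a dyadic vertical strip
    affinely onto a dyadic horizontal strip, and the digits of both strips can be prescribed
    (\<open>branch_approx\<close>). The fixed points of these iterates are dense (\<open>dense_baker_cycles\<close>), and
    the iterates themselves give topological transitivity (\<open>baker_transitive\<close>).
  \<^item> The manifold is not compact, and some compact leaves escape to its end. On the
    left half of the square \<open>B\<close> preserves the product \<open>x y\<close>. The periodic orbit whose binary code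
    repeats a single \<open>1\<close> followed by \<open>m\<close> zeros visits the right half once in each period, and \<open>x y\<close> is
    constant along the whole orbit; this constant tends to \<open>0\<close> as \<open>m\<close> grows
    (\<open>small_baker_cycles\<close>).

  The last point defeats sensitivity. Put the Euclidean metric on each transversal, distance
  \<open>\<infinity>\<close> between different transversals, and cut the generators of the holonomy pseudogroup into
  pieces whose domain and image, near a point \<open>z\<close>, have diameter at most \<open>\<rho>(z) = x y\<close>. Compositions
  of such pieces inherit the bound on their last step. Given \<open>c > 0\<close>, all holonomy images of a point
  on an orbit with \<open>\<rho> < c\<close> again satisfy \<open>\<rho> < c\<close>, so no composition moves a neighbour of
  that point to distance \<open>c\<close> (\<open>not_sensitiveI\<close>). Since
  sensitivity is a statement about all compatible metrics and all generating pseudo\<open>*\<close>groups, this one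
  choice refutes it.

  Both circles are covered by four open semicircles, on which the tangent of the angle is a coordinate
  with values in all of \<open>\<real>\<close>; consecutive coordinates are related by \<open>x \<mapsto> -1/x\<close>. All
  coordinate changes are therefore built from \<open>x \<mapsto> -1/x\<close>, the identity and the locally affine
  maps \<open>B\<close> and its inverse, which makes the foliation \<open>C\<^sup>\<infinity>\<close> and transversally affine.\<close>

section \<open>Smooth and locally affine maps\<close>

lemma Ck_on_cong:
  assumes "open S" "\<And>x. x \<in> S \<Longrightarrow> f x = g x" "Ck_on k S g"
  shows "Ck_on k S f"
  using assms(2,3)
proof (induction k arbitrary: f g)
  case 0
  then show ?case by (simp cong: continuous_on_cong_simp)
next
  case (Suc k)
  have diff: "f differentiable (at x)" if "x \<in> S" for x
    using Suc.prems that assms(1) unfolding differentiable_def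
    by (metis Ck_on.simps(2) differentiable_def has_derivative_transform_within_open)
  have "frechet_derivative f (at x) = frechet_derivative g (at x)" if "x \<in> S" for x
    using frechet_derivative_transform_within_open[OF diff[OF that] assms(1) that] Suc.prems(1) by blast
  then have "Ck_on k S (\<lambda>x. frechet_derivative f (at x) v)" for v
    using Suc.IH[of "\<lambda>x. frechet_derivative f (at x) v" "\<lambda>x. frechet_derivative g (at x) v"] Suc.prems(2)
    by simp
  with diff show ?case by simp
qed

text \<open>Order by order, being \<open>C\<^sup>k\<close> is a condition at each point. This reduces locally affine maps, which
  may be given by different formulas on different components, to affine ones.\<close>

lemma Ck_on_local:
  assumes "\<And>x. x \<in> S \<Longrightarrow> \<exists>V. open V \<and> x \<in> V \<and> Ck_on k V f"
  shows "Ck_on k S f"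
  using assms
proof (induction k arbitrary: f)
  case 0
  then show ?case
    by (metis Ck_on.simps(1) continuous_at_imp_continuous_on continuous_on_eq_continuous_at)
next
  case (Suc k)
  have "f differentiable (at x)" if "x \<in> S" for x
    using Suc.prems[OF that] by auto
  moreover have "Ck_on k S (\<lambda>x. frechet_derivative f (at x) v)" for v
    using Suc.prems by (intro Suc.IH) fastforce
  ultimately show ?case by simp
qed

lemma Ck_on_subset: "Ck_on k S f \<Longrightarrow> T \<subseteq> S \<Longrightarrow> Ck_on k T f"
  by (induction k arbitrary: f) (auto intro: continuous_on_subset)

lemma Ck_on_affine: 
  assumes "linear A" shows "Ck_on k S (\<lambda>x. A x + b)"
  using assms
proof (induction k arbitrary: A b)
  case 0
  then show ?case by (simp add: continuous_on_add linear_continuous_on linear_linear)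
next
  case (Suc k)
  have D: "((\<lambda>x. A x + b) has_derivative A) (at x)" for x
    using Suc.prems by (auto intro!: derivative_eq_intros bounded_linear_imp_has_derivative 
        simp: linear_conv_bounded_linear)
  have "Ck_on k S (\<lambda>x. frechet_derivative (\<lambda>x. A x + b) (at x) v)" for v
    using Suc.IH[of "\<lambda>x. 0" "A v"] frechet_derivative_at[OF D] by (simp add: linear_zero)
  with D show ?case unfolding Ck_on.simps differentiable_def by blast
qed

text \<open>The family of maps \<open>p \<mapsto> (l p)\<^sup>-\<^sup>n w\<close> with \<open>l\<close> linear is closed under directional
  derivatives, so induction on the order of differentiation closes. The coordinate changes use the
  case \<open>n = 1\<close>.\<close>

lemma Ck_on_inverse_power:
  assumes l: "linear l" and nz: "\<And>x. x \<in> S \<Longrightarrow> l x \<noteq> (0::real)" and "open S"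
  shows "Ck_on k S (\<lambda>x. inverse (l x) ^ n *\<^sub>R w)"
proof (induction k arbitrary: n w)
  case 0
  have "continuous_on S l"
    using l by (simp add: linear_continuous_on linear_linear)
  then show ?case using nz by (auto intro!: continuous_intros)
next
  case (Suc k)
  have D: "((\<lambda>x. inverse (l x) ^ n *\<^sub>R w) has_derivative
      (\<lambda>v. inverse (l x) ^ Suc n *\<^sub>R ((- real n * l v) *\<^sub>R w))) (at x)" if "x \<in> S" for x
  proof -
    have *: "(l has_derivative l) (at x)"
      using l by (simp add: bounded_linear_imp_has_derivative linear_linear)
    show ?thesis
      by (rule derivative_eq_intros * refl nz[OF that])+
        (cases n; simp add: fun_eq_iff algebra_simps)
  qed
  have "Ck_on k S (\<lambda>x. frechet_derivative (\<lambda>x. inverse (l x) ^ n *\<^sub>R w) (at x) v)" for v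
  proof (rule Ck_on_cong[OF \<open>open S\<close>])
    show "frechet_derivative (\<lambda>x. inverse (l x) ^ n *\<^sub>R w) (at x) v =
      inverse (l x) ^ Suc n *\<^sub>R ((- real n * l v) *\<^sub>R w)" if "x \<in> S" for x
      using frechet_derivative_at[OF D[OF that]] by metis
  qed (rule Suc.IH)
  with D show ?case unfolding Ck_on.simps differentiable_def by blast
qed

lemma Ck_on_add:
  assumes "open S" "Ck_on k S f" "Ck_on k S g"
  shows "Ck_on k S (\<lambda>x. f x + g x)"
  using assms(2,3)
proof (induction k arbitrary: f g)
  case 0
  then show ?case by (simp add: continuous_on_add)
next
  case (Suc k)
  have "Ck_on k S (\<lambda>x. frechet_derivative (\<lambda>x. f x + g x) (at x) v)" for v
  proof (rule Ck_on_cong[OF \<open>open S\<close>])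
    show "frechet_derivative (\<lambda>x. f x + g x) (at x) v =
      frechet_derivative f (at x) v + frechet_derivative g (at x) v" if "x \<in> S" for x
    proof -
      have "((\<lambda>x. f x + g x) has_derivative
          (\<lambda>v. frechet_derivative f (at x) v + frechet_derivative g (at x) v)) (at x)"
        using Suc.prems that by (intro has_derivative_add) (simp_all add: frechet_derivative_works[symmetric])
      from frechet_derivative_at[OF this] show ?thesis by metis
    qed
  qed (use Suc in simp)
  with Suc.prems show ?case by simp
qed

lemma Ck_on_linear_compose:
  assumes "open S" "linear L" "Ck_on k S f"
  shows "Ck_on k S (\<lambda>x. L (f x))"
  using assms(3)
proof (induction k arbitrary: f)
  case 0
  then show ?case using assms(2)
    by (simp add: linear_continuous_on_compose)
next
  case (Suc k)
  have D: "((\<lambda>x. L (f x)) has_derivative (\<lambda>v. L (frechet_derivative f (at x) v))) (at x)" if "x \<in> S" for x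
  proof -
    have "bounded_linear L" "(f has_derivative frechet_derivative f (at x)) (at x)"
      using Suc.prems that assms(2)
      by (simp_all add: linear_conv_bounded_linear frechet_derivative_works[symmetric])
    then show ?thesis by (rule bounded_linear.has_derivative)
  qed
  have "Ck_on k S (\<lambda>x. frechet_derivative (\<lambda>x. L (f x)) (at x) v)" for v
  proof (rule Ck_on_cong[OF \<open>open S\<close>])
    show "frechet_derivative (\<lambda>x. L (f x)) (at x) v = L (frechet_derivative f (at x) v)" if "x \<in> S" for x
      using frechet_derivative_at[OF D[OF that]] by metis
  qed (use Suc in simp)
  with D show ?case unfolding Ck_on.simps differentiable_def by blast
qed

lemma Ck_on_compose_linear:
  assumes "open S" "linear L" "Ck_on k S f"
  shows "Ck_on k (L -` S) (\<lambda>x. f (L x))"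
  using assms(3)
proof (induction k arbitrary: f)
  case 0
  have "continuous_on (L -` S) L"
    using assms(2) by (simp add: linear_continuous_on linear_linear)
  with 0 show ?case
    by (auto intro!: continuous_on_compose2[of S f])
next
  case (Suc k)
  have op: "open (L -` S)"
    using assms(1,2) by (simp add: linear_continuous_on linear_linear open_vimage)
  have D: "((\<lambda>x. f (L x)) has_derivative (\<lambda>v. frechet_derivative f (at (L x)) (L v))) (at x)" 
    if "x \<in> L -` S" for x
  proof -
    have "(f has_derivative frechet_derivative f (at (L x))) (at (L x))"
      using Suc.prems that frechet_derivative_works by auto
    moreover have "(L has_derivative L) (at x)"
      using assms(2) by (simp add: bounded_linear_imp_has_derivative linear_linear)
    ultimately show ?thesis
      by (simp add: has_derivative_compose)
  qed
  have "Ck_on k (L -` S) (\<lambda>x. frechet_derivative (\<lambda>x. f (L x)) (at x) v)" for v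
  proof (rule Ck_on_cong[OF op])
    show "frechet_derivative (\<lambda>x. f (L x)) (at x) v = frechet_derivative f (at (L x)) (L v)" 
      if "x \<in> L -` S" for x
      using frechet_derivative_at[OF D[OF that]] by metis
  qed (use Suc.IH[of "\<lambda>x. frechet_derivative f (at x) (L v)" for v] Suc.prems in simp)
  with D show ?case unfolding Ck_on.simps differentiable_def by blast
qed

lemma smooth_on_locally_affine:
  assumes "open S" "locally_affine_on S f"
  shows "smooth_on S f"
  unfolding smooth_on_def
proof (intro allI Ck_on_local)
  fix k x assume "x \<in> S"
  then obtain V A b where V: "open V" "x \<in> V" "linear A" "\<forall>y\<in>V \<inter> S. f y = A y + b"
    using assms(2) unfolding locally_affine_on_def by blast
  have "Ck_on k (V \<inter> S) f"
    using V assms(1) by (intro Ck_on_cong[OF _ _ Ck_on_affine[of A k _ b]]) auto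
  then show "\<exists>V. open V \<and> x \<in> V \<and> Ck_on k V f"
    using V assms(1) \<open>x \<in> S\<close> by (intro exI[of _ "V \<inter> S"]) auto
qed

lemma locally_affine_on_cong:
  assumes "locally_affine_on T f" "S \<subseteq> T" "\<And>x. x \<in> S \<Longrightarrow> g x = f x"
  shows "locally_affine_on S g"
  unfolding locally_affine_on_def
proof
  fix x assume "x \<in> S"
  then have "x \<in> T" using assms(2) by auto
  with assms(1) obtain V A b where V: "open V" "x \<in> V" "linear A" "\<forall>y\<in>V \<inter> T. f y = A y + b"
    unfolding locally_affine_on_def by blast
  have "\<forall>y\<in>V \<inter> S. g y = A y + b" using V(4) assms(2,3) by auto
  with V(1-3) show "\<exists>V A b. open V \<and> x \<in> V \<and> linear A \<and> (\<forall>y\<in>V \<inter> S. g y = A y + b)"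
    by (intro exI conjI)
qed

lemma smooth_on_cong:
  assumes "open S" "smooth_on S g" "\<And>x. x \<in> S \<Longrightarrow> f x = g x"
  shows "smooth_on S f"
  using assms(2) unfolding smooth_on_def by (intro allI Ck_on_cong[OF assms(1,3)]) auto

lemma smooth_on_subset: "smooth_on S f \<Longrightarrow> S' \<subseteq> S \<Longrightarrow> smooth_on S' f"
  unfolding smooth_on_def using Ck_on_subset[of _ S f S'] by simp

lemma smooth_on_linear_compose:
  "open S \<Longrightarrow> linear K \<Longrightarrow> smooth_on S f \<Longrightarrow> smooth_on S (\<lambda>x. K (f x))"
  unfolding smooth_on_def by (intro allI Ck_on_linear_compose[where L = K and f = f]) simp_all

lemma smooth_on_compose_linear:
  "open S \<Longrightarrow> linear K \<Longrightarrow> smooth_on S f \<Longrightarrow> smooth_on (K -` S) (\<lambda>x. f (K x))"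
  unfolding smooth_on_def by (intro allI Ck_on_compose_linear[where L = K and f = f]) simp_all

lemma smooth_on_add:
  "open S \<Longrightarrow> smooth_on S f \<Longrightarrow> smooth_on S g \<Longrightarrow> smooth_on S (\<lambda>x. f x + g x)"
  unfolding smooth_on_def using Ck_on_add[of S _ f g] by simp

lemma locally_affine_on_id: "locally_affine_on S (\<lambda>x. x)"
  unfolding locally_affine_on_def
proof
  fix x :: 'a assume "x \<in> S"
  show "\<exists>V A b. open V \<and> x \<in> V \<and> linear A \<and> (\<forall>y\<in>V \<inter> S. y = A y + b)"
    by (rule exI[of _ UNIV], rule exI[of _ "\<lambda>x. x"], rule exI[of _ 0]) (simp add: linear_id[unfolded id_def])
qed

section \<open>Topological manifolds glued from charts\<close>

text \<open>Bijections \<open>\<phi> i\<close> from subsets \<open>U i\<close> of a bare set onto subsets \<open>E i\<close> of a Euclidean space, with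
  continuous changes of coordinates on open overlaps. The inverses \<open>\<psi> i\<close> are carried along because
  all conditions are checked in Euclidean space, through preimages under \<open>\<psi> i\<close>. Openness of the
  sets \<open>E i\<close> is the case \<open>i = j\<close> of the condition on overlaps.\<close>

locale gluing =
  fixes I :: "'i set" and U :: "'i \<Rightarrow> 'm set" and E :: "'i \<Rightarrow> 'e::euclidean_space set"
    and \<phi> :: "'i \<Rightarrow> 'm \<Rightarrow> 'e" and \<psi> :: "'i \<Rightarrow> 'e \<Rightarrow> 'm"
  assumes chart: "\<And>i p. i \<in> I \<Longrightarrow> p \<in> U i \<Longrightarrow> \<phi> i p \<in> E i \<and> \<psi> i (\<phi> i p) = p"
    and inverse_chart: "\<And>i e. i \<in> I \<Longrightarrow> e \<in> E i \<Longrightarrow> \<psi> i e \<in> U i \<and> \<phi> i (\<psi> i e) = e"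
    and open_overlap: "\<And>i j. i \<in> I \<Longrightarrow> j \<in> I \<Longrightarrow> open {e \<in> E i. \<psi> i e \<in> U j}"
    and continuous_change: "\<And>i j. i \<in> I \<Longrightarrow> j \<in> I \<Longrightarrow>
      continuous_on {e \<in> E i. \<psi> i e \<in> U j} (\<lambda>e. \<phi> j (\<psi> i e))"
begin

text \<open>The final topology for the maps \<open>\<psi> i\<close>.\<close>

definition glued :: "'m topology" where
  "glued = topology (\<lambda>V. V \<subseteq> (\<Union>i\<in>I. U i) \<and> (\<forall>i\<in>I. open {e \<in> E i. \<psi> i e \<in> V}))"

lemma open_chart_image: "i \<in> I \<Longrightarrow> open (E i)"
proof -
  assume "i \<in> I"
  moreover have "{e \<in> E i. \<psi> i e \<in> U i} = E i"
    using inverse_chart \<open>i \<in> I\<close> by auto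
  ultimately show ?thesis using open_overlap[of i i] by simp
qed

lemma openin_glued:
  "openin glued V \<longleftrightarrow> V \<subseteq> (\<Union>i\<in>I. U i) \<and> (\<forall>i\<in>I. open {e \<in> E i. \<psi> i e \<in> V})"
proof -
  have "istopology (\<lambda>V. V \<subseteq> (\<Union>i\<in>I. U i) \<and> (\<forall>i\<in>I. open {e \<in> E i. \<psi> i e \<in> V}))"
    unfolding istopology_def
  proof (intro conjI allI impI ballI)
    fix S T i assume *: "S \<subseteq> (\<Union>i\<in>I. U i) \<and> (\<forall>i\<in>I. open {e \<in> E i. \<psi> i e \<in> S})"
      "T \<subseteq> (\<Union>i\<in>I. U i) \<and> (\<forall>i\<in>I. open {e \<in> E i. \<psi> i e \<in> T})" "i \<in> I"
    have "{e \<in> E i. \<psi> i e \<in> S \<inter> T} = {e \<in> E i. \<psi> i e \<in> S} \<inter> {e \<in> E i. \<psi> i e \<in> T}" by auto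
    with * show "open {e \<in> E i. \<psi> i e \<in> S \<inter> T}" by auto
  next
    fix \<K> i assume *: "\<forall>K\<in>\<K>. K \<subseteq> (\<Union>i\<in>I. U i) \<and> (\<forall>i\<in>I. open {e \<in> E i. \<psi> i e \<in> K})" "i \<in> I"
    have "{e \<in> E i. \<psi> i e \<in> \<Union>\<K>} = (\<Union>K\<in>\<K>. {e \<in> E i. \<psi> i e \<in> K})" by auto
    with * show "open {e \<in> E i. \<psi> i e \<in> \<Union>\<K>}" by auto
  qed blast+
  then show ?thesis by (simp add: glued_def)
qed

lemma openin_domain: "i \<in> I \<Longrightarrow> openin glued (U i)"
  using open_overlap by (auto simp: openin_glued)

lemma topspace_glued: "topspace glued = (\<Union>i\<in>I. U i)"
proof
  show "topspace glued \<subseteq> (\<Union>i\<in>I. U i)"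
    using openin_glued openin_topspace by blast
  show "(\<Union>i\<in>I. U i) \<subseteq> topspace glued"
    using openin_domain openin_subset by blast
qed

lemma chart_image_overlap:
  assumes "i \<in> I"
  shows "\<phi> i ` (U i \<inter> V) = {e \<in> E i. \<psi> i e \<in> V}"
proof (intro equalityI subsetI)
  fix e assume "e \<in> \<phi> i ` (U i \<inter> V)"
  then show "e \<in> {e \<in> E i. \<psi> i e \<in> V}" using chart[OF assms] by auto
next
  fix e assume e: "e \<in> {e \<in> E i. \<psi> i e \<in> V}"
  show "e \<in> \<phi> i ` (U i \<inter> V)"
    using e inverse_chart[OF assms, of e] by (intro image_eqI[of _ _ "\<psi> i e"]) auto
qed

lemma chart_preimage:
  assumes "i \<in> I" "V \<subseteq> E i"
  shows "{p \<in> U i. \<phi> i p \<in> V} = \<psi> i ` V"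
proof (intro equalityI subsetI)
  fix p assume p: "p \<in> {p \<in> U i. \<phi> i p \<in> V}"
  show "p \<in> \<psi> i ` V" using p chart[OF assms(1), of p] by (intro image_eqI[of _ _ "\<phi> i p"]) auto
next
  fix p assume "p \<in> \<psi> i ` V"
  then show "p \<in> {p \<in> U i. \<phi> i p \<in> V}" using inverse_chart[OF assms(1)] assms(2) by auto
qed

text \<open>Seen in another chart, an open set of \<open>E i\<close> is its preimage under a coordinate change, which is
  open because the coordinate change is continuous on an open set.\<close>

lemma open_map_inverse_chart:
  assumes "i \<in> I" "open W" "W \<subseteq> E i"
  shows "openin glued (\<psi> i ` W)"
  unfolding openin_glued
proof (intro conjI ballI)
  show "\<psi> i ` W \<subseteq> (\<Union>i\<in>I. U i)" using assms inverse_chart by blast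
  fix j assume j: "j \<in> I"
  have "{e \<in> E j. \<psi> j e \<in> \<psi> i ` W} = {e \<in> E j. \<psi> j e \<in> U i} \<inter> (\<lambda>e. \<phi> i (\<psi> j e)) -` W"
  proof (intro equalityI subsetI)
    fix e assume "e \<in> {e \<in> E j. \<psi> j e \<in> \<psi> i ` W}"
    then obtain w where "e \<in> E j" "w \<in> W" "\<psi> j e = \<psi> i w" by auto
    then show "e \<in> {e \<in> E j. \<psi> j e \<in> U i} \<inter> (\<lambda>e. \<phi> i (\<psi> j e)) -` W"
      using inverse_chart[OF assms(1), of w] assms(3) by auto
  next
    fix e assume "e \<in> {e \<in> E j. \<psi> j e \<in> U i} \<inter> (\<lambda>e. \<phi> i (\<psi> j e)) -` W"
    then show "e \<in> {e \<in> E j. \<psi> j e \<in> \<psi> i ` W}"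
      using chart[OF assms(1), of "\<psi> j e"] by (auto simp: image_iff intro!: bexI[of _ "\<phi> i (\<psi> j e)"])
  qed
  then show "open {e \<in> E j. \<psi> j e \<in> \<psi> i ` W}"
    using continuous_open_preimage[OF continuous_change[OF j assms(1)] open_overlap[OF j assms(1)] assms(2)]
    by simp
qed

lemma continuous_map_from_glued:
  assumes "\<And>i. i \<in> I \<Longrightarrow> continuous_map (top_of_set (E i)) Y (f \<circ> \<psi> i)"
  shows "continuous_map glued Y f"
  unfolding continuous_map_def
proof (intro conjI allI impI)
  show "f \<in> topspace glued \<rightarrow> topspace Y"
  proof
    fix p assume "p \<in> topspace glued"
    then obtain i where "i \<in> I" "p \<in> U i" by (auto simp: topspace_glued)
    then show "f p \<in> topspace Y"
      using assms[of i] chart[of i p] by (auto simp: continuous_map_def Pi_iff dest!: bspec[of _ _ "\<phi> i p"])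
  qed
  fix V assume V: "openin Y V"
  show "openin glued {p \<in> topspace glued. f p \<in> V}"
    unfolding openin_glued
  proof (intro conjI ballI)
    fix i assume i: "i \<in> I"
    have "openin (top_of_set (E i)) {e \<in> E i. f (\<psi> i e) \<in> V}"
      using assms[OF i] V by (auto simp: continuous_map_def)
    then have "open {e \<in> E i. f (\<psi> i e) \<in> V}"
      using open_chart_image[OF i] openin_open_eq by blast
    moreover have "{e \<in> E i. f (\<psi> i e) \<in> V} = {e \<in> E i. \<psi> i e \<in> {p \<in> topspace glued. f p \<in> V}}"
      using inverse_chart[OF i] i by (auto simp: topspace_glued)
    ultimately show "open {e \<in> E i. \<psi> i e \<in> {p \<in> topspace glued. f p \<in> V}}" by simp
  qed (auto simp: topspace_glued)
qed

lemma homeomorphic_map_chart: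
  assumes "i \<in> I"
  shows "homeomorphic_map (subtopology glued (U i)) (top_of_set (E i)) (\<phi> i)"
proof (rule bijective_open_imp_homeomorphic_map)
  have tU: "topspace (subtopology glued (U i)) = U i"
    using openin_subset[OF openin_domain[OF assms]] by (simp add: inf.absorb2)
  show "continuous_map (subtopology glued (U i)) (top_of_set (E i)) (\<phi> i)"
    unfolding continuous_map_def tU
  proof (intro conjI allI impI)
    show "\<phi> i \<in> U i \<rightarrow> topspace (top_of_set (E i))" using chart assms by auto
    fix V assume "openin (top_of_set (E i)) V"
    then have V: "open V" "V \<subseteq> E i"
      using open_chart_image[OF assms] openin_open_eq by blast+
    have "{p \<in> U i. \<phi> i p \<in> V} = \<psi> i ` V"
      using V(2) assms by (rule chart_preimage[rotated])
    then show "openin (subtopology glued (U i)) {p \<in> U i. \<phi> i p \<in> V}"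
      using open_map_inverse_chart[OF assms V] openin_open_subtopology[OF openin_domain[OF assms]] by auto
  qed
  show "open_map (subtopology glued (U i)) (top_of_set (E i)) (\<phi> i)"
    unfolding open_map_def
  proof (intro allI impI)
    fix V assume "openin (subtopology glued (U i)) V"
    then have V: "openin glued V" "V \<subseteq> U i"
      using openin_open_subtopology[OF openin_domain[OF assms]] by auto
    have "\<phi> i ` V = {e \<in> E i. \<psi> i e \<in> V}"
      using chart_image_overlap[OF assms, of V] V(2) by (simp add: inf.absorb2)
    then show "openin (top_of_set (E i)) (\<phi> i ` V)"
      using V(1) assms open_chart_image[OF assms] by (auto simp: openin_glued openin_open_eq)
  qed
  show "\<phi> i ` topspace (subtopology glued (U i)) = topspace (top_of_set (E i))"
    unfolding tU
    using chart_image_overlap[OF assms, of "U i"] inverse_chart[OF assms] by auto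
  show "inj_on (\<phi> i) (topspace (subtopology glued (U i)))"
    unfolding tU using chart[OF assms] by (intro inj_on_inverseI[of _ "\<psi> i"]) blast
qed

lemma inv_into_chart: "i \<in> I \<Longrightarrow> e \<in> E i \<Longrightarrow> inv_into (U i) (\<phi> i) e = \<psi> i e"
  using chart inverse_chart by (intro inv_into_f_eq inj_on_inverseI[of _ "\<psi> i"]) blast+

lemma second_countable_glued:
  assumes "countable I"
  shows "second_countable glued"
proof -
  obtain B :: "'e set set" where B: "countable B" "topological_basis B"
    using ex_countable_basis by blast
  define \<B> where "\<B> = (\<lambda>(i, b). \<psi> i ` (b \<inter> E i)) ` (I \<times> B)"
  show ?thesis unfolding second_countable_def
  proof (intro exI[of _ \<B>] conjI allI impI ballI)
    show "countable \<B>" using assms B by (simp add: \<B>_def)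
    show "openin glued V" if "V \<in> \<B>" for V
      using that B(2) open_chart_image
      by (auto simp: \<B>_def topological_basis_open intro!: open_map_inverse_chart)
    fix W p assume Wp: "openin glued W \<and> p \<in> W"
    then obtain i where i: "i \<in> I" "p \<in> U i" by (auto simp: openin_glued)
    have "open {e \<in> E i. \<psi> i e \<in> W}" "\<phi> i p \<in> {e \<in> E i. \<psi> i e \<in> W}"
      using Wp i chart[OF i] by (simp_all add: openin_glued)
    with B(2) obtain b where b: "b \<in> B" "\<phi> i p \<in> b" "b \<subseteq> {e \<in> E i. \<psi> i e \<in> W}"
      by (rule topological_basisE)
    have "p \<in> \<psi> i ` (b \<inter> E i)"
      using b i chart[OF i] by (intro image_eqI[of _ _ "\<phi> i p"]) auto
    moreover have "\<psi> i ` (b \<inter> E i) \<subseteq> W" using b by auto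
    moreover have "\<psi> i ` (b \<inter> E i) \<in> \<B>" using i b by (auto simp: \<B>_def)
    ultimately show "\<exists>V\<in>\<B>. p \<in> V \<and> V \<subseteq> W" by (intro bexI conjI)
  qed
qed

text \<open>Points with different values under a continuous map to a Hausdorff space are separated by that map,
  and points of a common chart are separated there. For a suspension the map records the position
  on the base, so only points of the same fibre have to share a chart.\<close>

lemma Hausdorff_glued:
  assumes cont: "continuous_map glued Y f" and "Hausdorff_space Y"
    and same: "\<And>p q. p \<in> topspace glued \<Longrightarrow> q \<in> topspace glued \<Longrightarrow> f p = f q \<Longrightarrow>
      \<exists>i\<in>I. p \<in> U i \<and> q \<in> U i"
  shows "Hausdorff_space glued"
  unfolding Hausdorff_space_def
proof (intro allI impI, elim conjE)
  fix p q assume p: "p \<in> topspace glued" and q: "q \<in> topspace glued" and "p \<noteq> q"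
  show "\<exists>V W. openin glued V \<and> openin glued W \<and> p \<in> V \<and> q \<in> W \<and> disjnt V W"
  proof (cases "f p = f q")
    case True
    then obtain i where i: "i \<in> I" "p \<in> U i" "q \<in> U i" using same p q by blast
    then have "\<phi> i p \<noteq> \<phi> i q" using chart \<open>p \<noteq> q\<close> by metis
    then obtain V W where VW: "open V" "open W" "\<phi> i p \<in> V" "\<phi> i q \<in> W" "V \<inter> W = {}"
      using hausdorff[of "\<phi> i p" "\<phi> i q"] by metis
    show ?thesis
    proof (intro exI conjI)
      show "openin glued (\<psi> i ` (V \<inter> E i))" "openin glued (\<psi> i ` (W \<inter> E i))"
        using VW i open_chart_image by (auto intro!: open_map_inverse_chart)
      show "p \<in> \<psi> i ` (V \<inter> E i)"
        using VW chart[OF i(1,2)] by (intro image_eqI[of p _ "\<phi> i p"]) simp_all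
      show "q \<in> \<psi> i ` (W \<inter> E i)"
        using VW chart[OF i(1,3)] by (intro image_eqI[of q _ "\<phi> i q"]) simp_all
      show "disjnt (\<psi> i ` (V \<inter> E i)) (\<psi> i ` (W \<inter> E i))"
      proof -
        have *: "\<phi> i r \<in> S" if "r \<in> \<psi> i ` (S \<inter> E i)" for r S
          using that inverse_chart[OF i(1)] by auto
        show ?thesis unfolding disjnt_iff using *[of _ V] *[of _ W] VW(5) by auto
      qed
    qed
  next
    case False
    have fpq: "f p \<in> topspace Y" "f q \<in> topspace Y"
      using cont p q by (auto simp: continuous_map_def)
    with False assms(2) obtain V W where VW: "openin Y V" "openin Y W" "f p \<in> V" "f q \<in> W" "disjnt V W"
      unfolding Hausdorff_space_def by blast
    then have "openin glued {p \<in> topspace glued. f p \<in> V}" "openin glued {p \<in> topspace glued. f p \<in> W}"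
      using cont by (auto simp: continuous_map_def)
    with VW p q show ?thesis
      by (intro exI[of _ "{p \<in> topspace glued. f p \<in> V}"] exI[of _ "{p \<in> topspace glued. f p \<in> W}"])
        (auto simp: disjnt_iff)
  qed
qed

end

section \<open>Pseudogroups and tame generating sets\<close>

text \<open>A symmetric description of partial homeomorphisms: injective, with open preimages and open images of
  open sets. Closure under inversion, composition and restriction can be read off from it.\<close>

lemma Ph_iff:
  "f \<in> Ph X \<longleftrightarrow> dom f \<subseteq> topspace X \<and> ran f \<subseteq> topspace X \<and> inj_on f (dom f) \<and>
     (\<forall>V. openin X V \<longrightarrow> openin X {x. \<exists>y\<in>V. f x = Some y}) \<and>
     (\<forall>V. openin X V \<longrightarrow> openin X {y. \<exists>x\<in>V. f x = Some y})"
  (is "?L \<longleftrightarrow> ?R")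
proof
  assume L: ?L
  then have o: "openin X (dom f)" "openin X (ran f)"
    and h: "homeomorphic_map (subtopology X (dom f)) (subtopology X (ran f)) (the \<circ> f)"
    by (auto simp: Ph_def)
  have ts: "topspace (subtopology X (dom f)) = dom f" "topspace (subtopology X (ran f)) = ran f"
    using openin_subset[OF o(1)] openin_subset[OF o(2)] by (simp_all add: inf.absorb2)
  have inj: "inj_on (the \<circ> f) (dom f)"
    using homeomorphic_imp_injective_map[OF h] ts by simp
  have "inj_on f (dom f)"
    using inj by (simp add: inj_on_def)
  moreover have "openin X {x. \<exists>y\<in>V. f x = Some y}" if V: "openin X V" for V
  proof -
    have "openin (subtopology X (ran f)) (V \<inter> ran f)"
      using V openin_subtopology by blast
    then have "openin (subtopology X (dom f)) {x \<in> dom f. (the \<circ> f) x \<in> V \<inter> ran f}"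
      using openin_continuous_map_preimage[OF homeomorphic_imp_continuous_map[OF h]] unfolding ts by blast
    then have "openin X {x \<in> dom f. (the \<circ> f) x \<in> V \<inter> ran f}"
      using openin_open_subtopology[OF o(1)] by blast
    moreover have "{x \<in> dom f. (the \<circ> f) x \<in> V \<inter> ran f} = {x. \<exists>y\<in>V. f x = Some y}"
      by (auto intro: ranI)
    ultimately show ?thesis by simp
  qed
  moreover have "openin X {y. \<exists>x\<in>V. f x = Some y}" if V: "openin X V" for V
  proof -
    have "openin (subtopology X (dom f)) (V \<inter> dom f)"
      using V openin_subtopology by blast
    then have "openin (subtopology X (ran f)) ((the \<circ> f) ` (V \<inter> dom f))"
      using homeomorphic_imp_open_map[OF h] by (auto simp: open_map_def)
    then have "openin X ((the \<circ> f) ` (V \<inter> dom f))"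
      using openin_open_subtopology[OF o(2)] by blast
    moreover have "(the \<circ> f) ` (V \<inter> dom f) = {y. \<exists>x\<in>V. f x = Some y}"
      by force
    ultimately show ?thesis by simp
  qed
  ultimately show ?R using openin_subset[OF o(1)] openin_subset[OF o(2)] by blast
next
  assume R: ?R
  have o: "openin X (dom f)" "openin X (ran f)"
  proof -
    have "dom f = {x. \<exists>y\<in>topspace X. f x = Some y}"
      using R by (auto intro: ranI)
    then show "openin X (dom f)" using R by auto
    have "ran f = {y. \<exists>x\<in>topspace X. f x = Some y}"
      using R by (auto simp: ran_def)
    then show "openin X (ran f)" using R by auto
  qed
  have ts: "topspace (subtopology X (dom f)) = dom f" "topspace (subtopology X (ran f)) = ran f"
    using R by (simp_all add: inf.absorb2)
  have "homeomorphic_map (subtopology X (dom f)) (subtopology X (ran f)) (the \<circ> f)"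
  proof (rule bijective_open_imp_homeomorphic_map)
    show "continuous_map (subtopology X (dom f)) (subtopology X (ran f)) (the \<circ> f)"
      unfolding continuous_map_def ts
    proof (intro conjI allI impI)
      show "the \<circ> f \<in> dom f \<rightarrow> ran f" by (auto intro: ranI)
      fix V assume "openin (subtopology X (ran f)) V"
      then have "openin X V" using openin_open_subtopology[OF o(2)] by blast
      then have "openin X {x. \<exists>y\<in>V. f x = Some y}" using R by blast
      moreover have "{x \<in> dom f. (the \<circ> f) x \<in> V} = {x. \<exists>y\<in>V. f x = Some y}" by auto
      ultimately show "openin (subtopology X (dom f)) {x \<in> dom f. (the \<circ> f) x \<in> V}"
        unfolding openin_open_subtopology[OF o(1)] by auto
    qed
    show "open_map (subtopology X (dom f)) (subtopology X (ran f)) (the \<circ> f)"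
      unfolding open_map_def
    proof (intro allI impI)
      fix V assume "openin (subtopology X (dom f)) V"
      then have V: "openin X V" "V \<subseteq> dom f" using openin_open_subtopology[OF o(1)] by blast+
      then have "openin X {y. \<exists>x\<in>V. f x = Some y}" using R by blast
      moreover have "(the \<circ> f) ` V = {y. \<exists>x\<in>V. f x = Some y}"
        using V(2) by force
      ultimately show "openin (subtopology X (ran f)) ((the \<circ> f) ` V)"
        unfolding openin_open_subtopology[OF o(2)] by (auto intro: ranI)
    qed
    show "(the \<circ> f) ` topspace (subtopology X (dom f)) = topspace (subtopology X (ran f))"
      unfolding ts by (force simp: ran_def)
    show "inj_on (the \<circ> f) (topspace (subtopology X (dom f)))"
    proof -
      have "inj_on f (dom f)" using R by blast
      then have "\<forall>x\<in>dom f. \<forall>y\<in>dom f. f x = f y \<longrightarrow> x = y" by (simp add: inj_on_def)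
      then show ?thesis unfolding ts inj_on_def by (metis comp_apply domIff option.expand)
    qed
  qed
  with o show ?L by (simp add: Ph_def)
qed

lemma Ph_inj: "f \<in> Ph X \<Longrightarrow> f x = Some z \<Longrightarrow> f y = Some z \<Longrightarrow> x = y"
  unfolding Ph_iff by (metis domI inj_onD)

lemma partial_inv_Some_iff: "f \<in> Ph X \<Longrightarrow> partial_inv f y = Some x \<longleftrightarrow> f x = Some y"
proof -
  assume f: "f \<in> Ph X"
  have *: "(THE x. f x = Some y) = x" if "f x = Some y" for x
    using that Ph_inj[OF f] by (intro the_equality)
  show "partial_inv f y = Some x \<longleftrightarrow> f x = Some y"
  proof
    assume "partial_inv f y = Some x"
    then have "y \<in> ran f" "(THE x. f x = Some y) = x"
      by (simp_all add: partial_inv_def split: if_splits)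
    then show "f x = Some y" using * unfolding ran_def by blast
  next
    assume "f x = Some y"
    with * show "partial_inv f y = Some x" by (auto simp: partial_inv_def ran_def)
  qed
qed

lemma partial_id_Some_iff: "partial_id X x = Some y \<longleftrightarrow> x \<in> topspace X \<and> y = x"
  by (auto simp: partial_id_def restrict_map_def)

lemma restrict_map_Some_iff: "(f |` V) x = Some y \<longleftrightarrow> x \<in> V \<and> f x = Some y"
  by (simp add: restrict_map_def)

lemma PhI:
  assumes "\<And>x y. f x = Some y \<Longrightarrow> x \<in> topspace X \<and> y \<in> topspace X"
    and "\<And>x y z. f x = Some z \<Longrightarrow> f y = Some z \<Longrightarrow> x = y"
    and "\<And>V. openin X V \<Longrightarrow> openin X {x. \<exists>y\<in>V. f x = Some y}"
    and "\<And>V. openin X V \<Longrightarrow> openin X {y. \<exists>x\<in>V. f x = Some y}"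
  shows "f \<in> Ph X"
  using assms unfolding Ph_iff by (auto simp: inj_on_def ran_def)

lemma Ph_D:
  assumes "f \<in> Ph X"
  shows "f x = Some y \<Longrightarrow> x \<in> topspace X \<and> y \<in> topspace X"
    and "openin X V \<Longrightarrow> openin X {x. \<exists>y\<in>V. f x = Some y}"
    and "openin X V \<Longrightarrow> openin X {y. \<exists>x\<in>V. f x = Some y}"
  using assms unfolding Ph_iff by (auto simp: ran_def)

lemma Ph_partial_id: "partial_id X \<in> Ph X"
proof (rule PhI)
  fix V assume "openin X V"
  moreover have "{x. \<exists>y\<in>V. partial_id X x = Some y} = V" "{y. \<exists>x\<in>V. partial_id X x = Some y} = V"
    using openin_subset[OF \<open>openin X V\<close>] by (auto simp: partial_id_Some_iff)
  ultimately show "openin X {x. \<exists>y\<in>V. partial_id X x = Some y}"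
    "openin X {y. \<exists>x\<in>V. partial_id X x = Some y}" by simp_all
qed (auto simp: partial_id_Some_iff)

lemma Ph_partial_inv:
  assumes "f \<in> Ph X" shows "partial_inv f \<in> Ph X"
proof (rule PhI)
  show "x = y" if "partial_inv f x = Some z" "partial_inv f y = Some z" for x y z
    using that partial_inv_Some_iff[OF assms] by simp
qed (use partial_inv_Some_iff[OF assms] Ph_D[OF assms] in auto)

lemma Ph_map_comp:
  assumes "f \<in> Ph X" "g \<in> Ph X" shows "g \<circ>\<^sub>m f \<in> Ph X"
proof (rule PhI)
  show "x = y" if "(g \<circ>\<^sub>m f) x = Some z" "(g \<circ>\<^sub>m f) y = Some z" for x y z
    using that Ph_inj[OF assms(1)] Ph_inj[OF assms(2)] by (auto simp: map_comp_Some_iff)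
  show "x \<in> topspace X \<and> y \<in> topspace X" if "(g \<circ>\<^sub>m f) x = Some y" for x y
    using that Ph_D(1)[OF assms(1)] Ph_D(1)[OF assms(2)] by (auto simp: map_comp_Some_iff)
  fix V assume V: "openin X V"
  have "{x. \<exists>y\<in>V. (g \<circ>\<^sub>m f) x = Some y} = {x. \<exists>y\<in>{x. \<exists>y\<in>V. g x = Some y}. f x = Some y}"
    by (auto simp: map_comp_Some_iff)
  then show "openin X {x. \<exists>y\<in>V. (g \<circ>\<^sub>m f) x = Some y}"
    using Ph_D(2)[OF assms(1) Ph_D(2)[OF assms(2) V]] by simp
  have "{y. \<exists>x\<in>V. (g \<circ>\<^sub>m f) x = Some y} = {y. \<exists>x\<in>{y. \<exists>x\<in>V. f x = Some y}. g x = Some y}"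
    by (auto simp: map_comp_Some_iff)
  then show "openin X {y. \<exists>x\<in>V. (g \<circ>\<^sub>m f) x = Some y}"
    using Ph_D(3)[OF assms(2) Ph_D(3)[OF assms(1) V]] by simp
qed

lemma Ph_restrict:
  assumes "f \<in> Ph X" "openin X W" shows "f |` W \<in> Ph X"
proof (rule PhI)
  show "x = y" if "(f |` W) x = Some z" "(f |` W) y = Some z" for x y z
    using that Ph_inj[OF assms(1)] by (auto simp: restrict_map_Some_iff)
  show "x \<in> topspace X \<and> y \<in> topspace X" if "(f |` W) x = Some y" for x y
    using that Ph_D(1)[OF assms(1)] by (auto simp: restrict_map_Some_iff)
  fix V assume V: "openin X V"
  have "{x. \<exists>y\<in>V. (f |` W) x = Some y} = {x. \<exists>y\<in>V. f x = Some y} \<inter> W"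
    by (auto simp: restrict_map_Some_iff)
  then show "openin X {x. \<exists>y\<in>V. (f |` W) x = Some y}"
    using Ph_D(2)[OF assms(1) V] assms(2) by auto
  have "{y. \<exists>x\<in>V. (f |` W) x = Some y} = {y. \<exists>x\<in>V \<inter> W. f x = Some y}"
    by (auto simp: restrict_map_Some_iff)
  then show "openin X {y. \<exists>x\<in>V. (f |` W) x = Some y}"
    using Ph_D(3)[OF assms(1), of "V \<inter> W"] V assms(2) by auto
qed

text \<open>The partial homeomorphisms for which \<open>C\<close> and its complement are invariant. They form a pseudogroup,
  so an invariant set of the generators is invariant under everything they generate. For \<open>C = {}\<close>
  this is the pseudogroup of all partial homeomorphisms.\<close>

definition preserving :: "'z topology \<Rightarrow> 'z set \<Rightarrow> ('z \<rightharpoonup> 'z) set" where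
  "preserving X C = {f \<in> Ph X. \<forall>x y. f x = Some y \<longrightarrow> (x \<in> C \<longleftrightarrow> y \<in> C)}"

lemma pseudogroup_preserving: "pseudogroup X (preserving X C)"
  unfolding pseudogroup_def pseudostargroup_def
proof (intro conjI ballI allI impI)
  fix f assume f: "f \<in> Ph X"
    "\<forall>x\<in>dom f. \<exists>V. openin X V \<and> x \<in> V \<and> V \<subseteq> dom f \<and> f |` V \<in> preserving X C"
  have "x \<in> C \<longleftrightarrow> y \<in> C" if fx: "f x = Some y" for x y
  proof -
    from f(2) fx obtain V where "x \<in> V" "f |` V \<in> preserving X C" by blast
    then show ?thesis using fx unfolding preserving_def by (simp add: restrict_map_Some_iff)
  qed
  with f(1) show "f \<in> preserving X C" by (simp add: preserving_def)
qed (auto simp: preserving_def Ph_partial_id partial_id_Some_iff Ph_partial_inv partial_inv_Some_iff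
      Ph_map_comp map_comp_Some_iff Ph_restrict restrict_map_Some_iff)

lemma pseudogroup_closure:
  assumes "pseudogroup X G"
  shows "G \<subseteq> Ph X" "partial_id X \<in> G" "f \<in> G \<Longrightarrow> partial_inv f \<in> G"
    "f \<in> G \<Longrightarrow> g \<in> G \<Longrightarrow> g \<circ>\<^sub>m f \<in> G" "f \<in> G \<Longrightarrow> openin X V \<Longrightarrow> V \<subseteq> dom f \<Longrightarrow> f |` V \<in> G"
  using assms unfolding pseudogroup_def pseudostargroup_def by auto

lemma pseudogroup_Inter:
  assumes "\<And>H. H \<in> \<H> \<Longrightarrow> pseudogroup X H" "\<H> \<noteq> {}"
  shows "pseudogroup X (\<Inter>\<H>)"
  unfolding pseudogroup_def pseudostargroup_def
proof (intro conjI ballI allI impI)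
  show "\<Inter>\<H> \<subseteq> Ph X"
  proof -
    obtain H where "H \<in> \<H>" using assms(2) by auto
    then show ?thesis using pseudogroup_closure(1)[OF assms(1)[of H]] by auto
  qed
  fix f assume f: "f \<in> Ph X"
    "\<forall>x\<in>dom f. \<exists>V. openin X V \<and> x \<in> V \<and> V \<subseteq> dom f \<and> f |` V \<in> \<Inter>\<H>"
  show "f \<in> \<Inter>\<H>"
  proof
    fix H assume "H \<in> \<H>"
    have "\<exists>V. openin X V \<and> x \<in> V \<and> V \<subseteq> dom f \<and> f |` V \<in> H" if x: "x \<in> dom f" for x
    proof -
      obtain V where "openin X V \<and> x \<in> V \<and> V \<subseteq> dom f \<and> f |` V \<in> \<Inter>\<H>"
        using bspec[OF f(2) x] by (rule exE)
      with \<open>H \<in> \<H>\<close> show ?thesis by (intro exI[of _ V]) simp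
    qed
    with assms(1)[OF \<open>H \<in> \<H>\<close>] f(1) show "f \<in> H" unfolding pseudogroup_def by simp
  qed
next
  show "partial_id X \<in> \<Inter>\<H>" using pseudogroup_closure(2)[OF assms(1)] by auto
next
  fix f assume f: "f \<in> \<Inter>\<H>"
  show "partial_inv f \<in> \<Inter>\<H>" using f pseudogroup_closure(3)[OF assms(1)] by auto
  show "g \<circ>\<^sub>m f \<in> \<Inter>\<H>" if "g \<in> \<Inter>\<H>" for g
    using f that pseudogroup_closure(4)[OF assms(1)] by auto
  show "f |` V \<in> \<Inter>\<H>" if "openin X V \<and> V \<subseteq> dom f" for V
    using f that pseudogroup_closure(5)[OF assms(1)] by auto
qed

text \<open>The intersection that defines the hull is over a nonempty family because the partial
  homeomorphisms themselves form a pseudogroup.\<close>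

lemma pseudogroup_hull:
  assumes "S \<subseteq> Ph X"
  shows "pseudogroup X (pseudogroup X hull S)"
proof -
  have "Ph X = preserving X {}" by (simp add: preserving_def)
  then have "Ph X \<in> {H. pseudogroup X H \<and> S \<subseteq> H}"
    using assms pseudogroup_preserving by (metis mem_Collect_eq)
  then show ?thesis
    unfolding hull_def by (intro pseudogroup_Inter) auto
qed

definition same_orbit :: "('z \<rightharpoonup> 'z) set \<Rightarrow> 'z \<Rightarrow> 'z \<Rightarrow> bool" where
  "same_orbit G x y \<longleftrightarrow> (\<exists>g\<in>G. g x = Some y)"

lemma same_orbit_refl:
  assumes "pseudogroup X G" "x \<in> topspace X" shows "same_orbit G x x"
  unfolding same_orbit_def using pseudogroup_closure(2)[OF assms(1)] assms(2)
  by (intro bexI[of _ "partial_id X"]) (simp_all add: partial_id_Some_iff)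

lemma same_orbit_sym:
  assumes "pseudogroup X G" "same_orbit G x y" shows "same_orbit G y x"
proof -
  obtain g where g: "g \<in> G" "g x = Some y" using assms(2) by (auto simp: same_orbit_def)
  then have "g \<in> Ph X" using pseudogroup_closure(1)[OF assms(1)] by auto
  with g show ?thesis unfolding same_orbit_def
    using pseudogroup_closure(3)[OF assms(1) g(1)]
    by (intro bexI[of _ "partial_inv g"]) (simp_all add: partial_inv_Some_iff)
qed

lemma same_orbit_trans:
  assumes "pseudogroup X G" "same_orbit G x y" "same_orbit G y z" shows "same_orbit G x z"
proof -
  obtain g h where g: "g \<in> G" "g x = Some y" "h \<in> G" "h y = Some z"
    using assms(2,3) by (auto simp: same_orbit_def)
  then show ?thesis unfolding same_orbit_def
    using pseudogroup_closure(4)[OF assms(1) g(1,3)]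
    by (intro bexI[of _ "h \<circ>\<^sub>m g"]) (simp_all add: map_comp_Some_iff)
qed

text \<open>A tame map is either part of the identity or has small domain and small image, measured by the scale
  \<open>\<rho>\<close> at each point. The first alternative is forced because a pseudo\<open>*\<close>group contains the whole
  identity. The bound on the image refers to the value of \<open>\<rho>\<close> at the image point, which is what makes
  tameness stable under composition: only the first domain and the last image matter.\<close>

definition tame :: "('z \<Rightarrow> 'z \<Rightarrow> ennreal) \<Rightarrow> ('z \<Rightarrow> real) \<Rightarrow> ('z \<rightharpoonup> 'z) \<Rightarrow> bool" where
  "tame d \<rho> f \<longleftrightarrow> (\<forall>x y. f x = Some y \<longrightarrow> y = x) \<or>
     (\<forall>x x' y y'. f x = Some x' \<longrightarrow> f y = Some y' \<longrightarrow> d x y \<le> \<rho> x \<and> d x' y' \<le> \<rho> x')"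

lemma tame_restriction:
  assumes "\<And>x y. h x = Some y \<Longrightarrow> f x = Some y" "tame d \<rho> f"
  shows "tame d \<rho> h"
  using assms(2) unfolding tame_def
proof (elim disjE)
  assume "\<forall>x y. f x = Some y \<longrightarrow> y = x"
  then show "(\<forall>x y. h x = Some y \<longrightarrow> y = x) \<or>
     (\<forall>x x' y y'. h x = Some x' \<longrightarrow> h y = Some y' \<longrightarrow> d x y \<le> \<rho> x \<and> d x' y' \<le> \<rho> x')"
    using assms(1) by simp
next
  assume "\<forall>x x' y y'. f x = Some x' \<longrightarrow> f y = Some y' \<longrightarrow> d x y \<le> \<rho> x \<and> d x' y' \<le> \<rho> x'"
  then show "(\<forall>x y. h x = Some y \<longrightarrow> y = x) \<or>
     (\<forall>x x' y y'. h x = Some x' \<longrightarrow> h y = Some y' \<longrightarrow> d x y \<le> \<rho> x \<and> d x' y' \<le> \<rho> x')"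
    using assms(1) by (intro disjI2) metis
qed

lemma tame_partial_inv:
  assumes "f \<in> Ph X" "tame d \<rho> f"
  shows "tame d \<rho> (partial_inv f)"
  using assms(2) unfolding tame_def partial_inv_Some_iff[OF assms(1)] by blast

lemma tame_map_comp:
  assumes f: "tame d \<rho> f" and g: "tame d \<rho> g"
  shows "tame d \<rho> (g \<circ>\<^sub>m f)"
proof -
  consider "\<forall>x y. f x = Some y \<longrightarrow> y = x" | "\<forall>x y. g x = Some y \<longrightarrow> y = x"
    | "\<And>x x' y y'. f x = Some x' \<Longrightarrow> f y = Some y' \<Longrightarrow> d x y \<le> \<rho> x \<and> d x' y' \<le> \<rho> x'"
      "\<And>x x' y y'. g x = Some x' \<Longrightarrow> g y = Some y' \<Longrightarrow> d x y \<le> \<rho> x \<and> d x' y' \<le> \<rho> x'"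
    using f g unfolding tame_def by metis
  then show ?thesis
  proof cases
    case 1
    then show ?thesis by (intro tame_restriction[OF _ g]) (auto simp: map_comp_Some_iff)
  next
    case 2
    then show ?thesis by (intro tame_restriction[OF _ f]) (auto simp: map_comp_Some_iff)
  next
    case 3
    then show ?thesis unfolding tame_def map_comp_Some_iff by (intro disjI2) metis
  qed
qed

text \<open>If every point of the domain of a generator has a neighbourhood on which the generator is tame, then
  the tame elements recover all generators by gluing, hence the whole pseudogroup.\<close>

lemma tame_generates:
  assumes S: "S \<subseteq> Ph X" 
    and cont: "\<And>f x. f \<in> S \<Longrightarrow> x \<in> dom f \<Longrightarrow> \<exists>V. openin X V \<and> x \<in> V \<and> V \<subseteq> dom f \<and> tame d \<rho> (f |` V)"
  defines "G \<equiv> pseudogroup X hull S"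
  shows "pseudostargroup X {f \<in> G. tame d \<rho> f}" "generates X {f \<in> G. tame d \<rho> f} G"
proof -
  have G: "pseudogroup X G" unfolding G_def using S by (rule pseudogroup_hull)
  note cl = pseudogroup_closure[OF G]
  show "pseudostargroup X {f \<in> G. tame d \<rho> f}"
    unfolding pseudostargroup_def
  proof (intro conjI ballI allI impI)
    show "{f \<in> G. tame d \<rho> f} \<subseteq> Ph X" using cl(1) by auto
    show "partial_id X \<in> {f \<in> G. tame d \<rho> f}"
      using cl(2) by (simp add: tame_def partial_id_Some_iff)
  next
    fix f assume f: "f \<in> {f \<in> G. tame d \<rho> f}"
    then have pf: "f \<in> Ph X" using cl(1) by auto
    have "tame d \<rho> (partial_inv f)"
      using f tame_partial_inv[OF pf] by simp
    then show "partial_inv f \<in> {f \<in> G. tame d \<rho> f}" using f cl(3) by simp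
    fix g assume g: "g \<in> {f \<in> G. tame d \<rho> f}"
    have "tame d \<rho> (g \<circ>\<^sub>m f)"
      using f g by (simp add: tame_map_comp)
    then show "g \<circ>\<^sub>m f \<in> {f \<in> G. tame d \<rho> f}" using f g cl(4) by simp
  next
    fix f V assume f: "f \<in> {f \<in> G. tame d \<rho> f}" and "openin X V \<and> V \<subseteq> dom f"
    moreover have "tame d \<rho> (f |` V)"
      using f by (intro tame_restriction[of "f |` V" f]) (simp_all add: restrict_map_Some_iff)
    ultimately show "f |` V \<in> {f \<in> G. tame d \<rho> f}" using cl(5) by simp
  qed
  show "generates X {f \<in> G. tame d \<rho> f} G"
    unfolding generates_def
  proof (intro conjI allI impI)
    fix H assume H: "pseudogroup X H \<and> {f \<in> G. tame d \<rho> f} \<subseteq> H"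
    have "S \<subseteq> H"
    proof
      fix f assume f: "f \<in> S"
      have fG: "f \<in> G" unfolding G_def using f by (rule hull_inc)
      have "\<exists>V. openin X V \<and> x \<in> V \<and> V \<subseteq> dom f \<and> f |` V \<in> H" if "x \<in> dom f" for x
        using cont[OF f that] H cl(5)[OF fG] by blast
      then show "f \<in> H" using H f S unfolding pseudogroup_def by blast
    qed
    then show "G \<subseteq> H" unfolding G_def using H by (intro hull_minimal) auto
  qed (use G in auto)
qed

section \<open>Foliations glued from foliated charts\<close>

lemma second_countable_euclidean: "second_countable (euclidean :: 'a::second_countable_topology topology)"
proof -
  obtain B :: "'a set set" where B: "countable B" "topological_basis B"
    using ex_countable_basis by blast
  show ?thesis unfolding second_countable_def
  proof (intro exI[of _ B] conjI allI impI ballI)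
    show "openin euclidean V" if "V \<in> B" for V
      using that B(2) by (simp add: topological_basis_open)
    show "\<exists>V\<in>B. x \<in> V \<and> V \<subseteq> U" if "openin euclidean U \<and> x \<in> U" for U and x :: 'a
      using that topological_basisE[OF B(2), of U x] by (metis open_openin)
  qed (rule B(1))
qed

lemma surface_top_of_set:
  assumes "open (Z :: (real^2) set)" shows "surface (top_of_set Z)"
  unfolding surface_def
proof (intro conjI ballI)
  show "Hausdorff_space (top_of_set Z)" by (simp add: Hausdorff_space_subtopology)
  show "second_countable (top_of_set Z)"
    by (simp add: second_countable_euclidean second_countable_subtopology)
  have "coord_chart (top_of_set Z) (Z, id)"
    using assms by (simp add: coord_chart_def subtopology_subtopology)
  moreover fix x assume "x \<in> topspace (top_of_set Z)"
  ultimately show "\<exists>U (a :: real^2 \<Rightarrow> real^2). x \<in> U \<and> coord_chart (top_of_set Z) (U, a)"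
    by (intro exI[of _ Z] exI[of _ id]) simp
qed

lemma openin_sum_top_of_set:
  assumes "\<And>i. i \<in> I \<Longrightarrow> open (Z i)"
  shows "openin (sum_topology (\<lambda>i. top_of_set (Z i)) I) V \<longleftrightarrow>
    V \<subseteq> Sigma I Z \<and> (\<forall>i\<in>I. open {z. (i, z) \<in> V})"
proof
  assume "openin (sum_topology (\<lambda>i. top_of_set (Z i)) I) V"
  then have V: "V \<subseteq> Sigma I Z" "\<And>i. i \<in> I \<Longrightarrow> openin (top_of_set (Z i)) {z. (i, z) \<in> V}"
    by (simp_all add: openin_sum_topology o_def)
  then show "V \<subseteq> Sigma I Z \<and> (\<forall>i\<in>I. open {z. (i, z) \<in> V})"
    using openin_open_eq[OF assms] by simp
next
  assume V: "V \<subseteq> Sigma I Z \<and> (\<forall>i\<in>I. open {z. (i, z) \<in> V})"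
  have "openin (top_of_set (Z i)) {z. (i, z) \<in> V}" if "i \<in> I" for i
    using V that openin_open_eq[OF assms[OF that]] by auto
  with V show "openin (sum_topology (\<lambda>i. top_of_set (Z i)) I) V"
    by (simp add: openin_sum_topology o_def)
qed

text \<open>Gluing data whose charts have the form \<open>\<real>\<^sup>2 \<times> Z i\<close>. The map \<open>h i j\<close> takes the transverse
  coordinate of chart \<open>j\<close> to that of chart \<open>i\<close>; since it is one map for the whole overlap, this is the
  condition that defines a foliated atlas.\<close>

locale foliated_gluing = gluing I U "\<lambda>i. UNIV \<times> Z i" \<phi> \<psi>
  for I :: "'i set" and U :: "'i \<Rightarrow> 'm set" and Z :: "'i \<Rightarrow> (real^2) set"
    and \<phi> :: "'i \<Rightarrow> 'm \<Rightarrow> (real^2) \<times> (real^2)" and \<psi> :: "'i \<Rightarrow> (real^2) \<times> (real^2) \<Rightarrow> 'm" +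
  fixes h :: "'i \<Rightarrow> 'i \<Rightarrow> real^2 \<Rightarrow> real^2"
  assumes finite_I: "finite I"
    and transverse: "\<And>i j p. i \<in> I \<Longrightarrow> j \<in> I \<Longrightarrow> p \<in> U i \<Longrightarrow> p \<in> U j \<Longrightarrow>
      snd (\<phi> i p) = h i j (snd (\<phi> j p))"
begin

abbreviation T :: "'i \<Rightarrow> (real^2) topology" where "T i \<equiv> top_of_set (Z i)"

lemma open_transversal: "i \<in> I \<Longrightarrow> open (Z i)"
  using open_image_snd[OF open_chart_image[of i]] by simp

lemma chart_snd: "i \<in> I \<Longrightarrow> p \<in> U i \<Longrightarrow> snd (\<phi> i p) \<in> Z i"
  using chart[of i p] by (auto simp: mem_Times_iff)

lemma foliated_atlas_glued: "foliated_atlas glued I U T \<phi>"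
  unfolding foliated_atlas_def
proof (intro conjI ballI)
  fix i assume i: "i \<in> I"
  show "openin glued (U i)" by (rule openin_domain[OF i])
  show "surface (T i)" by (rule surface_top_of_set[OF open_transversal[OF i]])
  have eq: "prod_topology euclidean (T i) = top_of_set (UNIV \<times> Z i)"
    using prod_topology_subtopology_eu[of UNIV "Z i"] by simp
  show "homeomorphic_map (subtopology glued (U i)) (prod_topology euclidean (T i)) (\<phi> i)"
    unfolding eq by (rule homeomorphic_map_chart[OF i])
  fix j assume j: "j \<in> I"
  show "\<exists>h. \<forall>x\<in>U i \<inter> U j. snd (\<phi> i x) = h (snd (\<phi> j x))"
    using transverse[OF i j] by (intro exI[of _ "h i j"]) simp
next
  show "(\<Union>i\<in>I. U i) = topspace glued" by (simp add: topspace_glued)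
  fix x assume "x \<in> topspace glued"
  then show "\<exists>N. openin glued N \<and> x \<in> N \<and> finite {i \<in> I. U i \<inter> N \<noteq> {}}"
    using finite_I by (intro exI[of _ "topspace glued"]) simp
qed

abbreviation tdom :: "'i \<Rightarrow> 'i \<Rightarrow> (real^2) set" where "tdom \<equiv> transition_dom U \<phi>"

lemma transition_dom_eq:
  assumes "j \<in> I" shows "tdom i j = snd ` {e \<in> UNIV \<times> Z j. \<psi> j e \<in> U i}"
proof -
  have "\<phi> j ` (U i \<inter> U j) = {e \<in> UNIV \<times> Z j. \<psi> j e \<in> U i}"
    using chart_image_overlap[OF assms, of "U i"] by (simp add: Int_commute)
  then show ?thesis unfolding transition_dom_def image_comp[symmetric] by simp
qed

lemma open_transition_dom: "i \<in> I \<Longrightarrow> j \<in> I \<Longrightarrow> open (tdom i j)"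
  unfolding transition_dom_eq by (intro open_image_snd open_overlap)

lemma transition_domE:
  assumes "i \<in> I" "j \<in> I" "z \<in> tdom i j"
  obtains p where "p \<in> U i" "p \<in> U j" "snd (\<phi> j p) = z" "snd (\<phi> i p) = h i j z"
proof -
  obtain p where p: "p \<in> U i \<inter> U j" "z = snd (\<phi> j p)"
    using assms(3) by (auto simp: transition_dom_def)
  with transverse[OF assms(1,2), of p] show ?thesis by (intro that[of p]) auto
qed

lemma transition_domI:
  "p \<in> U i \<Longrightarrow> p \<in> U j \<Longrightarrow> snd (\<phi> j p) \<in> tdom i j"
  by (auto simp: transition_dom_def)

lemma transition_map_eq:
  assumes "i \<in> I" "j \<in> I" "z \<in> tdom i j"
  shows "transition_map U \<phi> i j z = h i j z"
proof -
  define p where "p = inv_into (U i \<inter> U j) (snd \<circ> \<phi> j) z"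
  have "z \<in> (snd \<circ> \<phi> j) ` (U i \<inter> U j)" using assms(3) by (simp add: transition_dom_def)
  from inv_into_into[OF this] f_inv_into_f[OF this] have "p \<in> U i \<inter> U j" "snd (\<phi> j p) = z"
    unfolding p_def by simp_all
  then show ?thesis
    using transverse[OF assms(1,2), of p] by (simp add: transition_map_def p_def)
qed

lemma transition_swap:
  assumes "i \<in> I" "j \<in> I" "z \<in> tdom i j"
  shows "h i j z \<in> tdom j i" "h j i (h i j z) = z"
proof -
  obtain p where p: "p \<in> U i" "p \<in> U j" "snd (\<phi> j p) = z" "snd (\<phi> i p) = h i j z"
    using transition_domE[OF assms] .
  show "h i j z \<in> tdom j i" using transition_domI[OF p(2,1)] p(4) by simp
  show "h j i (h i j z) = z" using transverse[OF assms(2,1) p(2,1)] p(3,4) by simp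
qed

lemma transition_dom_subset: "j \<in> I \<Longrightarrow> tdom i j \<subseteq> Z j"
  by (auto simp: transition_dom_eq)

text \<open>Near a point, \<open>h i j\<close> is the transverse part of the coordinate change restricted to a slice
  \<open>{x} \<times> Z j\<close>, and the plane coordinate \<open>x\<close> may be frozen because the result does not depend on it.\<close>

lemma continuous_transition:
  assumes i: "i \<in> I" and j: "j \<in> I"
  shows "continuous_on (tdom i j) (h i j)"
proof (rule continuous_at_imp_continuous_on, rule ballI)
  fix z assume "z \<in> tdom i j"
  then obtain x where x: "(x, z) \<in> UNIV \<times> Z j" "\<psi> j (x, z) \<in> U i"
    unfolding transition_dom_eq[OF j] by auto
  define D where "D = {e \<in> UNIV \<times> Z j. \<psi> j e \<in> U i}"
  define V where "V = Pair x -` D"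
  have "open V" unfolding V_def D_def by (intro open_vimage open_overlap i j continuous_intros)
  have "continuous_on V (\<lambda>z. snd (\<phi> i (\<psi> j (x, z))))"
  proof -
    have "continuous_on D (\<lambda>e. snd (\<phi> i (\<psi> j e)))"
      unfolding D_def by (intro continuous_on_snd continuous_change i j)
    then show ?thesis
      by (rule continuous_on_compose2[of D _ V "Pair x"]) (auto simp: V_def intro!: continuous_intros)
  qed
  moreover have "snd (\<phi> i (\<psi> j (x, z'))) = h i j z'" if "z' \<in> V" for z'
  proof -
    have "(x, z') \<in> UNIV \<times> Z j" "\<psi> j (x, z') \<in> U i" using that by (auto simp: V_def D_def)
    then show ?thesis
      using transverse[OF i j, of "\<psi> j (x, z')"] inverse_chart[OF j, of "(x, z')"] by simp
  qed
  ultimately have "continuous_on V (h i j)" by (simp cong: continuous_on_cong)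
  moreover have "z \<in> V" using x by (simp add: V_def D_def)
  ultimately show "isCont (h i j) z"
    using \<open>open V\<close> by (simp add: continuous_on_eq_continuous_at)
qed

abbreviation X :: "('i \<times> (real^2)) topology" where "X \<equiv> transversal I T"

abbreviation G :: "('i \<times> (real^2) \<rightharpoonup> 'i \<times> (real^2)) set" where "G \<equiv> holonomy_pseudogroup I U T \<phi>"

lemma openin_X: "openin X V \<longleftrightarrow> V \<subseteq> Sigma I Z \<and> (\<forall>i\<in>I. open {z. (i, z) \<in> V})"
  unfolding transversal_def using open_transversal by (rule openin_sum_top_of_set)

lemma topspace_X: "topspace X = Sigma I Z"
  by (simp add: transversal_def o_def)

lemma holonomy_map_Some_iff:
  assumes "i \<in> I" "j \<in> I"
  shows "holonomy_map U \<phi> i j x = Some y \<longleftrightarrow>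
    fst x = j \<and> snd x \<in> tdom i j \<and> y = (i, h i j (snd x))"
  using transition_map_eq[OF assms, of "snd x"] by (auto simp: holonomy_map_def split: prod.splits)

lemma holonomy_map_swap:
  assumes "i \<in> I" "j \<in> I" "holonomy_map U \<phi> i j x = Some y"
  shows "holonomy_map U \<phi> j i y = Some x"
  using assms(3) transition_swap[OF assms(1,2), of "snd x"]
  unfolding holonomy_map_Some_iff[OF assms(1,2)] holonomy_map_Some_iff[OF assms(2,1)]
  by (auto simp: prod_eq_iff)

text \<open>Since the inverse of a holonomy map is the holonomy map with the indices exchanged, open
  preimages already show that it is a homeomorphism.\<close>

lemma holonomy_map_preimage:
  assumes i: "i \<in> I" and j: "j \<in> I" and V: "openin X V"
  shows "openin X {x. \<exists>y\<in>V. holonomy_map U \<phi> i j x = Some y}"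
proof -
  have eq: "{x. \<exists>y\<in>V. holonomy_map U \<phi> i j x = Some y} = {j} \<times> {z \<in> tdom i j. (i, h i j z) \<in> V}"
    unfolding holonomy_map_Some_iff[OF i j] by (auto simp: mem_Times_iff)
  have "open {z. (i, z) \<in> V}" using V i openin_X by simp
  then have "open (tdom i j \<inter> h i j -` {z. (i, z) \<in> V})"
    by (intro continuous_open_preimage continuous_transition open_transition_dom i j)
  moreover have "tdom i j \<inter> h i j -` {z. (i, z) \<in> V} = {z \<in> tdom i j. (i, h i j z) \<in> V}" by auto
  ultimately have o: "open {z \<in> tdom i j. (i, h i j z) \<in> V}" by simp
  have "{z. (k, z) \<in> {j} \<times> {z \<in> tdom i j. (i, h i j z) \<in> V}} =
      (if k = j then {z \<in> tdom i j. (i, h i j z) \<in> V} else {})" for k by auto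
  with o show ?thesis
    unfolding eq openin_X using j transition_dom_subset[OF j, of i] by (auto simp: mem_Times_iff)
qed

lemma holonomy_map_Ph:
  assumes i: "i \<in> I" and j: "j \<in> I"
  shows "holonomy_map U \<phi> i j \<in> Ph X"
proof (rule PhI)
  show "x \<in> topspace X \<and> y \<in> topspace X" if "holonomy_map U \<phi> i j x = Some y" for x y
  proof -
    have "fst x = j" "snd x \<in> tdom i j" "fst y = i" "snd y \<in> tdom j i"
      using that transition_swap(1)[OF i j, of "snd x"] unfolding holonomy_map_Some_iff[OF i j] by auto
    then show ?thesis
      using i j transition_dom_subset[OF i, of j] transition_dom_subset[OF j, of i]
      unfolding topspace_X by (cases x, cases y) auto
  qed
  show "x = y" if "holonomy_map U \<phi> i j x = Some z" "holonomy_map U \<phi> i j y = Some z" for x y z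
    using holonomy_map_swap[OF i j that(1)] holonomy_map_swap[OF i j that(2)] by simp
  fix V assume V: "openin X V"
  show "openin X {x. \<exists>y\<in>V. holonomy_map U \<phi> i j x = Some y}"
    by (rule holonomy_map_preimage[OF i j V])
  have "{y. \<exists>x\<in>V. holonomy_map U \<phi> i j x = Some y} = {y. \<exists>x\<in>V. holonomy_map U \<phi> j i y = Some x}"
    using holonomy_map_swap[OF i j] holonomy_map_swap[OF j i] by blast
  then show "openin X {y. \<exists>x\<in>V. holonomy_map U \<phi> i j x = Some y}"
    using holonomy_map_preimage[OF j i V] by simp
qed

lemma holonomy_maps_Ph: "{holonomy_map U \<phi> i j | i j. i \<in> I \<and> j \<in> I} \<subseteq> Ph X"
  using holonomy_map_Ph by auto

lemma pseudogroup_G: "pseudogroup X G"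
  unfolding holonomy_pseudogroup_def by (rule pseudogroup_hull[OF holonomy_maps_Ph])

lemma same_orbit_transition:
  assumes "i \<in> I" "j \<in> I" "p \<in> U i" "p \<in> U j"
  shows "same_orbit G (j, snd (\<phi> j p)) (i, snd (\<phi> i p))"
proof -
  have "holonomy_map U \<phi> i j \<in> G"
    unfolding holonomy_pseudogroup_def by (rule hull_inc) (use assms in auto)
  moreover have "holonomy_map U \<phi> i j (j, snd (\<phi> j p)) = Some (i, snd (\<phi> i p))"
    unfolding holonomy_map_Some_iff[OF assms(1,2)]
    using transition_domI[OF assms(3,4)] transverse[OF assms] by simp
  ultimately show ?thesis unfolding same_orbit_def by blast
qed

text \<open>Sets of transverse coordinates, one in each chart, that fit together to a union of leaves.\<close>

definition saturated :: "('i \<Rightarrow> (real^2) set) \<Rightarrow> bool" where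
  "saturated F \<longleftrightarrow> (\<forall>i\<in>I. F i \<subseteq> Z i) \<and>
     (\<forall>i\<in>I. \<forall>j\<in>I. \<forall>p\<in>U i \<inter> U j. snd (\<phi> i p) \<in> F i \<longleftrightarrow> snd (\<phi> j p) \<in> F j)"

lemma saturatedD:
  assumes "saturated F" "i \<in> I" "j \<in> I" "p \<in> U i" "p \<in> U j"
  shows "snd (\<phi> i p) \<in> F i \<longleftrightarrow> snd (\<phi> j p) \<in> F j"
proof -
  have "\<forall>i\<in>I. \<forall>j\<in>I. \<forall>p\<in>U i \<inter> U j. snd (\<phi> i p) \<in> F i \<longleftrightarrow> snd (\<phi> j p) \<in> F j"
    using assms(1) unfolding saturated_def by (rule conjunct2)
  from this[rule_format, OF assms(2,3) IntI, OF assms(4,5)] show ?thesis .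
qed

lemma saturated_invariant:
  assumes F: "saturated F" and g: "g \<in> G" "g x = Some y"
  shows "snd x \<in> F (fst x) \<longleftrightarrow> snd y \<in> F (fst y)"
proof -
  have "holonomy_map U \<phi> i j \<in> preserving X {x. snd x \<in> F (fst x)}" if ij: "i \<in> I" "j \<in> I" for i j
  proof -
    have "snd x \<in> F (fst x) \<longleftrightarrow> snd y \<in> F (fst y)" if "holonomy_map U \<phi> i j x = Some y" for x y
    proof -
      have x: "fst x = j" "snd x \<in> tdom i j" and y: "y = (i, h i j (snd x))"
        using that unfolding holonomy_map_Some_iff[OF ij] by auto
      obtain p where p: "p \<in> U i" "p \<in> U j" "snd (\<phi> j p) = snd x" "snd (\<phi> i p) = h i j (snd x)"
        using transition_domE[OF ij x(2)] .
      show ?thesis using saturatedD[OF F ij p(1,2)] p(3,4) x(1) y by simp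
    qed
    then show ?thesis using holonomy_map_Ph[OF ij] unfolding preserving_def by blast
  qed
  then have "G \<subseteq> preserving X {x. snd x \<in> F (fst x)}"
    unfolding holonomy_pseudogroup_def by (intro hull_minimal pseudogroup_preserving) auto
  with g(1) have "g \<in> preserving X {x. snd x \<in> F (fst x)}" by (rule subsetD[rotated])
  then show ?thesis using g(2) unfolding preserving_def by blast
qed

abbreviation L :: "'m topology" where "L \<equiv> leaf_topology I U T \<phi>"

lemma openin_plaque:
  assumes "i \<in> I" "open V" "z \<in> Z i"
  shows "openin L {p \<in> U i. fst (\<phi> i p) \<in> V \<and> snd (\<phi> i p) = z}"
  unfolding leaf_topology_def by (rule topology_generated_by_Basis) (use assms in auto)

lemma topspace_leaf_topology: "topspace L = (\<Union>i\<in>I. U i)"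
proof
  show "topspace L \<subseteq> (\<Union>i\<in>I. U i)"
    by (auto simp: leaf_topology_def)
  show "(\<Union>i\<in>I. U i) \<subseteq> topspace L"
  proof
    fix p assume "p \<in> (\<Union>i\<in>I. U i)"
    then obtain i where i: "i \<in> I" "p \<in> U i" by auto
    have "p \<in> {q \<in> U i. fst (\<phi> i q) \<in> UNIV \<and> snd (\<phi> i q) = snd (\<phi> i p)}" using i by simp
    with openin_subset[OF openin_plaque[OF i(1) open_UNIV chart_snd[OF i]]]
    show "p \<in> topspace L" by (rule subsetD)
  qed
qed

lemma openin_union_of_plaques:
  assumes "\<And>i p q. i \<in> I \<Longrightarrow> p \<in> U i \<Longrightarrow> q \<in> U i \<Longrightarrow> snd (\<phi> i p) = snd (\<phi> i q) \<Longrightarrow> p \<in> C \<Longrightarrow> q \<in> C"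
    and "C \<subseteq> (\<Union>i\<in>I. U i)"
  shows "openin L C"
proof (subst openin_subopen, rule ballI)
  fix p assume p: "p \<in> C"
  then obtain i where i: "i \<in> I" "p \<in> U i" using assms(2) by auto
  let ?P = "{q \<in> U i. fst (\<phi> i q) \<in> UNIV \<and> snd (\<phi> i q) = snd (\<phi> i p)}"
  have "openin L ?P" by (intro openin_plaque i open_UNIV chart_snd)
  moreover have "p \<in> ?P" using i by simp
  moreover have "?P \<subseteq> C"
  proof
    fix q assume "q \<in> ?P"
    then show "q \<in> C" using assms(1)[of i p q] i p by simp
  qed
  ultimately show "\<exists>T. openin L T \<and> p \<in> T \<and> T \<subseteq> C" by (intro exI conjI)
qed

lemma continuous_map_plaque:
  assumes i: "i \<in> I" and z: "z \<in> Z i"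
  shows "continuous_map euclidean L (\<lambda>x. \<psi> i (x, z))"
  unfolding leaf_topology_def
proof (rule continuous_on_generated_topo)
  fix S assume "S \<in> {{p \<in> U j. fst (\<phi> j p) \<in> V \<and> snd (\<phi> j p) = w} | j V w.
        j \<in> I \<and> open V \<and> w \<in> topspace (T j)}"
  then obtain j V w where S: "S = {p \<in> U j. fst (\<phi> j p) \<in> V \<and> snd (\<phi> j p) = w}"
    and j: "j \<in> I" and V: "open V" by auto
  define D where "D = {e \<in> UNIV \<times> Z i. \<psi> i e \<in> U j}"
  have D: "open D" "continuous_on D (\<lambda>e. fst (\<phi> j (\<psi> i e)))"
    unfolding D_def by (intro open_overlap continuous_on_fst continuous_change i j)+
  have h: "snd (\<phi> j (\<psi> i (x, z))) = h j i z" if "(x, z) \<in> D" for x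
    using that transverse[OF j i, of "\<psi> i (x, z)"] inverse_chart[OF i, of "(x, z)"] by (simp add: D_def)
  have "(\<lambda>x. \<psi> i (x, z)) -` S = (if h j i z = w then
      (\<lambda>x. (x, z)) -` (D \<inter> (\<lambda>e. fst (\<phi> j (\<psi> i e))) -` V) else {})"
  proof (intro set_eqI)
    fix x
    have "(x, z) \<in> D \<longleftrightarrow> \<psi> i (x, z) \<in> U j" using z by (simp add: D_def)
    with h[of x] show "x \<in> (\<lambda>x. \<psi> i (x, z)) -` S \<longleftrightarrow> x \<in> (if h j i z = w then
      (\<lambda>x. (x, z)) -` (D \<inter> (\<lambda>e. fst (\<phi> j (\<psi> i e))) -` V) else {})"
      by (auto simp: S)
  qed
  moreover have "open ((\<lambda>x. (x, z)) -` (D \<inter> (\<lambda>e. fst (\<phi> j (\<psi> i e))) -` V))"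
    by (intro open_vimage continuous_open_preimage D V continuous_intros)
  ultimately show "openin euclidean ((\<lambda>x. \<psi> i (x, z)) -` S \<inter> topspace euclidean)" by simp
next
  have "\<psi> i (x, z) \<in> topspace L" for x
    using inverse_chart[OF i, of "(x, z)"] z i unfolding topspace_leaf_topology by auto
  then show "(\<lambda>x. \<psi> i (x, z)) ` topspace euclidean \<subseteq>
      \<Union>{{p \<in> U j. fst (\<phi> j p) \<in> V \<and> snd (\<phi> j p) = w} | j V w.
        j \<in> I \<and> open V \<and> w \<in> topspace (T j)}"
    unfolding leaf_topology_def topology_generated_by_topspace by auto
qed

text \<open>The union \<open>C\<close> of plaques over a finite saturated family is open and closed in the leaf topology,
  being a union of plaques with a complement of the same kind. If its points have coordinates
  in fixed compact sets \<open>K i\<close>, then \<open>C\<close> is a finite union of compact pieces of plaques. A leaf that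
  meets \<open>C\<close> is connected, hence contained in \<open>C\<close>, and closed, hence compact.\<close>

lemma compact_leaf_of_finite_saturated:
  assumes F: "saturated F" "\<And>i. i \<in> I \<Longrightarrow> finite (F i)"
    and K: "\<And>i. i \<in> I \<Longrightarrow> compact (K i)"
    and cover: "\<And>j p. j \<in> I \<Longrightarrow> p \<in> U j \<Longrightarrow> snd (\<phi> j p) \<in> F j \<Longrightarrow>
      \<exists>i\<in>I. p \<in> U i \<and> fst (\<phi> i p) \<in> K i"
    and p: "i \<in> I" "p \<in> U i" "snd (\<phi> i p) \<in> F i"
  shows "p \<in> \<Union>{l \<in> leaves I U T \<phi>. compactin L l}"
proof -
  define C where "C = {q \<in> topspace glued. \<exists>j\<in>I. q \<in> U j \<and> snd (\<phi> j q) \<in> F j}"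
  have C_iff: "q \<in> C \<longleftrightarrow> snd (\<phi> j q) \<in> F j" if "j \<in> I" "q \<in> U j" for j q
  proof
    assume "q \<in> C"
    then obtain k where "k \<in> I" "q \<in> U k" "snd (\<phi> k q) \<in> F k" unfolding C_def by blast
    then show "snd (\<phi> j q) \<in> F j" using saturatedD[OF F(1) that(1) _ that(2), of k] by simp
  qed (use that in \<open>auto simp: C_def topspace_glued\<close>)
  have C_sub: "C \<subseteq> (\<Union>i\<in>I. U i)" by (auto simp: C_def topspace_glued)
  have "openin L C"
    by (rule openin_union_of_plaques[OF _ C_sub]) (simp add: C_iff)
  moreover have "closedin L C"
    unfolding closedin_def topspace_leaf_topology
    by (intro conjI C_sub openin_union_of_plaques) (auto simp: C_iff)
  moreover have "compactin L C"
  proof -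
    have "compactin L ((\<lambda>x. \<psi> j (x, z)) ` K j)" if "j \<in> I" "z \<in> F j" for j z
    proof (rule image_compactin)
      show "compactin euclidean (K j)" using K that by simp
      have "z \<in> Z j" using F(1) that unfolding saturated_def by auto
      then show "continuous_map euclidean L (\<lambda>x. \<psi> j (x, z))"
        by (rule continuous_map_plaque[OF that(1)])
    qed
    then have "compactin L (\<Union>j\<in>I. \<Union>z\<in>F j. (\<lambda>x. \<psi> j (x, z)) ` K j)"
      using finite_I F(2) by (auto intro!: compactin_Union)
    moreover have "(\<Union>j\<in>I. \<Union>z\<in>F j. (\<lambda>x. \<psi> j (x, z)) ` K j) = C"
    proof (intro equalityI subsetI)
      fix q assume "q \<in> (\<Union>j\<in>I. \<Union>z\<in>F j. (\<lambda>x. \<psi> j (x, z)) ` K j)"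
      then obtain j z x where q: "j \<in> I" "z \<in> F j" "q = \<psi> j (x, z)" by auto
      have "z \<in> Z j" using F(1) q unfolding saturated_def by auto
      then have "q \<in> U j" "snd (\<phi> j q) = z" using inverse_chart[OF q(1), of "(x, z)"] q(3) by auto
      with q C_iff show "q \<in> C" by simp
    next
      fix q assume q: "q \<in> C"
      then obtain k where k: "k \<in> I" "q \<in> U k" "snd (\<phi> k q) \<in> F k" unfolding C_def by blast
      then obtain j where j: "j \<in> I" "q \<in> U j" "fst (\<phi> j q) \<in> K j" using cover[OF k] by blast
      then have "snd (\<phi> j q) \<in> F j" using C_iff q by simp
      moreover have "q = \<psi> j (fst (\<phi> j q), snd (\<phi> j q))" using chart[OF j(1,2)] by simp
      ultimately show "q \<in> (\<Union>j\<in>I. \<Union>z\<in>F j. (\<lambda>x. \<psi> j (x, z)) ` K j)"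
        using j by (intro UN_I[of j] UN_I[of "snd (\<phi> j q)"] image_eqI[of _ _ "fst (\<phi> j q)"])
    qed
    ultimately show ?thesis by simp
  qed
  moreover have "p \<in> topspace L" using p unfolding topspace_leaf_topology by auto
  then obtain l where l: "l \<in> leaves I U T \<phi>" "p \<in> l"
    unfolding leaves_def Union_connected_components_of[symmetric] by auto
  moreover have "p \<in> C" using C_iff p by simp
  ultimately have "l \<subseteq> C"
    using connectedin_clopen_cases[OF connectedin_connected_components_of[of l L], of C]
    unfolding leaves_def disjnt_iff by blast
  then have "compactin L l"
    using closed_compactin[OF \<open>compactin L C\<close>] closedin_connected_components_of l(1)
    unfolding leaves_def by blast
  with l show ?thesis by auto
qed

text \<open>The covering condition concerns points over the saturated family only: points over
  other parts of the transversals may leave every union of compact pieces.\<close>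

lemma dense_compact_leavesI:
  assumes K: "\<And>i. i \<in> I \<Longrightarrow> compact (K i)"
    and dense: "\<And>i z e. i \<in> I \<Longrightarrow> z \<in> Z i \<Longrightarrow> 0 < e \<Longrightarrow>
      \<exists>F w. saturated F \<and> (\<forall>j\<in>I. finite (F j)) \<and> w \<in> F i \<and> dist w z < e \<and>
        (\<forall>j\<in>I. \<forall>p\<in>U j. snd (\<phi> j p) \<in> F j \<longrightarrow> (\<exists>k\<in>I. p \<in> U k \<and> fst (\<phi> k p) \<in> K k))"
  shows "dense_compact_leaves glued I U T \<phi>"
  unfolding dense_compact_leaves_def dense_intersects_open
proof (intro allI impI, elim conjE)
  fix W assume W: "openin glued W" "W \<noteq> {}"
  then obtain p i where p: "p \<in> W" "i \<in> I" "p \<in> U i" unfolding openin_glued by blast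
  obtain x z where xz: "\<phi> i p = (x, z)" by (rule prod.exhaust)
  have z: "z \<in> Z i" "\<psi> i (x, z) = p" using chart[OF p(2,3)] xz by auto
  have "open {e \<in> UNIV \<times> Z i. \<psi> i e \<in> W}" using W(1) p(2) unfolding openin_glued by blast
  then have "open (Pair x -` {e \<in> UNIV \<times> Z i. \<psi> i e \<in> W})"
    by (intro open_vimage continuous_intros)
  moreover have "z \<in> Pair x -` {e \<in> UNIV \<times> Z i. \<psi> i e \<in> W}" using z p by simp
  ultimately have "\<exists>e>0. \<forall>w. dist w z < e \<longrightarrow> w \<in> Pair x -` {e \<in> UNIV \<times> Z i. \<psi> i e \<in> W}"
    unfolding open_dist by (rule bspec)
  then obtain e where e: "0 < e" "\<forall>w. dist w z < e \<longrightarrow> w \<in> Pair x -` {e \<in> UNIV \<times> Z i. \<psi> i e \<in> W}"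
    by (elim exE conjE)
  obtain F w where F: "saturated F" "\<forall>j\<in>I. finite (F j)" "w \<in> F i" "dist w z < e"
    and cover: "\<forall>j\<in>I. \<forall>p\<in>U j. snd (\<phi> j p) \<in> F j \<longrightarrow> (\<exists>k\<in>I. p \<in> U k \<and> fst (\<phi> k p) \<in> K k)"
    using dense[OF p(2) z(1) e(1)] by (elim exE conjE)
  have w: "\<psi> i (x, w) \<in> W" "w \<in> Z i" using e(2)[rule_format, OF F(4)] by simp_all
  then have "\<psi> i (x, w) \<in> U i" "snd (\<phi> i (\<psi> i (x, w))) = w"
    using inverse_chart[OF p(2), of "(x, w)"] by simp_all
  then have "\<psi> i (x, w) \<in> \<Union>{l \<in> leaves I U T \<phi>. compactin L l}"
    using F by (intro compact_leaf_of_finite_saturated[OF F(1) _ K cover[rule_format] p(2)]) auto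
  with w show "\<Union>{l \<in> leaves I U T \<phi>. compactin L l} \<inter> W \<noteq> {}" by blast
qed

text \<open>The infinite distance between different transversals keeps holonomy maps from being compared across
  them.\<close>

definition separation :: "'i \<times> (real^2) \<Rightarrow> 'i \<times> (real^2) \<Rightarrow> ennreal" where
  "separation x y = (if fst x = fst y then ennreal (dist (snd x) (snd y)) else \<infinity>)"

lemma separation_ball:
  assumes "i \<in> I" "0 < r"
  shows "{y \<in> topspace X. separation (i, z) y < ennreal r} = {i} \<times> (ball z r \<inter> Z i)"
  using assms by (auto simp: topspace_X separation_def ennreal_less_iff split: if_splits)

lemma compatible_metric_separation: "compatible_metric X separation"
  unfolding compatible_metric_def
proof (intro conjI ballI)
  fix x y z :: "'i \<times> (real^2)"
  show "separation x y = 0 \<longleftrightarrow> x = y" by (auto simp: separation_def prod_eq_iff ennreal_eq_0_iff)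
  show "separation x y = separation y x" by (simp add: separation_def dist_commute)
  have "ennreal (dist (snd x) (snd z)) \<le> ennreal (dist (snd x) (snd y)) + ennreal (dist (snd y) (snd z))"
    by (simp add: dist_triangle ennreal_leI flip: ennreal_plus)
  then show "separation x z \<le> separation x y + separation y z" by (simp add: separation_def)
next
  let ?B = "{{y \<in> topspace X. separation x y < ennreal r} | x r. x \<in> topspace X \<and> 0 < r}"
  have B_open: "openin X S" if S: "S \<in> ?B" for S
  proof -
    obtain i z r where S: "S = {y \<in> topspace X. separation (i, z) y < ennreal r}" "i \<in> I" "0 < r"
      using S unfolding topspace_X by auto
    have "{w. (k, w) \<in> {i} \<times> (ball z r \<inter> Z i)} = (if k = i then ball z r \<inter> Z i else {})" for k
      by auto
    then show ?thesis
      unfolding S(1) separation_ball[OF S(2,3)] openin_X using S(2) open_transversal by auto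
  qed
  have "openin X V \<longleftrightarrow> openin (topology_generated_by ?B) V" for V
  proof
    assume V: "openin X V"
    show "openin (topology_generated_by ?B) V"
    proof (subst openin_subopen, rule ballI)
      fix x assume x: "x \<in> V"
      obtain i z where iz: "x = (i, z)" by (rule prod.exhaust)
      have i: "i \<in> I" "z \<in> Z i" using x V iz unfolding openin_X by auto
      have "open {w. (i, w) \<in> V}" using V i unfolding openin_X by blast
      then obtain r where r: "0 < r" "ball z r \<subseteq> {w. (i, w) \<in> V}"
        using x iz open_contains_ball[of "{w. (i, w) \<in> V}"] by auto
      have "{i} \<times> (ball z r \<inter> Z i) \<in> ?B"
        using separation_ball[OF i(1) r(1), of z, symmetric] i r unfolding topspace_X by blast
      then have "openin (topology_generated_by ?B) ({i} \<times> (ball z r \<inter> Z i))"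
        by (rule topology_generated_by_Basis)
      moreover have "x \<in> {i} \<times> (ball z r \<inter> Z i)" using iz i r by simp
      moreover have "{i} \<times> (ball z r \<inter> Z i) \<subseteq> V" using r by auto
      ultimately show "\<exists>T. openin (topology_generated_by ?B) T \<and> x \<in> T \<and> T \<subseteq> V"
        by (intro exI conjI)
    qed
  next
    assume "openin (topology_generated_by ?B) V"
    then have "generate_topology_on ?B V" by (rule openin_topology_generated_by)
    with istopology_openin B_open show "openin X V" by (rule generate_topology_on_coarsest)
  qed
  then show "X = topology_generated_by ?B" by (simp add: topology_eq)
qed

lemma open_strict_sublevel:
  assumes "open S" "continuous_on S f"
  shows "open {a \<in> S. f a < (c::real)}"
  using continuous_open_preimage[OF assms(2,1) open_lessThan[of c]] by (simp add: Int_def vimage_def)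

text \<open>Since \<open>\<rho>\<close> is positive and continuous, a small neighbourhood of a point has diameter below all
  values of \<open>\<rho>\<close> on it, and so has its image under the continuous map \<open>h i j\<close>.\<close>

lemma holonomy_map_locally_tame:
  fixes \<rho> :: "real^2 \<Rightarrow> real"
  assumes cont: "\<And>i. i \<in> I \<Longrightarrow> continuous_on (Z i) \<rho>" and pos: "\<And>i z. i \<in> I \<Longrightarrow> z \<in> Z i \<Longrightarrow> 0 < \<rho> z"
    and i: "i \<in> I" and j: "j \<in> I" and x: "x \<in> dom (holonomy_map U \<phi> i j)"
  shows "\<exists>V. openin X V \<and> x \<in> V \<and> V \<subseteq> dom (holonomy_map U \<phi> i j) \<and>
    tame separation (\<lambda>x. \<rho> (snd x)) (holonomy_map U \<phi> i j |` V)"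
proof -
  let ?f = "h i j"
  obtain y where "holonomy_map U \<phi> i j x = Some y" using x by auto
  then obtain z where z: "x = (j, z)" "z \<in> tdom i j"
    unfolding holonomy_map_Some_iff[OF i j] by (cases x) auto
  have Zj: "tdom i j \<subseteq> Z j" by (rule transition_dom_subset[OF j])
  have Zi: "?f ` tdom i j \<subseteq> Z i"
    using transition_swap(1)[OF i j] transition_dom_subset[OF i, of j] by auto
  have c1: "continuous_on (tdom i j) \<rho>" using cont[OF j] Zj by (rule continuous_on_subset)
  have cf: "continuous_on (tdom i j) ?f" by (rule continuous_transition[OF i j])
  have c2: "continuous_on (tdom i j) (\<lambda>a. \<rho> (?f a))"
    by (rule continuous_on_compose2[OF cont[OF i] cf Zi])
  have p1: "0 < \<rho> z" using pos[OF j] Zj z by auto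
  have p2: "0 < \<rho> (?f z)" using pos[OF i] Zi z by auto
  \<comment> \<open>Radius \<open>\<rho>/4\<close> gives diameter at most \<open>\<rho>/2\<close>, and \<open>\<rho>\<close> exceeds half its value at the centre.
    The conditions are written as strict sublevels of continuous functions.\<close>
  define A where "A = {a \<in> tdom i j. dist a z - \<rho> z / 4 < 0} \<inter> {a \<in> tdom i j. - \<rho> a < - \<rho> z / 2} \<inter>
    {a \<in> tdom i j. dist (?f a) (?f z) - \<rho> (?f z) / 4 < 0} \<inter> {a \<in> tdom i j. - \<rho> (?f a) < - \<rho> (?f z) / 2}"
  have "open A" unfolding A_def
    by (intro open_Int open_strict_sublevel open_transition_dom i j continuous_intros c1 c2 cf)
  have zA: "z \<in> A" using z p1 p2 by (simp add: A_def)
  have AD: "A \<subseteq> tdom i j" by (auto simp: A_def)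
  have d1: "dist a b \<le> \<rho> a" if "a \<in> A" "b \<in> A" for a b
    using that dist_triangle2[of a b z] p1 unfolding A_def by simp
  have d2: "dist (?f a) (?f b) \<le> \<rho> (?f a)" if "a \<in> A" "b \<in> A" for a b
    using that dist_triangle2[of "?f a" "?f b" "?f z"] p2 unfolding A_def by simp
  show ?thesis
  proof (intro exI[of _ "{j} \<times> A"] conjI)
    have "{w. (k, w) \<in> {j} \<times> A} = (if k = j then A else {})" for k by auto
    then show "openin X ({j} \<times> A)"
      unfolding openin_X using \<open>open A\<close> j AD Zj by auto
    show "x \<in> {j} \<times> A" using z zA by simp
    show "{j} \<times> A \<subseteq> dom (holonomy_map U \<phi> i j)"
    proof
      fix y assume "y \<in> {j} \<times> A"
      then have "holonomy_map U \<phi> i j y = Some (i, ?f (snd y))"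
        using AD unfolding holonomy_map_Some_iff[OF i j] by auto
      then show "y \<in> dom (holonomy_map U \<phi> i j)" by (rule domI)
    qed
    show "tame separation (\<lambda>x. \<rho> (snd x)) (holonomy_map U \<phi> i j |` ({j} \<times> A))"
      unfolding tame_def restrict_map_Some_iff holonomy_map_Some_iff[OF i j]
    proof (intro disjI2 allI impI)
      fix x x' y y' :: "'i \<times> (real^2)"
      assume a: "x \<in> {j} \<times> A \<and> fst x = j \<and> snd x \<in> tdom i j \<and> x' = (i, ?f (snd x))"
        "y \<in> {j} \<times> A \<and> fst y = j \<and> snd y \<in> tdom i j \<and> y' = (i, ?f (snd y))"
      then have "snd x \<in> A" "snd y \<in> A" by auto
      with a d1 d2 show "separation x y \<le> ennreal (\<rho> (snd x)) \<and> separation x' y' \<le> ennreal (\<rho> (snd x'))"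
        by (simp add: separation_def ennreal_leI)
    qed
  qed
qed

text \<open>The witness against sensitivity with constant \<open>c\<close> is a point whose whole orbit lies where \<open>\<rho> < c\<close>:
  a tame map that is not part of the identity brings neighbours of the point to within
  \<open>\<rho>\<close> of its image.\<close>

lemma not_sensitiveI:
  fixes \<rho> :: "real^2 \<Rightarrow> real"
  assumes cont: "\<And>i. i \<in> I \<Longrightarrow> continuous_on (Z i) \<rho>" and pos: "\<And>i z. i \<in> I \<Longrightarrow> z \<in> Z i \<Longrightarrow> 0 < \<rho> z"
    and small: "\<And>c. 0 < c \<Longrightarrow>
      \<exists>F. saturated F \<and> (\<exists>i\<in>I. F i \<noteq> {}) \<and> (\<forall>i\<in>I. \<forall>z\<in>F i. \<rho> z < c)"
  shows "\<not> sensitive_foliation I U T \<phi>"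
proof
  assume sens: "sensitive_foliation I U T \<phi>"
  define S where "S = {f \<in> G. tame separation (\<lambda>x. \<rho> (snd x)) f}"
  have loc: "\<exists>V. openin X V \<and> x \<in> V \<and> V \<subseteq> dom f \<and> tame separation (\<lambda>x. \<rho> (snd x)) (f |` V)"
    if "f \<in> {holonomy_map U \<phi> i j | i j. i \<in> I \<and> j \<in> I}" "x \<in> dom f" for f x
  proof -
    from that(1) obtain i j where ij: "f = holonomy_map U \<phi> i j" "i \<in> I" "j \<in> I" by blast
    from that(2) show ?thesis unfolding ij(1)
      by (intro holonomy_map_locally_tame cont pos ij(2,3))
  qed
  have S: "pseudostargroup X S" "generates X S G"
    unfolding S_def holonomy_pseudogroup_def
    by (rule tame_generates[OF holonomy_maps_Ph loc]; assumption)+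
  have "S \<subseteq> G" by (auto simp: S_def)
  have "compatible_metric X separation \<and> pseudostargroup X S \<and> S \<subseteq> G \<and> generates X S G"
    using S \<open>S \<subseteq> G\<close> compatible_metric_separation by simp
  from sens[unfolded sensitive_foliation_def sensitive_def, rule_format, OF this]
  obtain c :: real where c: "0 < c"
    "\<forall>x\<in>topspace X. \<forall>r::real. 0 < r \<longrightarrow> (\<exists>s\<in>S. \<exists>y. x \<in> dom s \<and> y \<in> dom s \<and>
       separation x y < ennreal r \<and> ennreal c \<le> separation (the (s x)) (the (s y)))"
    by (elim exE conjE)
  obtain F i z where F: "saturated F" "\<forall>i\<in>I. \<forall>z\<in>F i. \<rho> z < c" and i: "i \<in> I" "z \<in> F i"
    using small[OF c(1)] by blast
  have "(i, z) \<in> topspace X" using F(1) i unfolding saturated_def topspace_X by auto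
  \<comment> \<open>Radius \<open>r = c\<close> excludes parts of the identity, which preserve the distance.\<close>
  from c(2)[rule_format, OF this c(1)] obtain s y where s: "s \<in> S" "(i, z) \<in> dom s" "y \<in> dom s"
    "separation (i, z) y < ennreal c" "ennreal c \<le> separation (the (s (i, z))) (the (s y))" by blast
  obtain x' y' where x'y': "s (i, z) = Some x'" "s y = Some y'" using s(2,3) by auto
  have sG: "s \<in> G" and tm: "tame separation (\<lambda>x. \<rho> (snd x)) s" using s(1) by (auto simp: S_def)
  have "s \<in> Ph X" using sG pseudogroup_closure(1)[OF pseudogroup_G] by auto
  have x'X: "x' \<in> topspace X" using Ph_D(1)[OF \<open>s \<in> Ph X\<close> x'y'(1)] by simp
  then have f: "fst x' \<in> I" "snd x' \<in> Z (fst x')" unfolding topspace_X by auto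
  from tm[unfolded tame_def] show False
  proof (elim disjE)
    assume "\<forall>x y. s x = Some y \<longrightarrow> y = x"
    then have "x' = (i, z)" "y' = y" using x'y' by blast+
    with s(4,5) x'y' show False by simp
  next
    assume "\<forall>x x' y y'. s x = Some x' \<longrightarrow> s y = Some y' \<longrightarrow>
      separation x y \<le> ennreal (\<rho> (snd x)) \<and> separation x' y' \<le> ennreal (\<rho> (snd x'))"
    then have "separation x' y' \<le> ennreal (\<rho> (snd x'))" using x'y' by blast
    then have "ennreal c \<le> ennreal (\<rho> (snd x'))" using s(5) x'y' by simp
    moreover have "0 < \<rho> (snd x')" by (rule pos[OF f])
    ultimately have "c \<le> \<rho> (snd x')" using c(1) by (simp add: ennreal_le_iff)
    moreover have "snd x' \<in> F (fst x')"
      using saturated_invariant[OF F(1) sG x'y'(1)] i(2) by simp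
    then have "\<rho> (snd x') < c" using F(2) f(1) by simp
    ultimately show False by simp
  qed
qed

end

section \<open>Smooth and transversally affine structures of glued foliations\<close>

abbreviation pt2 :: "real \<Rightarrow> real \<Rightarrow> real^2" where "pt2 x y \<equiv> vector [x, y]"

lemma pt2_eta: "pt2 (z$1) (z$2) = z"
  by (simp add: vec_eq_iff forall_2)

lemma pt2_eq_iff: "pt2 x y = pt2 x' y' \<longleftrightarrow> x = x' \<and> y = y'"
  by (auto simp: vec_eq_iff forall_2)

text \<open>The product of two planes as \<open>\<real>\<^sup>4\<close>, the model space of the manifold.\<close>

definition join4 :: "(real^2) \<times> (real^2) \<Rightarrow> real^4" where
  "join4 p = (\<chi> i. if i = 1 then fst p $ 1 else if i = 2 then fst p $ 2
     else if i = 3 then snd p $ 1 else snd p $ 2)"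

definition split4 :: "real^4 \<Rightarrow> (real^2) \<times> (real^2)" where
  "split4 y = (pt2 (y$1) (y$2), pt2 (y$3) (y$4))"

lemma split4_join4: "split4 (join4 p) = p"
  by (simp add: split4_def join4_def pt2_eta)

lemma join4_split4: "join4 (split4 y) = y"
  by (simp add: split4_def join4_def vec_eq_iff forall_4)

lemma linear_join4: "linear join4"
  by (rule linearI) (simp_all add: join4_def vec_eq_iff forall_4)

lemma linear_split4: "linear split4"
  by (rule linearI) (simp_all add: split4_def vec_eq_iff forall_2 prod_eq_iff)

lemma join4_image: "join4 ` S = split4 -` S"
proof (intro equalityI subsetI)
  fix y assume "y \<in> split4 -` S"
  then show "y \<in> join4 ` S" by (intro image_eqI[of _ _ "split4 y"]) (simp_all add: join4_split4)
qed (auto simp: split4_join4)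

lemma open_join4_image: "open S \<Longrightarrow> open (join4 ` S)"
  unfolding join4_image using linear_split4
  by (simp add: open_vimage linear_continuous_on linear_linear)

lemma homeomorphic_map_join4: "homeomorphic_map (top_of_set S) (top_of_set (join4 ` S)) join4"
proof -
  have "continuous_on S join4" "continuous_on (join4 ` S) split4"
    using linear_join4 linear_split4 by (simp_all add: linear_continuous_on linear_linear)
  then have "homeomorphic_maps (top_of_set S) (top_of_set (join4 ` S)) join4 split4"
    unfolding homeomorphic_maps_def by (auto simp: split4_join4 join4_split4)
  then show ?thesis by (simp add: homeomorphic_maps_map)
qed

text \<open>The foliated charts themselves, read in \<open>\<real>\<^sup>4\<close>, serve as smooth structure of the glued manifold, and
  the inclusions of the sets \<open>Z i\<close> into \<open>\<real>\<^sup>2\<close> serve as affine structures of the transversals. Smoothness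
  of all charts then reduces to smoothness of the coordinate changes.\<close>

locale smooth_gluing = foliated_gluing +
  assumes smooth_change: "\<And>i j. i \<in> I \<Longrightarrow> j \<in> I \<Longrightarrow>
      smooth_on {e \<in> UNIV \<times> Z i. \<psi> i e \<in> U j} (\<lambda>e. \<phi> j (\<psi> i e))"
    and affine_transition: "\<And>i j. i \<in> I \<Longrightarrow> j \<in> I \<Longrightarrow> locally_affine_on (transition_dom U \<phi> i j) (h i j)"
begin

definition joined_charts :: "('b set \<times> ('b \<Rightarrow> real^4)) set" where
  "joined_charts = (\<lambda>i. (U i, join4 \<circ> \<phi> i)) ` I"

abbreviation overlap_region :: "'a \<Rightarrow> 'a \<Rightarrow> ((real^2) \<times> (real^2)) set" where
  "overlap_region i j \<equiv> {e \<in> UNIV \<times> Z i. \<psi> i e \<in> U j}"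

lemma joined_chart_image: "i \<in> I \<Longrightarrow> (join4 \<circ> \<phi> i) ` (U i \<inter> V) = join4 ` {e \<in> UNIV \<times> Z i. \<psi> i e \<in> V}"
  unfolding image_comp[symmetric] by (simp add: chart_image_overlap)

lemma inv_into_joined_chart:
  assumes "i \<in> I" "e \<in> UNIV \<times> Z i"
  shows "inv_into (U i) (join4 \<circ> \<phi> i) (join4 e) = \<psi> i e"
proof (rule inv_into_f_eq)
  show "inj_on (join4 \<circ> \<phi> i) (U i)"
  proof (rule inj_on_inverseI[of _ "\<psi> i \<circ> split4"])
    fix p assume "p \<in> U i"
    then show "(\<psi> i \<circ> split4) ((join4 \<circ> \<phi> i) p) = p"
      using chart[OF assms(1), of p] by (simp add: split4_join4)
  qed
  show "\<psi> i e \<in> U i" "(join4 \<circ> \<phi> i) (\<psi> i e) = join4 e"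
    using inverse_chart[OF assms] by simp_all
qed

text \<open>Transfer of smoothness from the product of two planes to \<open>\<real>\<^sup>4\<close>; the map
  on \<open>\<real>\<^sup>4\<close> is described by its values at the points \<open>join4 e\<close>, which is how inverses of charts are known.\<close>

lemma smooth_on_join4_image:
  assumes "open S" "smooth_on S f" "\<And>e. e \<in> S \<Longrightarrow> g (join4 e) = f e"
  shows "smooth_on (join4 ` S) g"
proof (rule smooth_on_cong[OF open_join4_image[OF assms(1)]])
  show "smooth_on (join4 ` S) (\<lambda>y. f (split4 y))"
    unfolding join4_image by (rule smooth_on_compose_linear[OF assms(1) linear_split4 assms(2)])
  show "g y = f (split4 y)" if "y \<in> join4 ` S" for y
    using that assms(3) by (auto simp: split4_join4)
qed

lemma smooth_atlas_joined_charts: "smooth_atlas glued joined_charts"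
proof -
  have coord: "coord_chart glued c" if "c \<in> joined_charts" for c
  proof -
  from that
  obtain i where i: "i \<in> I" "c = (U i, join4 \<circ> \<phi> i)" by (auto simp: joined_charts_def)
  have im: "(join4 \<circ> \<phi> i) ` U i = join4 ` (UNIV \<times> Z i)"
  proof -
    have "{e \<in> UNIV \<times> Z i. \<psi> i e \<in> U i} = UNIV \<times> Z i" using inverse_chart[OF i(1)] by auto
    then show ?thesis using joined_chart_image[OF i(1), of "U i"] by simp
  qed
  show ?thesis
    unfolding coord_chart_def i(2) case_prod_conv im
    using openin_domain[OF i(1)] open_join4_image[OF open_chart_image[OF i(1)]]
      homeomorphic_map_compose[OF homeomorphic_map_chart[OF i(1)] homeomorphic_map_join4]
    by blast
  qed
  have change: "smooth_on ((join4 \<circ> \<phi> i) ` (U i \<inter> U j)) ((join4 \<circ> \<phi> j) \<circ> inv_into (U i) (join4 \<circ> \<phi> i))"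
    if ij: "i \<in> I" "j \<in> I" for i j
    unfolding joined_chart_image[OF ij(1)]
  proof (rule smooth_on_join4_image[OF open_overlap[OF ij]])
    show "smooth_on (overlap_region i j) (\<lambda>e. join4 (\<phi> j (\<psi> i e)))"
      by (rule smooth_on_linear_compose[OF open_overlap[OF ij] linear_join4 smooth_change[OF ij]])
  qed (simp add: inv_into_joined_chart[OF ij(1)])
  have "\<forall>(U, a)\<in>joined_charts. \<forall>(V, b)\<in>joined_charts. smooth_on (a ` (U \<inter> V)) (b \<circ> inv_into U a)"
    unfolding joined_charts_def ball_simps case_prod_conv by (intro ballI change)
  moreover have "(\<Union>(V, a)\<in>joined_charts. V) = topspace glued"
    by (simp add: joined_charts_def topspace_glued)
  ultimately show ?thesis unfolding atlas_def using coord by blast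
qed

lemma atlas_identity:
  assumes "open Y" "P Y (\<lambda>x. x)"
    and cong: "\<And>f. (\<And>x. x \<in> Y \<Longrightarrow> f x = x) \<Longrightarrow> P Y (\<lambda>x. x) \<Longrightarrow> P Y f"
  shows "atlas P (top_of_set Y) {(Y :: (real^2) set, id)}"
proof -
  have "coord_chart (top_of_set Y) (Y, id)"
    using assms(1) by (simp add: coord_chart_def subtopology_subtopology)
  moreover have "P Y (id \<circ> inv_into Y id)"
    by (rule cong[OF _ assms(2)]) (simp add: inv_into_f_eq)
  ultimately show ?thesis by (simp add: atlas_def)
qed

lemma smooth_foliated_atlas_glued:
  "smooth_foliated_atlas glued joined_charts I U T (\<lambda>i. {(Z i, id)}) \<phi>"
  unfolding smooth_foliated_atlas_def
proof (intro conjI ballI)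
  show "foliated_atlas glued I U T \<phi>" by (rule foliated_atlas_glued)
  fix i assume i: "i \<in> I"
  have oZ: "open (Z i)" by (rule open_transversal[OF i])
  have sid: "smooth_on (Z i) (\<lambda>x. x)"
    by (rule smooth_on_locally_affine[OF oZ locally_affine_on_id])
  show "smooth_atlas (T i) {(Z i, id)}"
    by (rule atlas_identity[where P = smooth_on, OF oZ sid]) (rule smooth_on_cong[OF oZ])
  have mp: "map_prod id id = (id :: (real^2) \<times> (real^2) \<Rightarrow> _)" by (simp add: fun_eq_iff)
  show "in_charts smooth_on joined_charts (plane_times_atlas {(Z i, id)}) (U i) (\<phi> i)"
    unfolding in_charts_def joined_charts_def plane_times_atlas_def ball_simps image_insert image_empty case_prod_conv mp
  proof (intro ballI conjI TrueI)
    fix j assume j: "j \<in> I"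
    have "U j \<inter> U i \<inter> \<phi> i -` (UNIV \<times> Z i) = U j \<inter> U i"
      using chart[OF i] by auto
    then have "(join4 \<circ> \<phi> j) ` (U j \<inter> U i \<inter> \<phi> i -` (UNIV \<times> Z i)) = join4 ` overlap_region j i"
      using joined_chart_image[OF j, of "U i"] by simp
    moreover have "smooth_on (join4 ` overlap_region j i) (id \<circ> \<phi> i \<circ> inv_into (U j) (join4 \<circ> \<phi> j))"
      by (rule smooth_on_join4_image[OF open_overlap[OF j i] smooth_change[OF j i]])
        (simp add: inv_into_joined_chart[OF j])
    ultimately show "smooth_on ((join4 \<circ> \<phi> j) ` (U j \<inter> U i \<inter> \<phi> i -` (UNIV \<times> Z i)))
        (id \<circ> \<phi> i \<circ> inv_into (U j) (join4 \<circ> \<phi> j))" by (simp only:)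
  qed
  show "in_charts smooth_on (plane_times_atlas {(Z i, id)}) joined_charts
          (UNIV \<times> topspace (T i)) (inv_into (U i) (\<phi> i))"
    unfolding in_charts_def joined_charts_def plane_times_atlas_def ball_simps image_insert image_empty case_prod_conv mp
  proof (intro ballI conjI TrueI)
    fix j assume j: "j \<in> I"
    let ?A = "UNIV \<times> Z i \<inter> UNIV \<times> topspace (T i) \<inter> inv_into (U i) (\<phi> i) -` U j"
    have "?A = overlap_region i j"
      using inv_into_chart[OF i] by auto
    moreover have "smooth_on (overlap_region i j) (join4 \<circ> \<phi> j \<circ> inv_into (U i) (\<phi> i) \<circ> inv_into (UNIV \<times> Z i) id)"
    proof (rule smooth_on_cong[OF open_overlap[OF i j]])
      show "smooth_on (overlap_region i j) (\<lambda>e. join4 (\<phi> j (\<psi> i e)))"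
        by (rule smooth_on_linear_compose[OF open_overlap[OF i j] linear_join4 smooth_change[OF i j]])
      show "(join4 \<circ> \<phi> j \<circ> inv_into (U i) (\<phi> i) \<circ> inv_into (UNIV \<times> Z i) id) e = join4 (\<phi> j (\<psi> i e))"
        if e: "e \<in> overlap_region i j" for e
      proof -
        have "e \<in> UNIV \<times> Z i" using e by simp
        then have "inv_into (UNIV \<times> Z i) id e = e" "inv_into (U i) (\<phi> i) e = \<psi> i e"
          by (intro inv_into_f_eq inv_into_chart[OF i]; simp)+
        then show ?thesis by simp
      qed
    qed
    ultimately show "smooth_on (id ` (UNIV \<times> Z i \<inter> UNIV \<times> topspace (T i) \<inter> inv_into (U i) (\<phi> i) -` U j))
        (join4 \<circ> \<phi> j \<circ> inv_into (U i) (\<phi> i) \<circ> inv_into (UNIV \<times> Z i) id)"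
      by (simp only: image_id id_apply)
  qed
qed

lemma transversally_affine_glued: "transversally_affine I U T (\<lambda>i. {(Z i, id)}) \<phi>"
  unfolding transversally_affine_def
proof (intro conjI ballI)
  fix i assume i: "i \<in> I"
  show "affine_atlas (T i) {(Z i, id)}"
    by (rule atlas_identity[where P = locally_affine_on, OF open_transversal[OF i] locally_affine_on_id])
      (rule locally_affine_on_cong[OF _ subset_refl])
  fix j assume j: "j \<in> I"
  have "locally_affine_on (id ` (Z j \<inter> transition_dom U \<phi> i j \<inter> transition_map U \<phi> i j -` Z i))
      (id \<circ> transition_map U \<phi> i j \<circ> inv_into (Z j) id)"
  proof (rule locally_affine_on_cong[OF affine_transition[OF i j]])
    fix z assume "z \<in> id ` (Z j \<inter> transition_dom U \<phi> i j \<inter> transition_map U \<phi> i j -` Z i)"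
    then have z: "z \<in> Z j" "z \<in> transition_dom U \<phi> i j" by auto
    from z(1) have "inv_into (Z j) id z = z" by (intro inv_into_f_eq) auto
    then show "(id \<circ> transition_map U \<phi> i j \<circ> inv_into (Z j) id) z = h i j z"
      using transition_map_eq[OF i j z(2)] by simp
  qed auto
  then show "in_charts locally_affine_on {(Z j, id)} {(Z i, id)}
      (transition_dom U \<phi> i j) (transition_map U \<phi> i j)"
    unfolding in_charts_def by simp
qed

end

section \<open>The baker map\<close>

definition square :: "(real^2) set" where
  "square = {z. 0 < z$1 \<and> z$1 < 1 \<and> 0 < z$2 \<and> z$2 < 1}"

definition vsplit_square :: "(real^2) set" where
  "vsplit_square = {z \<in> square. z$1 \<noteq> 1/2}"

definition hsplit_square :: "(real^2) set" where
  "hsplit_square = {z \<in> square. z$2 \<noteq> 1/2}"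

definition baker :: "real^2 \<Rightarrow> real^2" where
  "baker z = (if z$1 < 1/2 then pt2 (2 * z$1) (z$2 / 2) else pt2 (2 * z$1 - 1) ((z$2 + 1) / 2))"

definition unbaker :: "real^2 \<Rightarrow> real^2" where
  "unbaker z = (if z$2 < 1/2 then pt2 (z$1 / 2) (2 * z$2) else pt2 ((z$1 + 1) / 2) (2 * z$2 - 1))"

lemmas square_defs = square_def vsplit_square_def hsplit_square_def

lemma baker_in: "z \<in> vsplit_square \<Longrightarrow> baker z \<in> hsplit_square"
  by (auto simp: square_defs baker_def)

lemma unbaker_in: "z \<in> hsplit_square \<Longrightarrow> unbaker z \<in> vsplit_square"
  by (auto simp: square_defs unbaker_def)

lemma unbaker_baker: "z \<in> vsplit_square \<Longrightarrow> unbaker (baker z) = z"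
  by (auto simp: square_defs baker_def unbaker_def vec_eq_iff forall_2 add_divide_distrib diff_divide_distrib)

lemma baker_unbaker: "z \<in> hsplit_square \<Longrightarrow> baker (unbaker z) = z"
  by (auto simp: square_defs baker_def unbaker_def vec_eq_iff forall_2 add_divide_distrib diff_divide_distrib)

lemma open_square: "open square"
proof -
  have "square = {z. 0 < z$1} \<inter> {z. z$1 < 1} \<inter> {z. 0 < z$2} \<inter> {z. z$2 < 1}"
    by (auto simp: square_def)
  also have "open \<dots>"
    by (intro open_Int open_Collect_less continuous_intros)
  finally show ?thesis .
qed

lemma open_vsplit_square: "open vsplit_square"
proof -
  have "vsplit_square = square \<inter> {z. z$1 \<noteq> 1/2}" by (auto simp: vsplit_square_def)
  also have "open \<dots>"
    by (intro open_Int open_square open_Collect_neq continuous_intros)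
  finally show ?thesis .
qed

lemma open_hsplit_square: "open hsplit_square"
proof -
  have "hsplit_square = square \<inter> {z. z$2 \<noteq> 1/2}" by (auto simp: hsplit_square_def)
  also have "open \<dots>"
    by (intro open_Int open_square open_Collect_neq continuous_intros)
  finally show ?thesis .
qed

lemma linear_diagonal: "linear (\<lambda>z. pt2 (a * z$1) (b * z$2))"
  by (rule linearI) (simp_all add: vec_eq_iff forall_2 algebra_simps)

lemma locally_affine_on_baker: "locally_affine_on vsplit_square baker"
  unfolding locally_affine_on_def
proof
  fix z assume z: "z \<in> vsplit_square"
  have lin: "linear (\<lambda>z. pt2 (2 * z$1) (z$2 / 2))"
    using linear_diagonal[of 2 "1/2"] by simp
  have op: "open {z::real^2. z$1 < 1/2}" "open {z::real^2. z$1 > 1/2}"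
    by (intro open_Collect_less continuous_intros)+
  consider "z$1 < 1/2" | "z$1 > 1/2" using z unfolding square_defs by fastforce
  then show "\<exists>V A b. open V \<and> z \<in> V \<and> linear A \<and> (\<forall>y\<in>V \<inter> vsplit_square. baker y = A y + b)"
  proof cases
    case 1
    then show ?thesis using op
      by (intro exI[of _ "{z. z$1 < 1/2}"] exI[of _ "\<lambda>z. pt2 (2 * z$1) (z$2 / 2)"] exI[of _ 0])
        (auto simp: lin baker_def vec_eq_iff forall_2)
  next
    case 2
    then show ?thesis using op
      by (intro exI[of _ "{z. z$1 > 1/2}"] exI[of _ "\<lambda>z. pt2 (2 * z$1) (z$2 / 2)"] 
          exI[of _ "pt2 (-1) (1/2)"])
        (auto simp: lin baker_def vec_eq_iff forall_2 add_divide_distrib)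
  qed
qed

lemma locally_affine_on_unbaker: "locally_affine_on hsplit_square unbaker"
  unfolding locally_affine_on_def
proof
  fix z assume z: "z \<in> hsplit_square"
  have lin: "linear (\<lambda>z. pt2 (z$1 / 2) (2 * z$2))"
    using linear_diagonal[of "1/2" 2] by simp
  have op: "open {z::real^2. z$2 < 1/2}" "open {z::real^2. z$2 > 1/2}"
    by (intro open_Collect_less continuous_intros)+
  consider "z$2 < 1/2" | "z$2 > 1/2" using z unfolding square_defs by fastforce
  then show "\<exists>V A b. open V \<and> z \<in> V \<and> linear A \<and> (\<forall>y\<in>V \<inter> hsplit_square. unbaker y = A y + b)"
  proof cases
    case 1
    then show ?thesis using op
      by (intro exI[of _ "{z. z$2 < 1/2}"] exI[of _ "\<lambda>z. pt2 (z$1 / 2) (2 * z$2)"] exI[of _ 0])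
        (auto simp: lin unbaker_def vec_eq_iff forall_2)
  next
    case 2
    then show ?thesis using op
      by (intro exI[of _ "{z. z$2 > 1/2}"] exI[of _ "\<lambda>z. pt2 (z$1 / 2) (2 * z$2)"] 
          exI[of _ "pt2 (1/2) (-1)"])
        (auto simp: lin unbaker_def vec_eq_iff forall_2 add_divide_distrib)
  qed
qed

definition baker_rel :: "((real^2) \<times> (real^2)) set" where
  "baker_rel = {(z, baker z) | z. z \<in> vsplit_square}"

text \<open>A branch of the \<open>k\<close>-th iterate of the baker map: the \<open>k\<close> binary digits of \<open>P\<close> are the first
  digits of \<open>x\<close>, those of \<open>Q\<close> are the same digits in reverse order, and \<open>k\<close> iterations move them from \<open>x\<close>
  to \<open>y\<close>. The reversal of digit strings stays implicit in the relation between \<open>P\<close> and \<open>Q\<close>.\<close>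

definition branch :: "nat \<Rightarrow> nat \<Rightarrow> nat \<Rightarrow> bool" where
  "branch k P Q \<longleftrightarrow> P < 2 ^ k \<and> Q < 2 ^ k \<and>
     (\<forall>x y. real P < 2 ^ k * x \<longrightarrow> 2 ^ k * x < real P + 1 \<longrightarrow> 0 < y \<longrightarrow> y < 1 \<longrightarrow>
        (pt2 x y, pt2 (2 ^ k * x - P) ((y + Q) / 2 ^ k)) \<in> baker_rel ^^ k)"

lemma branchD:
  assumes "branch k P Q" "real P < 2 ^ k * x" "2 ^ k * x < real P + 1" "0 < y" "y < 1"
  shows "(pt2 x y, pt2 (2 ^ k * x - P) ((y + Q) / 2 ^ k)) \<in> baker_rel ^^ k"
  using assms unfolding branch_def by metis

lemma branch_0: "branch 0 0 0"
  by (simp add: branch_def)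

lemma branch_1: "i < 2 \<Longrightarrow> branch (Suc 0) i i"
  by (auto simp: branch_def baker_rel_def baker_def square_defs pt2_eq_iff less_2_cases_iff
      add_divide_distrib)

text \<open>Concatenation of digit strings. After \<open>k\<close> steps the point has first coordinate \<open>2\<^sup>k x - P\<close>, whose first
  digits are those of \<open>P'\<close>, and the later digits end up in front of the earlier ones in \<open>y\<close>.\<close>

lemma branch_append:
  assumes 1: "branch k P Q" and 2: "branch l P' Q'"
  shows "branch (k + l) (P * 2 ^ l + P') (Q' * 2 ^ k + Q)"
  unfolding branch_def
proof (intro conjI allI impI)
  have bound: "a * 2 ^ n + b < 2 ^ (m + n)" if "a < 2 ^ m" "b < 2 ^ n" for a b m n :: nat
  proof -
    have "a * 2 ^ n + b < (a + 1) * 2 ^ n" using that by simp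
    also have "\<dots> \<le> 2 ^ m * 2 ^ n" using that by (intro mult_right_mono) auto
    finally show ?thesis by (simp add: power_add)
  qed
  have lt: "P < 2 ^ k" "Q < 2 ^ k" "P' < 2 ^ l" "Q' < 2 ^ l"
    using 1 2 by (auto simp: branch_def)
  show "P * 2 ^ l + P' < 2 ^ (k + l)" using bound lt by blast
  show "Q' * 2 ^ k + Q < 2 ^ (k + l)" using bound[OF lt(4,2)] by (simp add: add.commute)
  fix x y :: real
  assume x: "real (P * 2 ^ l + P') < 2 ^ (k + l) * x" "2 ^ (k + l) * x < real (P * 2 ^ l + P') + 1"
    and y: "0 < y" "y < 1"
  define x2 where "x2 = 2 ^ k * x - P"
  define y2 where "y2 = (y + Q) / 2 ^ k"
  have e: "2 ^ l * x2 = 2 ^ (k + l) * x - P * 2 ^ l"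
    by (simp add: x2_def power_add algebra_simps)
  have x2: "real P' < 2 ^ l * x2" "2 ^ l * x2 < real P' + 1" using x e by simp_all
  have "real P' + 1 \<le> 2 ^ l"
    using lt(3) by (metis Suc_eq_plus1 Suc_leI of_nat_Suc of_nat_le_iff of_nat_numeral of_nat_power add.commute)
  then have "2 ^ l * x2 < 2 ^ l * 1" using x2(2) by linarith
  then have "x2 < 1" by simp
  moreover have "0 < 2 ^ l * x2" using x2(1) by (meson le_less_trans of_nat_0_le_iff)
  then have "0 < x2" by (simp add: zero_less_mult_iff)
  ultimately have s1: "(pt2 x y, pt2 x2 y2) \<in> baker_rel ^^ k"
    unfolding x2_def y2_def using x2_def by (intro branchD[OF 1] y) linarith+
  have "real Q + 1 \<le> 2 ^ k"
    using lt(2) by (metis Suc_eq_plus1 Suc_leI of_nat_Suc of_nat_le_iff of_nat_numeral of_nat_power add.commute)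
  then have "0 < y2" "y2 < 1" using y by (simp_all add: y2_def divide_simps add_pos_nonneg)
  then have s2: "(pt2 x2 y2, pt2 (2 ^ l * x2 - P') ((y2 + Q') / 2 ^ l)) \<in> baker_rel ^^ l"
    using x2 by (intro branchD[OF 2])
  have "2 ^ l * x2 - P' = 2 ^ (k + l) * x - real (P * 2 ^ l + P')" using e by simp
  moreover have "(y2 + Q') / 2 ^ l = (y + real (Q' * 2 ^ k + Q)) / 2 ^ (k + l)"
    by (simp add: y2_def power_add field_simps)
  ultimately show "(pt2 x y, pt2 (2 ^ (k + l) * x - real (P * 2 ^ l + P'))
      ((y + real (Q' * 2 ^ k + Q)) / 2 ^ (k + l))) \<in> baker_rel ^^ (k + l)"
    using s1 s2 unfolding relpow_add by (metis relcomp.relcompI)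
qed

lemma branch_with_start: "P < 2 ^ k \<Longrightarrow> \<exists>Q. branch k P Q"
proof (induction k arbitrary: P)
  case 0
  then show ?case using branch_0 by auto
next
  case (Suc k)
  then have "P div 2 < 2 ^ k" by simp
  then obtain Q where "branch k (P div 2) Q" using Suc.IH by blast
  from branch_append[OF this branch_1[of "P mod 2"]] show ?case by auto
qed

lemma branch_with_end: "Q < 2 ^ k \<Longrightarrow> \<exists>P. branch k P Q"
proof (induction k arbitrary: Q)
  case 0
  then show ?case using branch_0 by auto
next
  case (Suc k)
  then have "Q div 2 < 2 ^ k" by simp
  then obtain P where "branch k P (Q div 2)" using Suc.IH by blast
  from branch_append[OF branch_1[of "Q mod 2"] this] show ?case by auto
qed

lemma dyadic_approx:
  assumes u: "0 < u" "u < (1::real)" and e: "inverse (2 ^ m) < e"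
  obtains a where "a < 2 ^ m" "\<And>\<theta>. 0 \<le> \<theta> \<Longrightarrow> \<theta> \<le> 1 \<Longrightarrow> \<bar>(real a + \<theta>) / 2 ^ m - u\<bar> < e"
proof
  define a where "a = nat \<lfloor>2 ^ m * u\<rfloor>"
  have pos: "0 < 2 ^ m * u" using u by simp
  have a: "real a \<le> 2 ^ m * u" "2 ^ m * u < real a + 1"
    using pos unfolding a_def by linarith+
  have "2 ^ m * u < 2 ^ m" using u by simp
  then have "real a < 2 ^ m" using a by linarith
  then show "a < 2 ^ m" by simp
  fix \<theta> :: real assume t: "0 \<le> \<theta>" "\<theta> \<le> 1"
  have "\<bar>(real a + \<theta>) - 2 ^ m * u\<bar> \<le> 1" using a t by linarith
  then have "\<bar>(real a + \<theta>) - 2 ^ m * u\<bar> / 2 ^ m \<le> 1 / 2 ^ m" by (intro divide_right_mono) auto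
  moreover have "\<bar>(real a + \<theta>) - 2 ^ m * u\<bar> / 2 ^ m = \<bar>(real a + \<theta>) / 2 ^ m - u\<bar>"
  proof -
    have "((real a + \<theta>) - 2 ^ m * u) / 2 ^ m = (real a + \<theta>) / 2 ^ m - u"
      by (simp add: field_simps)
    moreover have "\<bar>(real a + \<theta>) - 2 ^ m * u\<bar> / 2 ^ m = \<bar>((real a + \<theta>) - 2 ^ m * u) / 2 ^ m\<bar>"
      by simp
    ultimately show ?thesis by simp
  qed
  ultimately show "\<bar>(real a + \<theta>) / 2 ^ m - u\<bar> < e" using e by (simp add: inverse_eq_divide)
qed

text \<open>One branch takes care of a neighbourhood of \<open>u\<close> in the first coordinate before, and of \<open>v\<close> in the
  second coordinate after the iteration: prescribe the beginning of the digit string by \<open>u\<close>, and its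
  end by \<open>v\<close>.\<close>

lemma branch_approx:
  assumes u: "0 < u" "u < (1::real)" and v: "0 < v" "v < (1::real)" and e: "0 < e"
  obtains n P Q where "0 < n" "branch n P Q"
    "\<And>\<theta>. 0 \<le> \<theta> \<Longrightarrow> \<theta> \<le> 1 \<Longrightarrow> \<bar>(real P + \<theta>) / 2 ^ n - u\<bar> < e"
    "\<And>\<theta>. 0 \<le> \<theta> \<Longrightarrow> \<theta> \<le> 1 \<Longrightarrow> \<bar>(real Q + \<theta>) / 2 ^ n - v\<bar> < e"
proof -
  obtain m0 where "inverse (2 ^ m0) < e"
    using reals_power_lt_ex[OF e, of 2] by (auto simp: power_one_over inverse_eq_divide)
  moreover have "inverse (2 ^ Suc m0) \<le> inverse (2 ^ m0 :: real)" by (simp add: field_simps)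
  ultimately obtain m where m: "inverse (2 ^ m) < e" "0 < m"
    using le_less_trans zero_less_Suc by metis
  \<comment> \<open>The first \<open>m\<close> digits of \<open>u\<close> and of \<open>v\<close>; the latter are to appear at the front of \<open>y\<close>.\<close>
  obtain a where a: "a < 2 ^ m" "\<And>\<theta>. 0 \<le> \<theta> \<Longrightarrow> \<theta> \<le> 1 \<Longrightarrow> \<bar>(real a + \<theta>) / 2 ^ m - u\<bar> < e"
    using dyadic_approx[OF u m(1)] by blast
  obtain b where b: "b < 2 ^ m" "\<And>\<theta>. 0 \<le> \<theta> \<Longrightarrow> \<theta> \<le> 1 \<Longrightarrow> \<bar>(real b + \<theta>) / 2 ^ m - v\<bar> < e"
    using dyadic_approx[OF v m(1)] by blast
  obtain q where q: "branch m a q" using branch_with_start a by blast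
  obtain p where p: "branch m p b" using branch_with_end b by blast
  have sub: "\<exists>\<theta>'. 0 \<le> \<theta>' \<and> \<theta>' \<le> 1 \<and> (real (c * 2 ^ m + d) + \<theta>) / 2 ^ (m + m) = (real c + \<theta>') / 2 ^ m"
    if "d < 2 ^ m" "0 \<le> \<theta>" "\<theta> \<le> 1" for c d :: nat and \<theta> :: real
  proof (intro exI conjI)
    have "real d + 1 \<le> 2 ^ m"
      using that(1) by (metis Suc_eq_plus1 Suc_leI of_nat_Suc of_nat_le_iff of_nat_numeral of_nat_power add.commute)
    then show "(real d + \<theta>) / 2 ^ m \<le> 1" using that by (simp add: divide_simps)
    show "0 \<le> (real d + \<theta>) / 2 ^ m" using that by simp
    show "(real (c * 2 ^ m + d) + \<theta>) / 2 ^ (m + m) = (real c + (real d + \<theta>) / 2 ^ m) / 2 ^ m"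
      by (simp add: power_add field_simps)
  qed
  have "p < 2 ^ m" "q < 2 ^ m" using p q by (auto simp: branch_def)
  show ?thesis
  proof (rule that[of "m + m" "a * 2 ^ m + p" "b * 2 ^ m + q"])
    show "branch (m + m) (a * 2 ^ m + p) (b * 2 ^ m + q)" by (rule branch_append[OF q p])
    show "\<bar>(real (a * 2 ^ m + p) + \<theta>) / 2 ^ (m + m) - u\<bar> < e" if "0 \<le> \<theta>" "\<theta> \<le> 1" for \<theta>
      using sub[OF \<open>p < 2 ^ m\<close> that, of a] a(2) by force
    show "\<bar>(real (b * 2 ^ m + q) + \<theta>) / 2 ^ (m + m) - v\<bar> < e" if "0 \<le> \<theta>" "\<theta> \<le> 1" for \<theta>
      using sub[OF \<open>q < 2 ^ m\<close> that, of b] b(2) by force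
  qed (use m in auto)
qed

lemma pt2_dist_less:
  assumes "\<bar>x - u\<bar> < e / 2" "\<bar>y - v\<bar> < e / 2"
  shows "dist (pt2 x y) (pt2 u v) < e"
proof -
  have "norm (pt2 x y - pt2 u v) \<le> \<bar>x - u\<bar> + \<bar>y - v\<bar>"
    using norm_le_l1_cart[of "pt2 x y - pt2 u v"] by (simp add: sum_2)
  with assms show ?thesis by (simp add: dist_norm)
qed

text \<open>Finite unions of periodic orbits. They avoid both walls, so that every holonomy map is defined on
  them.\<close>

definition baker_cycles :: "(real^2) set \<Rightarrow> bool" where
  "baker_cycles F \<longleftrightarrow> finite F \<and> F \<subseteq> vsplit_square \<inter> hsplit_square \<and>
     (\<forall>z\<in>vsplit_square. baker z \<in> F \<longleftrightarrow> z \<in> F)"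

lemma baker_cyclesI:
  assumes "finite F" "F \<subseteq> vsplit_square" "baker ` F = F"
  shows "baker_cycles F"
proof -
  have "z \<in> F" if "z \<in> vsplit_square" "baker z \<in> F" for z
  proof -
    from that(2) assms(3) obtain w where "w \<in> F" "baker z = baker w" by blast
    then show ?thesis using unbaker_baker that(1) assms(2) by (metis subsetD)
  qed
  moreover have "F \<subseteq> hsplit_square"
    using assms(2) baker_in by (subst assms(3)[symmetric]) auto
  moreover have "baker z \<in> F" if "z \<in> F" for z
    using that assms(3) by blast
  ultimately show ?thesis using assms(1,2) unfolding baker_cycles_def by blast
qed

lemma baker_cycles_of_periodic:
  assumes "(z, z) \<in> baker_rel ^^ n" "0 < n"
  obtains F where "baker_cycles F" "z \<in> F"
proof -
  obtain f where f: "f 0 = z" "f n = z" "\<And>i. i < n \<Longrightarrow> (f i, f (Suc i)) \<in> baker_rel"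
    using assms(1) unfolding relpow_fun_conv by auto
  have step: "f i \<in> vsplit_square" "baker (f i) = f (Suc i)" if "i < n" for i
    using f(3)[OF that] by (auto simp: baker_rel_def)
  have "baker ` (f ` {..<n}) = f ` {..<n}"
  proof (intro equalityI subsetI)
    fix w assume "w \<in> baker ` (f ` {..<n})"
    then obtain i where i: "i < n" "w = f (Suc i)" using step by auto
    show "w \<in> f ` {..<n}"
    proof (cases "Suc i < n")
      case False
      then have "w = f 0" using i f by (metis Suc_lessI)
      then show ?thesis using assms(2) by auto
    qed (use i in auto)
  next
    fix w assume "w \<in> f ` {..<n}"
    then obtain i where i: "i < n" "w = f i" by auto
    show "w \<in> baker ` (f ` {..<n})"
    proof (cases i)
      case 0
      then have "w = baker (f (n - 1))" using i f(1,2) step(2)[of "n - 1"] assms(2) by simp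
      then show ?thesis using assms(2) by auto
    next
      case (Suc j)
      then have "w = baker (f j)" using i step(2)[of j] by simp
      then show ?thesis using i Suc by auto
    qed
  qed
  then have "baker_cycles (f ` {..<n})"
    using step by (intro baker_cyclesI) auto
  then show ?thesis using that[of "f ` {..<n}"] f(1) assms(2) by auto
qed

text \<open>The fixed point of the branch \<open>(x, y) \<mapsto> (2\<^sup>n x - P, (y + Q)/2\<^sup>n)\<close> is
  \<open>(P/(2\<^sup>n - 1), Q/(2\<^sup>n - 1))\<close>. It lies in the open strip on which the branch is defined unless all
  digits are equal; the bound \<open>d\<close> on the distance to the walls of the square excludes that.\<close>

lemma dense_baker_cycles:
  assumes "z \<in> square" "0 < e"
  obtains F w where "baker_cycles F" "w \<in> F" "dist w z < e"
proof -
  define u v where "u = z$1" and "v = z$2"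
  have uv: "0 < u" "u < 1" "0 < v" "v < 1" using assms by (auto simp: square_def u_def v_def)
  \<comment> \<open>Distance to the boundary of the square, so that the digit string is not constant.\<close>
  define d where "d = Min {e / 2, u, 1 - u, v, 1 - v}"
  have "0 < d" using uv assms(2) by (simp add: d_def)
  moreover have "d \<le> e / 2" "d \<le> u" "d \<le> 1 - u" "d \<le> v" "d \<le> 1 - v"
    unfolding d_def by (rule Min_le; simp)+
  ultimately have d: "0 < d" "d \<le> e / 2" "d \<le> u" "d \<le> 1 - u" "d \<le> v" "d \<le> 1 - v" .
  obtain n P Q where n: "0 < n" and br: "branch n P Q"
    and P: "\<And>\<theta>. 0 \<le> \<theta> \<Longrightarrow> \<theta> \<le> 1 \<Longrightarrow> \<bar>(real P + \<theta>) / 2 ^ n - u\<bar> < d"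
    and Q: "\<And>\<theta>. 0 \<le> \<theta> \<Longrightarrow> \<theta> \<le> 1 \<Longrightarrow> \<bar>(real Q + \<theta>) / 2 ^ n - v\<bar> < d"
    using branch_approx[OF uv(1,2) uv(3,4) d(1)] by metis
  define D :: real where "D = 2 ^ n - 1"
  have fixed: "0 < R / D \<and> R / D < 1 \<and> (R + R / D) / 2 ^ n = R / D"
    if "\<And>\<theta>. 0 \<le> \<theta> \<Longrightarrow> \<theta> \<le> 1 \<Longrightarrow> \<bar>(R + \<theta>) / 2 ^ n - w\<bar> < d" "d \<le> w" "d \<le> 1 - w" for R w :: real
  proof -
    have "0 < (R + 0) / 2 ^ n" using that(1)[of 0] that(2) by linarith
    then have "0 < R" by (simp add: zero_less_divide_iff)
    have "(R + 1) / 2 ^ n < 1" using that(1)[of 1] that(3) by linarith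
    then have "R < D" by (simp add: D_def divide_simps)
    have "(R + R / D) * D = R * 2 ^ n"
      using \<open>0 < R\<close> \<open>R < D\<close> by (simp add: algebra_simps) (simp add: D_def algebra_simps)
    then have "(R + R / D) / 2 ^ n = R / D"
      using \<open>0 < R\<close> \<open>R < D\<close> by (simp add: frac_eq_eq)
    with \<open>0 < R\<close> \<open>R < D\<close> show ?thesis by simp
  qed
  note x = fixed[OF P d(3,4)] and y = fixed[OF Q d(5,6)]
  define x where "x = P / D"
  define y where "y = Q / D"
  have x: "0 < x" "x < 1" "(P + x) / 2 ^ n = x" and y: "0 < y" "y < 1" "(Q + y) / 2 ^ n = y"
    using fixed[OF P d(3,4)] fixed[OF Q d(5,6)] by (auto simp: x_def y_def)
  have ex: "2 ^ n * x = P + x" using x(3) by (simp add: divide_simps mult.commute)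
  have "(pt2 x y, pt2 (2 ^ n * x - P) ((y + Q) / 2 ^ n)) \<in> baker_rel ^^ n"
    using x y ex by (intro branchD[OF br]) simp_all
  moreover have "2 ^ n * x - P = x" "(y + Q) / 2 ^ n = y" using ex y(3) by (simp_all add: add.commute)
  ultimately obtain F where F: "baker_cycles F" "pt2 x y \<in> F"
    using baker_cycles_of_periodic[OF _ n] by metis
  have "dist (pt2 x y) (pt2 u v) < e"
  proof (rule pt2_dist_less)
    show "\<bar>x - u\<bar> < e / 2" using P[of x] x d(2) by simp
    show "\<bar>y - v\<bar> < e / 2" using Q[of y] y d(2) by simp
  qed
  with F that show ?thesis by (simp add: u_def v_def pt2_eta)
qed

text \<open>The branch doubles \<open>x\<close> so often that the new first coordinate can be prescribed exactly; the initial
  second coordinate hardly influences the final one.\<close>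

lemma baker_transitive:
  assumes "z \<in> square" "w \<in> square" "0 < e"
  obtains n z' w' where "(z', w') \<in> baker_rel ^^ n" "dist z' z < e" "dist w' w < e"
proof -
  have z: "0 < z$1" "z$1 < 1" "0 < z$2" "z$2 < 1" and w: "0 < w$1" "w$1 < 1" "0 < w$2" "w$2 < 1"
    using assms by (auto simp: square_def)
  have "0 < e / 2" using assms(3) by simp
  from branch_approx[OF z(1,2) w(3,4) this] obtain n P Q where br: "branch n P Q"
    and P: "\<And>\<theta>. 0 \<le> \<theta> \<Longrightarrow> \<theta> \<le> 1 \<Longrightarrow> \<bar>(real P + \<theta>) / 2 ^ n - z$1\<bar> < e / 2"
    and Q: "\<And>\<theta>. 0 \<le> \<theta> \<Longrightarrow> \<theta> \<le> 1 \<Longrightarrow> \<bar>(real Q + \<theta>) / 2 ^ n - w$2\<bar> < e / 2"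
    by metis
  define x where "x = (P + w$1) / 2 ^ n"
  have ex: "2 ^ n * x = P + w$1" by (simp add: x_def)
  show ?thesis
  proof (rule that)
    show "(pt2 x (z$2), pt2 (2 ^ n * x - P) ((z$2 + Q) / 2 ^ n)) \<in> baker_rel ^^ n"
      using z w ex by (intro branchD[OF br]) simp_all
    have "dist (pt2 x (z$2)) (pt2 (z$1) (z$2)) < e"
      using P[of "w$1"] w assms(3) by (intro pt2_dist_less) (simp_all add: x_def)
    then show "dist (pt2 x (z$2)) z < e" by (simp add: pt2_eta)
    have "dist (pt2 (2 ^ n * x - P) ((z$2 + Q) / 2 ^ n)) (pt2 (w$1) (w$2)) < e"
      using Q[of "z$2"] z assms(3) by (intro pt2_dist_less) (simp_all add: ex add.commute)
    then show "dist (pt2 (2 ^ n * x - P) ((z$2 + Q) / 2 ^ n)) w < e" by (simp add: pt2_eta)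
  qed
qed

text \<open>The orbit with code \<open>10\<dots>0\<close> of period \<open>m + 1\<close> consists of the points
  \<open>(2\<^sup>j/D, 2\<^sup>m\<^sup>-\<^sup>j/D)\<close> with \<open>D = 2\<^sup>m\<^sup>+\<^sup>1 - 1\<close>, all of which have the same product of coordinates
  \<open>2\<^sup>m/D\<^sup>2\<close>.\<close>

lemma small_baker_cycles:
  assumes "0 < c"
  obtains F where "baker_cycles F" "F \<noteq> {}" "\<And>z. z \<in> F \<Longrightarrow> z$1 * z$2 < c"
proof -
  obtain n0 where n0: "inverse (2 ^ n0) < c"
    using reals_power_lt_ex[OF assms, of 2] by (auto simp: power_one_over inverse_eq_divide)
  define m where "m = Suc n0"
  define D :: real where "D = 2 ^ Suc m - 1"
  have m1: "(2::real) \<le> 2 ^ m" by (simp add: m_def)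
  have D: "2 ^ m < D" using m1 by (simp add: D_def)
  define f where "f j = pt2 (2 ^ j / D) (2 ^ (m - j) / D)" for j
  have small: "(2::real) ^ j < D" if "j \<le> m" for j
    using power_increasing[OF that, of "2::real"] D by linarith
  have Dpos: "0 < D" using D m1 by linarith
  have sq: "f j \<in> square" if "j \<le> m" for j
    using small[OF that] small[of "m - j"] Dpos by (simp add: f_def square_def)
  \<comment> \<open>Only the last point of the orbit lies in the right half of the square.\<close>
  have left: "2 ^ j / D < 1/2" if "j < m" for j
    using small[of "Suc j"] that Dpos by (simp add: field_simps)
  have right: "2 ^ m / D > 1/2"
    using Dpos by (simp add: field_simps D_def)
  have vs: "f j \<in> vsplit_square" if "j \<le> m" for j
  proof (cases "j = m")
    case True
    then have "f j $ 1 = 2 ^ m / D" by (simp add: f_def)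
    with right have "f j $ 1 \<noteq> 1/2" by linarith
    then show ?thesis using sq[OF that] by (simp add: vsplit_square_def)
  next
    case False
    then have "f j $ 1 < 1/2" using left[of j] that by (simp add: f_def)
    then show ?thesis using sq[OF that] by (simp add: vsplit_square_def)
  qed
  have step: "baker (f j) = f (Suc j)" if "j < m" for j
  proof -
    have e: "m - j = Suc (m - Suc j)" using that by simp
    have "(2::real) ^ (m - j) = 2 * 2 ^ (m - Suc j)" unfolding e by simp
    then show ?thesis using left[OF that] by (simp add: baker_def f_def)
  qed
  have last: "baker (f m) = f 0"
  proof -
    have "2 * (2 ^ m / D) - 1 = 1 / D" using Dpos by (simp add: field_simps) (simp add: D_def)
    moreover have "(1 / D + 1) / 2 = 2 ^ m / D" using Dpos by (simp add: field_simps) (simp add: D_def algebra_simps)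
    ultimately show ?thesis using right by (simp add: baker_def f_def)
  qed
  have "baker ` (f ` {..m}) = f ` {..m}"
  proof (intro equalityI subsetI)
    fix w assume "w \<in> baker ` (f ` {..m})"
    then obtain j where j: "j \<le> m" "w = baker (f j)" by auto
    show "w \<in> f ` {..m}"
    proof (cases "j = m")
      case True
      then show ?thesis using j last by auto
    next
      case False
      then show ?thesis using j step[of j] by (intro image_eqI[of _ _ "Suc j"]) auto
    qed
  next
    fix w assume "w \<in> f ` {..m}"
    then obtain j where j: "j \<le> m" "w = f j" by auto
    show "w \<in> baker ` (f ` {..m})"
    proof (cases j)
      case 0
      then have "w = baker (f m)" using j last by simp
      then show ?thesis by (intro image_eqI[of _ baker "f m"]) auto
    next
      case (Suc i)
      then show ?thesis using j step[of i] by (auto intro!: image_eqI[of _ baker "f i"])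
    qed
  qed
  then have cyc: "baker_cycles (f ` {..m})" using vs by (intro baker_cyclesI) auto
  have "f j $ 1 * f j $ 2 < c" if "j \<le> m" for j
  proof -
    have "f j $ 1 * f j $ 2 = 2 ^ j * 2 ^ (m - j) / (D * D)" by (simp add: f_def)
    also have "(2::real) ^ j * 2 ^ (m - j) = 2 ^ m" using that by (simp flip: power_add)
    also have "2 ^ m / (D * D) < D / (D * D)" using D Dpos by (intro divide_strict_right_mono) auto
    also have "\<dots> = inverse D" using Dpos by (simp add: field_simps)
    also have "\<dots> < inverse (2 ^ m)" using D m1 by (intro less_imp_inverse_less) auto
    also have "\<dots> \<le> inverse (2 ^ n0)" by (simp add: m_def field_simps)
    finally show ?thesis using n0 by simp
  qed
  then show ?thesis using that[OF cyc] by auto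
qed

section \<open>The circle as a union of four semicircles\<close>

text \<open>The open semicircle centred at \<open>\<i>\<^sup>k\<close>, with the tangent of the angle to \<open>\<i>\<^sup>k\<close> as coordinate.\<close>

definition semicircle :: "nat \<Rightarrow> complex set" where
  "semicircle k = {w. norm w = 1 \<and> 0 < Re (w * cnj (\<i> ^ k))}"

definition slope :: "nat \<Rightarrow> complex \<Rightarrow> real" where
  "slope k w = Im (w * cnj (\<i> ^ k)) / Re (w * cnj (\<i> ^ k))"

text \<open>The inverse of \<open>slope k\<close>.\<close>

definition arc_point :: "nat \<Rightarrow> real \<Rightarrow> complex" where
  "arc_point k x = \<i> ^ k * (Complex 1 x / of_real (sqrt (1 + x\<^sup>2)))"

text \<open>The part of the coordinate line of semicircle \<open>k\<close> that lies on semicircle \<open>k'\<close>. With four semicircles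
  every overlap is connected, which a foliated atlas of the suspension requires: on an overlap with
  two components, one of them across \<open>w = 1\<close>, the transverse coordinate would change in two ways.\<close>

definition ray :: "nat \<Rightarrow> nat \<Rightarrow> real set" where
  "ray k k' = (if k' = k then UNIV else if k' = Suc k mod 4 then {0<..}
     else if k = Suc k' mod 4 then {..<0} else {})"

definition slope_change :: "nat \<Rightarrow> nat \<Rightarrow> real \<Rightarrow> real" where
  "slope_change k k' x = (if k' = k then x else - inverse x)"

lemma i_power_cnj: "\<i> ^ k * cnj (\<i> ^ k) = 1"
  using complex_norm_square[of "\<i> ^ k"] by (simp add: norm_power del: complex_cnj_power)

lemma rotated_arc_point: "arc_point k x * cnj (\<i> ^ k) = Complex 1 x / of_real (sqrt (1 + x\<^sup>2))"
proof -
  have "\<i> ^ k * q * cnj (\<i> ^ k) = \<i> ^ k * cnj (\<i> ^ k) * q" for q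
    by (simp only: mult.commute mult.left_commute)
  then show ?thesis unfolding arc_point_def i_power_cnj by simp
qed

lemma norm_arc_point: "norm (arc_point k x) = 1"
proof -
  have "0 < 1 + x\<^sup>2" by (simp add: add_pos_nonneg)
  then show ?thesis by (simp add: arc_point_def norm_mult norm_power norm_divide complex_norm)
qed

lemma sqrt_pos: "0 < sqrt (1 + x\<^sup>2)"
  by (simp add: add_pos_nonneg)

lemma Re_Im_normalized: "Re (Complex 1 x / of_real (sqrt (1 + x\<^sup>2))) = 1 / sqrt (1 + x\<^sup>2)"
    "Im (Complex 1 x / of_real (sqrt (1 + x\<^sup>2))) = x / sqrt (1 + x\<^sup>2)"
  by (simp_all add: Re_divide_of_real Im_divide_of_real)

lemma arc_point_in: "arc_point k x \<in> semicircle k"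
  unfolding semicircle_def mem_Collect_eq rotated_arc_point Re_Im_normalized
  using norm_arc_point sqrt_pos[of x] by simp

lemma slope_arc_point: "slope k (arc_point k x) = x"
  unfolding slope_def rotated_arc_point Re_Im_normalized using sqrt_pos[of x] by simp

lemma arc_point_slope:
  assumes "w \<in> semicircle k" shows "arc_point k (slope k w) = w"
proof -
  define u where "u = w * cnj (\<i> ^ k)"
  have w: "\<i> ^ k * u = w"
  proof -
    have "\<i> ^ k * u = \<i> ^ k * cnj (\<i> ^ k) * w"
      unfolding u_def by (simp only: mult.commute mult.left_commute)
    then show ?thesis unfolding i_power_cnj by simp
  qed
  have r: "0 < Re u" using assms by (simp add: semicircle_def u_def)
  have "norm u = 1" using assms by (simp add: semicircle_def u_def norm_mult norm_power)
  then have n: "(Re u)\<^sup>2 + (Im u)\<^sup>2 = 1" by (simp add: cmod_def)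
  have sl: "slope k w = Im u / Re u" by (simp only: slope_def u_def)
  have "1 + (slope k w)\<^sup>2 = ((Re u)\<^sup>2 + (Im u)\<^sup>2) / (Re u)\<^sup>2"
    unfolding sl using r by (simp add: power_divide add_divide_distrib)
  then have "1 + (slope k w)\<^sup>2 = (1 / Re u)\<^sup>2" using n by (simp add: power_divide)
  then have "sqrt (1 + (slope k w)\<^sup>2) = 1 / Re u" using r by simp
  then have "Complex 1 (slope k w) / of_real (sqrt (1 + (slope k w)\<^sup>2)) = u"
    using r by (simp add: complex_eq_iff Re_divide_of_real Im_divide_of_real) (simp add: sl)
  then show ?thesis unfolding arc_point_def using w by simp
qed

lemma less_4_cases: "(k::nat) < 4 \<longleftrightarrow> k = 0 \<or> k = 1 \<or> k = 2 \<or> k = 3"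
  by auto

lemma i_cube: "\<i> ^ 3 = - \<i>"
  by (simp add: power3_eq_cube)

lemma Re_Im_arc_point:
  "Re (arc_point 0 x) = 1 / sqrt (1 + x\<^sup>2)" "Im (arc_point 0 x) = x / sqrt (1 + x\<^sup>2)"
  "Re (arc_point (Suc 0) x) = - x / sqrt (1 + x\<^sup>2)" "Im (arc_point (Suc 0) x) = 1 / sqrt (1 + x\<^sup>2)"
  "Re (arc_point 2 x) = - 1 / sqrt (1 + x\<^sup>2)" "Im (arc_point 2 x) = - x / sqrt (1 + x\<^sup>2)"
  "Re (arc_point 3 x) = x / sqrt (1 + x\<^sup>2)" "Im (arc_point 3 x) = - 1 / sqrt (1 + x\<^sup>2)"
  by (simp_all add: arc_point_def Re_Im_normalized i_cube)

lemma arc_cases: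
  "w \<in> semicircle 0 \<longleftrightarrow> norm w = 1 \<and> 0 < Re w"
  "w \<in> semicircle (Suc 0) \<longleftrightarrow> norm w = 1 \<and> 0 < Im w"
  "w \<in> semicircle 2 \<longleftrightarrow> norm w = 1 \<and> Re w < 0"
  "w \<in> semicircle 3 \<longleftrightarrow> norm w = 1 \<and> Im w < 0"
  by (simp_all add: semicircle_def i_cube)

lemma slope_cases:
  "slope 0 w = Im w / Re w" "slope (Suc 0) w = - Re w / Im w"
  "slope 2 w = Im w / Re w" "slope 3 w = - Re w / Im w"
  by (simp_all add: slope_def i_cube)

lemma arc_overlap:
  assumes "k < 4" "k' < 4"
  shows "arc_point k x \<in> semicircle k' \<longleftrightarrow> x \<in> ray k k'"
  using assms sqrt_pos[of x] norm_arc_point[of k x] unfolding less_4_cases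
  by (elim disjE) (simp_all add: arc_cases Re_Im_arc_point ray_def zero_less_divide_iff divide_less_0_iff)

lemma slope_overlap:
  assumes "k < 4" "k' < 4" "x \<in> ray k k'"
  shows "slope k' (arc_point k x) = slope_change k k' x"
  using assms sqrt_pos[of x] unfolding less_4_cases
  by (elim disjE) (simp_all add: slope_cases Re_Im_arc_point ray_def slope_change_def inverse_eq_divide)

text \<open>This supplies the compact pieces of plaques by which compact leaves are covered.\<close>

lemma quarter_cover:
  assumes "norm w = 1"
  obtains k where "k < 4" "w \<in> semicircle k" "\<bar>slope k w\<bar> \<le> 1"
proof -
  have nz: "(Re w)\<^sup>2 + (Im w)\<^sup>2 = 1" using assms by (simp add: cmod_def)
  have quot: "\<bar>a / b\<bar> \<le> 1" if "\<bar>a\<bar> \<le> \<bar>b\<bar>" for a b :: real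
    using that by (simp add: divide_simps)
  consider "\<bar>Im w\<bar> \<le> \<bar>Re w\<bar>" "0 < Re w" | "\<bar>Im w\<bar> \<le> \<bar>Re w\<bar>" "Re w < 0"
    | "\<bar>Re w\<bar> \<le> \<bar>Im w\<bar>" "0 < Im w" | "\<bar>Re w\<bar> \<le> \<bar>Im w\<bar>" "Im w < 0"
  proof -
    have "Re w \<noteq> 0 \<or> Im w \<noteq> 0" using nz by auto
    then show ?thesis using that by linarith
  qed
  then show ?thesis
  proof cases
    case 1
    then show ?thesis using quot[of "Im w" "Re w"] assms by (intro that[of 0]) (simp_all add: arc_cases slope_cases)
  next
    case 2
    then show ?thesis using quot[of "Im w" "Re w"] assms by (intro that[of 2]) (simp_all add: arc_cases slope_cases)
  next
    case 3
    then show ?thesis using quot[of "- Re w" "Im w"] assms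
      by (intro that[of "Suc 0"]) (simp_all add: arc_cases slope_cases)
  next
    case 4
    then show ?thesis using quot[of "- Re w" "Im w"] assms by (intro that[of 3]) (simp_all add: arc_cases slope_cases)
  qed
qed

lemma continuous_on_arc_point: "continuous_on S (arc_point k)"
proof -
  have eq: "arc_point k = (\<lambda>x. \<i> ^ k * ((1 + \<i> * of_real x) / of_real (sqrt (1 + x\<^sup>2))))"
    by (simp add: fun_eq_iff arc_point_def complex_eq_iff)
  show ?thesis unfolding eq
    using sqrt_pos by (intro continuous_intros) (metis less_irrefl of_real_eq_0_iff)
qed

section \<open>The suspension of the baker map times a circle\<close>

text \<open>Semicircle \<open>0\<close> contains the point \<open>w = 1\<close>, where \<open>z\<close> must avoid the first wall.\<close>

definition transversal_of :: "nat \<Rightarrow> (real^2) set" where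
  "transversal_of k = (if k = 0 then vsplit_square else square)"

text \<open>A point of the manifold carries the square coordinate that is valid just after the last crossing of
  \<open>w = 1\<close>, and just before the crossing if \<open>w = 1\<close>. The chart over semicircle \<open>0\<close> continues the coordinate valid before the
  crossing, so it differs from the one carried by the point where \<open>Im w > 0\<close>.\<close>

definition stored :: "nat \<Rightarrow> complex \<Rightarrow> real^2 \<Rightarrow> real^2" where
  "stored k w z = (if k = 0 \<and> 0 < Im w then baker z else z)"

definition retrieved :: "nat \<Rightarrow> complex \<Rightarrow> real^2 \<Rightarrow> real^2" where
  "retrieved k w z = (if k = 0 \<and> 0 < Im w then unbaker z else z)"

definition stored_range :: "nat \<Rightarrow> complex \<Rightarrow> (real^2) set" where
  "stored_range k w = (if k = 0 then if 0 < Im w then hsplit_square else vsplit_square else square)"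

text \<open>The transverse coordinates of chart \<open>k\<close> that survive in chart \<open>k'\<close>; \<open>passage\<close> is the map between
  the coordinates. The baker map acts between the charts \<open>0\<close> and \<open>1\<close>, after the crossing of \<open>w = 1\<close>;
  between \<open>3\<close> and \<open>0\<close> only the first wall is removed.\<close>

definition gate :: "nat \<Rightarrow> nat \<Rightarrow> (real^2) set" where
  "gate k k' = (if k = 1 \<and> k' = 0 then hsplit_square
     else if k = 0 \<or> k' = 0 then vsplit_square else square)"

definition passage :: "nat \<Rightarrow> nat \<Rightarrow> real^2 \<Rightarrow> real^2" where
  "passage k k' z = (if k = 0 \<and> k' = 1 then baker z else if k = 1 \<and> k' = 0 then unbaker z else z)"

lemma split_squares_subset: "vsplit_square \<subseteq> square" "hsplit_square \<subseteq> square"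
  by (auto simp: square_defs)

lemma stored_in: "z \<in> transversal_of k \<Longrightarrow> stored k w z \<in> stored_range k w"
  using baker_in by (auto simp: transversal_of_def stored_def stored_range_def)

lemma retrieved_in: "s \<in> stored_range k w \<Longrightarrow> retrieved k w s \<in> transversal_of k"
  using unbaker_in by (auto simp: transversal_of_def retrieved_def stored_range_def)

lemma retrieved_stored: "z \<in> transversal_of k \<Longrightarrow> retrieved k w (stored k w z) = z"
  using unbaker_baker by (auto simp: transversal_of_def stored_def retrieved_def)

lemma stored_retrieved: "s \<in> stored_range k w \<Longrightarrow> stored k w (retrieved k w s) = s"
  using baker_unbaker by (auto simp: stored_range_def stored_def retrieved_def)

lemma gate_subset: "gate k k' \<subseteq> transversal_of k"
  using split_squares_subset by (auto simp: gate_def transversal_of_def)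

lemma gate_iff:
  assumes "k < 4" "k' < 4" "x \<in> ray k k'" "z \<in> transversal_of k"
  shows "stored k (arc_point k x) z \<in> stored_range k' (arc_point k x) \<longleftrightarrow> z \<in> gate k k'"
  using assms sqrt_pos[of x] baker_in[of z] split_squares_subset unfolding less_4_cases
  by (elim disjE) (auto simp: stored_def stored_range_def gate_def ray_def transversal_of_def
      Re_Im_arc_point zero_less_divide_iff)

lemma passage_eq:
  assumes "k < 4" "k' < 4" "x \<in> ray k k'" "z \<in> gate k k'"
  shows "retrieved k' (arc_point k x) (stored k (arc_point k x) z) = passage k k' z"
  using assms sqrt_pos[of x] unbaker_baker[of z] unfolding less_4_cases
  by (elim disjE) (auto simp: stored_def retrieved_def gate_def passage_def ray_def
      Re_Im_arc_point zero_less_divide_iff)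

lemma open_gate: "open (gate k k')"
  by (simp add: gate_def open_square open_vsplit_square open_hsplit_square)

lemma locally_affine_on_passage: "locally_affine_on (gate k k') (passage k k')"
proof -
  consider "k = 0 \<and> k' = 1" | "k = 1 \<and> k' = 0" | "\<not> (k = 0 \<and> k' = 1)" "\<not> (k = 1 \<and> k' = 0)" by blast
  then show ?thesis
  proof cases
    case 1
    then show ?thesis
      by (intro locally_affine_on_cong[OF locally_affine_on_baker]) (auto simp: gate_def passage_def)
  next
    case 2
    then show ?thesis
      by (intro locally_affine_on_cong[OF locally_affine_on_unbaker]) (auto simp: gate_def passage_def)
  next
    case 3
    then show ?thesis
      by (intro locally_affine_on_cong[OF locally_affine_on_id subset_refl]) (auto simp: passage_def)
  qed
qed

lemma smooth_on_slope_term: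
  assumes l: "linear l" and S: "open S" "\<And>p. p \<in> S \<Longrightarrow> l p \<in> ray k k'"
  shows "smooth_on S (\<lambda>p. slope_change k k' (l p) *\<^sub>R w)"
proof (cases "k' = k")
  case True
  have "linear (\<lambda>p. l p *\<^sub>R w)"
    using l by (intro linearI) (simp_all add: linear_add linear_scale scaleR_left_distrib)
  from Ck_on_affine[OF this, where b = 0] show ?thesis
    using True by (simp add: smooth_on_def slope_change_def)
next
  case False
  then have "l p \<noteq> 0" if "p \<in> S" for p
    using S(2)[OF that] by (auto simp: ray_def split: if_splits)
  from Ck_on_inverse_power[OF l this S(1), where n = 1 and w = "- w"] show ?thesis
    using False by (simp add: smooth_on_def slope_change_def)
qed

definition overlap :: "nat \<Rightarrow> nat \<Rightarrow> nat \<Rightarrow> nat \<Rightarrow> ((real^2) \<times> (real^2)) set" where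
  "overlap k k' l l' = {(x, z). x$1 \<in> ray k k' \<and> x$2 \<in> ray l l' \<and> z \<in> gate k k'}"

definition coordinate_change ::
  "nat \<Rightarrow> nat \<Rightarrow> nat \<Rightarrow> nat \<Rightarrow> (real^2) \<times> (real^2) \<Rightarrow> (real^2) \<times> (real^2)" where
  "coordinate_change k k' l l' p =
     (pt2 (slope_change k k' (fst p $ 1)) (slope_change l l' (fst p $ 2)), passage k k' (snd p))"

lemma open_ray: "open (ray k k')"
  by (simp add: ray_def)

lemma linear_coordinates:
  "linear (\<lambda>p. fst p $ i :: real)" "linear (\<lambda>z. (0 :: real^2, z :: real^2))"
  "linear (snd :: (real^2) \<times> (real^2) \<Rightarrow> real^2)" for i :: 2
  by (rule linearI; simp)+

lemma open_overlap_set: "open (overlap k k' l l')"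
proof -
  have "overlap k k' l l' = (\<lambda>p. fst p $ 1) -` ray k k' \<inter> (\<lambda>p. fst p $ 2) -` ray l l' \<inter> snd -` gate k k'"
    by (auto simp: overlap_def)
  then show ?thesis
    by (simp only:) (intro open_Int open_vimage open_ray open_gate continuous_intros)
qed

text \<open>The coordinate change is a sum of two terms \<open>x \<mapsto> -1/x\<close> or \<open>x \<mapsto> x\<close> along fixed vectors and a
  locally affine term.\<close>

lemma smooth_on_coordinate_change: "smooth_on (overlap k k' l l') (coordinate_change k k' l l')"
proof (rule smooth_on_cong[OF open_overlap_set])
  let ?O = "overlap k k' l l'"
  have "smooth_on (snd -` gate k k' :: ((real^2) \<times> (real^2)) set) (\<lambda>p. passage k k' (snd p))"
    by (intro smooth_on_compose_linear open_gate linear_coordinates smooth_on_locally_affine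
        locally_affine_on_passage)
  then have "smooth_on ?O (\<lambda>p. passage k k' (snd p))"
    by (rule smooth_on_subset) (auto simp: overlap_def)
  then have "smooth_on ?O (\<lambda>p. (0 :: real^2, passage k k' (snd p)))"
    by (rule smooth_on_linear_compose[OF open_overlap_set linear_coordinates(2)])
  moreover have "smooth_on ?O (\<lambda>p. slope_change k k' (fst p $ 1) *\<^sub>R (pt2 1 0, 0 :: real^2))"
    by (rule smooth_on_slope_term[OF linear_coordinates(1) open_overlap_set]) (auto simp: overlap_def)
  moreover have "smooth_on ?O (\<lambda>p. slope_change l l' (fst p $ 2) *\<^sub>R (pt2 0 1, 0 :: real^2))"
    by (rule smooth_on_slope_term[OF linear_coordinates(1) open_overlap_set]) (auto simp: overlap_def)
  ultimately show "smooth_on ?O (\<lambda>p. slope_change k k' (fst p $ 1) *\<^sub>R (pt2 1 0, 0) +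
      slope_change l l' (fst p $ 2) *\<^sub>R (pt2 0 1, 0) + (0, passage k k' (snd p)))"
    by (intro smooth_on_add open_overlap_set)
  show "coordinate_change k k' l l' p = slope_change k k' (fst p $ 1) *\<^sub>R (pt2 1 0, 0) +
      slope_change l l' (fst p $ 2) *\<^sub>R (pt2 0 1, 0) + (0, passage k k' (snd p))" for p
    by (simp add: coordinate_change_def prod_eq_iff vec_eq_iff forall_2)
qed

definition pack :: "complex \<Rightarrow> complex \<Rightarrow> real^2 \<Rightarrow> point4" where
  "pack w v z = (\<lambda>n. if n < 6 then [Re w, Im w, Re v, Im v, z$1, z$2] ! n else 0)"

definition first_circle :: "point4 \<Rightarrow> complex" where "first_circle p = Complex (p 0) (p 1)"
definition second_circle :: "point4 \<Rightarrow> complex" where "second_circle p = Complex (p 2) (p 3)"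
definition square_part :: "point4 \<Rightarrow> real^2" where "square_part p = pt2 (p 4) (p 5)"

lemma unpack: "first_circle (pack w v z) = w" "second_circle (pack w v z) = v" "square_part (pack w v z) = z"
  by (simp_all add: first_circle_def second_circle_def square_part_def pack_def pt2_eta)

text \<open>Index \<open>i < 16\<close> stands for the pair of semicircles \<open>i mod 4\<close> for \<open>w\<close> and \<open>i div 4\<close> for \<open>v\<close>.\<close>

definition patch :: "nat \<Rightarrow> point4 set" where
  "patch i = {pack w v s | w v s. w \<in> semicircle (i mod 4) \<and> v \<in> semicircle (i div 4) \<and> s \<in> stored_range (i mod 4) w}"

definition patch_chart :: "nat \<Rightarrow> point4 \<Rightarrow> (real^2) \<times> (real^2)" where
  "patch_chart i p = (pt2 (slope (i mod 4) (first_circle p)) (slope (i div 4) (second_circle p)),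
     retrieved (i mod 4) (first_circle p) (square_part p))"

definition patch_point :: "nat \<Rightarrow> (real^2) \<times> (real^2) \<Rightarrow> point4" where
  "patch_point i e = (let w = arc_point (i mod 4) (fst e $ 1) in
     pack w (arc_point (i div 4) (fst e $ 2)) (stored (i mod 4) w (snd e)))"

lemma pack_in_patch: "pack w v s \<in> patch i \<longleftrightarrow>
    w \<in> semicircle (i mod 4) \<and> v \<in> semicircle (i div 4) \<and> s \<in> stored_range (i mod 4) w"
  unfolding patch_def using unpack by (auto, metis+)

lemma patch_point_overlap:
  assumes "i < 16" "j < 16" "snd e \<in> transversal_of (i mod 4)"
  shows "patch_point i e \<in> patch j \<longleftrightarrow> e \<in> overlap (i mod 4) (j mod 4) (i div 4) (j div 4)"
proof -
  have b: "i mod 4 < 4" "j mod 4 < 4" "i div 4 < 4" "j div 4 < 4" using assms by auto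
  show ?thesis
    unfolding patch_point_def Let_def pack_in_patch overlap_def
    using arc_overlap[OF b(1,2), of "fst e $ 1"] arc_overlap[OF b(3,4), of "fst e $ 2"]
      gate_iff[OF b(1,2) _ assms(3)] by (auto simp: case_prod_beta)
qed

lemma overlap_set_eq:
  assumes "i < 16" "j < 16"
  shows "{e \<in> UNIV \<times> transversal_of (i mod 4). patch_point i e \<in> patch j} =
    overlap (i mod 4) (j mod 4) (i div 4) (j div 4)"
  using patch_point_overlap[OF assms] gate_subset[of "i mod 4" "j mod 4"]
  by (auto simp: overlap_def mem_Times_iff)

lemma patch_chart_patch_point:
  assumes "i < 16" "j < 16" "e \<in> overlap (i mod 4) (j mod 4) (i div 4) (j div 4)"
  shows "patch_chart j (patch_point i e) = coordinate_change (i mod 4) (j mod 4) (i div 4) (j div 4) e"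
proof -
  have b: "i mod 4 < 4" "j mod 4 < 4" "i div 4 < 4" "j div 4 < 4" using assms by auto
  have e: "fst e $ 1 \<in> ray (i mod 4) (j mod 4)" "fst e $ 2 \<in> ray (i div 4) (j div 4)"
    "snd e \<in> gate (i mod 4) (j mod 4)"
    using assms(3) by (auto simp: overlap_def)
  show ?thesis
    unfolding patch_chart_def patch_point_def Let_def unpack coordinate_change_def
    using slope_overlap[OF b(1,2) e(1)] slope_overlap[OF b(3,4) e(2)] passage_eq[OF b(1,2) e(1,3)]
    by simp
qed

lemma patch_point_patch_chart:
  assumes "p \<in> patch i"
  shows "patch_chart i p \<in> UNIV \<times> transversal_of (i mod 4)" "patch_point i (patch_chart i p) = p"
proof -
  obtain w v s where p: "p = pack w v s" and w: "w \<in> semicircle (i mod 4)" "v \<in> semicircle (i div 4)"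
    "s \<in> stored_range (i mod 4) w" using assms unfolding patch_def by (elim CollectE exE conjE)
  show "patch_chart i p \<in> UNIV \<times> transversal_of (i mod 4)" "patch_point i (patch_chart i p) = p"
    unfolding p patch_chart_def patch_point_def Let_def unpack
    using arc_point_slope[OF w(1)] arc_point_slope[OF w(2)] retrieved_in[OF w(3)] stored_retrieved[OF w(3)]
    by simp_all
qed

lemma patch_chart_overlap:
  assumes "i < 16" "j < 16" "p \<in> patch i" "p \<in> patch j"
  shows "patch_chart i p \<in> overlap (i mod 4) (j mod 4) (i div 4) (j div 4)"
    "patch_chart j p = coordinate_change (i mod 4) (j mod 4) (i div 4) (j div 4) (patch_chart i p)"
proof -
  note c = patch_point_patch_chart[OF assms(3)]
  have "snd (patch_chart i p) \<in> transversal_of (i mod 4)" using c(1) by auto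
  then show o: "patch_chart i p \<in> overlap (i mod 4) (j mod 4) (i div 4) (j div 4)"
    using patch_point_overlap[OF assms(1,2), of "patch_chart i p"] c(2) assms(4) by simp
  show "patch_chart j p = coordinate_change (i mod 4) (j mod 4) (i div 4) (j div 4) (patch_chart i p)"
    using patch_chart_patch_point[OF assms(1,2) o] c(2) by simp
qed

interpretation M: smooth_gluing "{..<16::nat}" patch "\<lambda>i. transversal_of (i mod 4)" patch_chart patch_point
  "\<lambda>i j. passage (j mod 4) (i mod 4)"
proof unfold_locales
  fix i j :: nat and e p assume i: "i \<in> {..<16}"
  show "patch_chart i p \<in> UNIV \<times> transversal_of (i mod 4) \<and> patch_point i (patch_chart i p) = p" if "p \<in> patch i"
    using patch_point_patch_chart[OF that] by simp
  show "patch_point i e \<in> patch i \<and> patch_chart i (patch_point i e) = e" if "e \<in> UNIV \<times> transversal_of (i mod 4)"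
  proof -
    have z: "snd e \<in> transversal_of (i mod 4)" using that by auto
    show ?thesis
      unfolding patch_chart_def patch_point_def Let_def unpack pack_in_patch slope_arc_point retrieved_stored[OF z]
      using arc_point_in stored_in[OF z] by (simp add: pt2_eta)
  qed
  assume j: "j \<in> {..<16}"
  have ij: "i < 16" "j < 16" using i j by auto
  show "open {e \<in> UNIV \<times> transversal_of (i mod 4). patch_point i e \<in> patch j}"
    unfolding overlap_set_eq[OF ij] by (rule open_overlap_set)
  show smooth: "smooth_on {e \<in> UNIV \<times> transversal_of (i mod 4). patch_point i e \<in> patch j} (\<lambda>e. patch_chart j (patch_point i e))"
    unfolding overlap_set_eq[OF ij]
    by (rule smooth_on_cong[OF open_overlap_set smooth_on_coordinate_change patch_chart_patch_point[OF ij]])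
  then have "Ck_on 0 {e \<in> UNIV \<times> transversal_of (i mod 4). patch_point i e \<in> patch j} (\<lambda>e. patch_chart j (patch_point i e))"
    unfolding smooth_on_def by (rule spec)
  then show "continuous_on {e \<in> UNIV \<times> transversal_of (i mod 4). patch_point i e \<in> patch j} (\<lambda>e. patch_chart j (patch_point i e))"
    by simp
  show "snd (patch_chart i p) = passage (j mod 4) (i mod 4) (snd (patch_chart j p))" if "p \<in> patch i" "p \<in> patch j"
    using patch_chart_overlap(2)[OF ij(2,1) that(2,1)] by (simp add: coordinate_change_def)
  show "locally_affine_on (transition_dom patch patch_chart i j) (passage (j mod 4) (i mod 4))"
  proof (rule locally_affine_on_cong[OF locally_affine_on_passage _ refl])
    show "transition_dom patch patch_chart i j \<subseteq> gate (j mod 4) (i mod 4)"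
    proof
      fix z assume "z \<in> transition_dom patch patch_chart i j"
      then obtain p where p: "p \<in> patch i" "p \<in> patch j" "z = snd (patch_chart j p)"
        by (auto simp: transition_dom_def)
      from patch_chart_overlap(1)[OF ij(2,1) p(2,1)] show "z \<in> gate (j mod 4) (i mod 4)"
        unfolding p(3) by (auto simp: overlap_def)
    qed
  qed
qed simp

abbreviation M4 :: "point4 topology" where "M4 \<equiv> M.glued"

lemma norm_semicircle: "w \<in> semicircle k \<Longrightarrow> norm w = 1"
  by (simp add: semicircle_def)

lemma interior_semicircle:
  assumes "norm w = 1" "w \<noteq> 1"
  obtains k where "k < 4" "k \<noteq> 0" "w \<in> semicircle k"
proof -
  have n: "(Re w)\<^sup>2 + (Im w)\<^sup>2 = 1" using assms(1) by (simp add: cmod_def)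
  consider "0 < Im w" | "Im w < 0" | "Im w = 0" by linarith
  then show ?thesis
  proof cases
    case 1
    then show ?thesis using assms by (intro that[of "Suc 0"]) (simp_all add: arc_cases)
  next
    case 2
    then show ?thesis using assms by (intro that[of 3]) (simp_all add: arc_cases)
  next
    case 3
    then have "(Re w)\<^sup>2 = 1" using n by simp
    then have "Re w = 1 \<or> Re w = -1" by (simp add: power2_eq_1_iff)
    then have "Re w < 0" using assms(2) 3 by (auto simp: complex_eq_iff)
    then show ?thesis using assms by (intro that[of 2]) (simp_all add: arc_cases)
  qed
qed

text \<open>The square over a fixed position \<open>(w, v)\<close> lies in one chart. For \<open>w \<noteq> 1\<close> one of the charts
  over the semicircles \<open>1\<close>, \<open>2\<close>, \<open>3\<close> has no walls; for \<open>w = 1\<close> the wall is missing from the manifold as well.\<close>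

lemma common_chart:
  assumes "norm w = 1" "norm v = 1"
  obtains i where "i < 16"
    "\<And>s. s \<in> square \<Longrightarrow> (w = 1 \<longrightarrow> s \<in> vsplit_square) \<Longrightarrow> pack w v s \<in> patch i"
proof -
  obtain l where l: "l < 4" "v \<in> semicircle l" using quarter_cover[OF assms(2)] .
  have "\<exists>k<4. w \<in> semicircle k \<and> (\<forall>s\<in>square. (w = 1 \<longrightarrow> s \<in> vsplit_square) \<longrightarrow> s \<in> stored_range k w)"
  proof (cases "w = 1")
    case True
    then show ?thesis by (intro exI[of _ 0]) (simp add: arc_cases stored_range_def)
  next
    case False
    then obtain k where "k < 4" "k \<noteq> 0" "w \<in> semicircle k"
      using interior_semicircle[OF assms(1)] by metis
    then show ?thesis by (intro exI[of _ k]) (simp add: stored_range_def)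
  qed
  then obtain k where k: "k < 4" "w \<in> semicircle k"
    "\<forall>s\<in>square. (w = 1 \<longrightarrow> s \<in> vsplit_square) \<longrightarrow> s \<in> stored_range k w" by (elim exE conjE)
  show ?thesis
  proof (rule that[of "k + 4 * l"])
    show "k + 4 * l < 16" using k l by auto
    have "(k + 4 * l) mod 4 = k" "(k + 4 * l) div 4 = l" using k l by auto
    then show "pack w v s \<in> patch (k + 4 * l)" if "s \<in> square" "w = 1 \<longrightarrow> s \<in> vsplit_square" for s
      using k l that by (simp add: pack_in_patch)
  qed
qed

lemma topspace_M4:
  "topspace M4 = {pack w v s | w v s. norm w = 1 \<and> norm v = 1 \<and> s \<in> square \<and> (w = 1 \<longrightarrow> s \<in> vsplit_square)}"
  (is "_ = ?M")
proof (intro equalityI subsetI)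
  fix p assume "p \<in> topspace M4"
  then obtain i where "p \<in> patch i" unfolding M.topspace_glued by auto
  then obtain w v s where p: "p = pack w v s" "w \<in> semicircle (i mod 4)" "v \<in> semicircle (i div 4)"
    "s \<in> stored_range (i mod 4) w"
    unfolding patch_def by (elim CollectE exE conjE)
  have "s \<in> square" using p(4) split_squares_subset by (auto simp: stored_range_def split: if_splits)
  moreover have "s \<in> vsplit_square" if "w = 1"
  proof -
    have "i mod 4 < 4" by simp
    then have "i mod 4 = 0"
      using p(2) that unfolding less_4_cases by (elim disjE) (simp_all add: arc_cases)
    then show ?thesis using p(4) that by (simp add: stored_range_def)
  qed
  ultimately show "p \<in> ?M" using p norm_semicircle by blast
next
  fix p assume "p \<in> ?M"
  then obtain w v s where p: "p = pack w v s" "norm w = 1" "norm v = 1" "s \<in> square"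
    "w = 1 \<longrightarrow> s \<in> vsplit_square" by (elim CollectE exE conjE)
  obtain i where "i < 16" "pack w v s \<in> patch i"
    using common_chart[OF p(2,3)] p(4,5) by metis
  then show "p \<in> topspace M4" unfolding M.topspace_glued p(1) by auto
qed

lemma Hausdorff_M4: "Hausdorff_space M4"
proof (rule M.Hausdorff_glued)
  show "continuous_map M4 euclidean (\<lambda>p. (first_circle p, second_circle p))"
  proof (rule M.continuous_map_from_glued)
    fix i :: nat
    have "(\<lambda>p. (first_circle p, second_circle p)) \<circ> patch_point i =
        (\<lambda>e. (arc_point (i mod 4) (fst e $ 1), arc_point (i div 4) (fst e $ 2)))"
      by (simp add: fun_eq_iff patch_point_def Let_def unpack)
    moreover have "continuous_on S (\<lambda>e :: (real^2) \<times> (real^2).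
        (arc_point (i mod 4) (fst e $ 1), arc_point (i div 4) (fst e $ 2)))" for S
      by (intro continuous_on_Pair continuous_on_compose2[OF continuous_on_arc_point[of UNIV]]
          continuous_intros) auto
    ultimately show "continuous_map (top_of_set (UNIV \<times> transversal_of (i mod 4))) euclidean
        ((\<lambda>p. (first_circle p, second_circle p)) \<circ> patch_point i)" by simp
  qed
  show "Hausdorff_space (euclidean :: (complex \<times> complex) topology)" by simp
  fix p q assume "p \<in> topspace M4" "q \<in> topspace M4" and eq: "(first_circle p, second_circle p) = (first_circle q, second_circle q)"
  then obtain w v s w' v' t where p: "p = pack w v s" "norm w = 1" "norm v = 1" "s \<in> square"
    "w = 1 \<longrightarrow> s \<in> vsplit_square" and q: "q = pack w' v' t" "t \<in> square" "w' = 1 \<longrightarrow> t \<in> vsplit_square"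
    unfolding topspace_M4 by (elim CollectE exE conjE)
  have wv: "w' = w" "v' = v" using eq by (simp_all add: p(1) q(1) unpack)
  obtain i where "i < 16" "pack w v s \<in> patch i" "pack w v t \<in> patch i"
    using common_chart[OF p(2,3)] p(4,5) q(2,3) wv by metis
  then show "\<exists>i\<in>{..<16}. p \<in> patch i \<and> q \<in> patch i"
    unfolding p(1) q(1) wv by (intro bexI[of _ i]) simp_all
qed

lemma overlap_same_orbit:
  assumes "i < 16" "j < 16" "e \<in> overlap (i mod 4) (j mod 4) (i div 4) (j div 4)"
  shows "same_orbit M.G (i, snd e) (j, passage (i mod 4) (j mod 4) (snd e))"
proof -
  have e: "e \<in> UNIV \<times> transversal_of (i mod 4)" "patch_point i e \<in> patch j"
    using assms(3) overlap_set_eq[OF assms(1,2)] by auto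
  have "patch_point i e \<in> patch i" "patch_chart i (patch_point i e) = e"
    using M.inverse_chart[of i e] e(1) assms(1) by simp_all
  then show ?thesis
    using M.same_orbit_transition[of j i "patch_point i e"] assms e(2) patch_chart_patch_point[OF assms]
    by (simp add: coordinate_change_def)
qed

lemma passage_same_orbit:
  assumes "k < 4" "k' < 4" "l < 4" "l' < 4" "ray k k' \<noteq> {}" "ray l l' \<noteq> {}" "z \<in> gate k k'"
  shows "same_orbit M.G (k + 4 * l, z) (k' + 4 * l', passage k k' z)"
proof -
  obtain a b where "a \<in> ray k k'" "b \<in> ray l l'" using assms(5,6) by auto
  then have "(pt2 a b, z) \<in> overlap k k' l l'" using assms(7) by (simp add: overlap_def)
  then show ?thesis
    using overlap_same_orbit[of "k + 4 * l" "k' + 4 * l'" "(pt2 a b, z)"] assms(1-4) by simp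
qed

lemmas M_orbit_trans = same_orbit_trans[OF M.pseudogroup_G]
lemmas M_orbit_sym = same_orbit_sym[OF M.pseudogroup_G]

text \<open>Every transversal is connected with the one of chart \<open>1\<close> by holonomy maps whose effect on the square is
  that of the identity: from chart \<open>0\<close> one goes backwards around the circle through \<open>3\<close> and \<open>2\<close>, which
  avoids the baker map.\<close>

lemma same_orbit_at_1:
  assumes "i < 16" "z \<in> transversal_of (i mod 4)"
  shows "same_orbit M.G (i, z) (Suc 0, z)"
proof -
  define k l where "k = i mod 4" and "l = i div 4"
  have kl: "k < 4" "l < 4" "i = k + 4 * l" using assms(1) by (auto simp: k_def l_def)
  have z: "z \<in> transversal_of k" using assms(2) by (simp add: k_def)
  then have sq: "z \<in> square" using split_squares_subset by (auto simp: transversal_of_def split: if_splits)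
  have stay: "same_orbit M.G (k + 4 * a, z) (k + 4 * b, z)" if "a < 4" "b < 4" "ray a b \<noteq> {}" for a b
  proof -
    have "z \<in> gate k k" using z by (simp add: gate_def transversal_of_def split: if_splits)
    moreover have "ray k k \<noteq> {}" "passage k k z = z" by (auto simp: ray_def passage_def)
    ultimately show ?thesis using passage_same_orbit[OF kl(1) kl(1) that(1,2) _ that(3), of z] by simp
  qed
  have l0: "same_orbit M.G (i, z) (k, z)"
  proof (cases "l = 2")
    case True
    then show ?thesis
      using M_orbit_trans[OF stay[of 2 1] stay[of 1 0]] kl(3) by (simp add: ray_def)
  next
    case False
    then have "ray l 0 \<noteq> {}" using kl(2) unfolding less_4_cases by (auto simp: ray_def)
    then show ?thesis using stay[of l 0] kl(2,3) by simp
  qed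
  have move: "same_orbit M.G (a, z) (b, z)" if "a < 4" "b < 4" "ray a b \<noteq> {}" "z \<in> gate a b" "passage a b z = z" for a b
    using passage_same_orbit[of a b 0 0 z] that by (simp add: ray_def)
  have 2: "same_orbit M.G (2, z) (Suc 0, z)"
    by (rule move) (simp_all add: ray_def gate_def passage_def sq)
  have "same_orbit M.G (3, z) (2, z)"
    by (rule move) (simp_all add: ray_def gate_def passage_def sq)
  then have 3: "same_orbit M.G (3, z) (Suc 0, z)" using 2 by (rule M_orbit_trans)
  from kl(1) have "same_orbit M.G (k, z) (Suc 0, z)"
    unfolding less_4_cases
  proof (elim disjE)
    assume k: "k = 0"
    then have "z \<in> vsplit_square" using z by (simp add: transversal_of_def)
    then have "same_orbit M.G (0, z) (3, z)"
      by (intro move) (simp_all add: ray_def gate_def passage_def)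
    then show ?thesis unfolding k using 3 by (rule M_orbit_trans)
  next
    assume "k = 1"
    then show ?thesis using move[of 1 1] sq by (simp add: ray_def gate_def passage_def)
  qed (use 2 3 in simp_all)
  with l0 show ?thesis by (rule M_orbit_trans)
qed

lemma same_orbit_baker:
  assumes "z \<in> vsplit_square"
  shows "same_orbit M.G (Suc 0, z) (Suc 0, baker z)"
proof -
  have "same_orbit M.G (0, z) (Suc 0, z)"
    by (rule same_orbit_at_1) (simp_all add: transversal_of_def assms)
  then have "same_orbit M.G (Suc 0, z) (0, z)" by (rule M_orbit_sym)
  moreover have "same_orbit M.G (0, z) (Suc 0, baker z)"
    using passage_same_orbit[of 0 "Suc 0" 0 0 z] assms by (simp add: ray_def gate_def passage_def)
  ultimately show ?thesis by (rule M_orbit_trans)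
qed

lemma same_orbit_baker_power:
  assumes "(z, w) \<in> baker_rel ^^ n" "z \<in> square"
  shows "same_orbit M.G (Suc 0, z) (Suc 0, w)"
  using assms(1)
proof (induction n arbitrary: w)
  case 0
  have "(Suc 0, z) \<in> topspace M.X"
    unfolding M.topspace_X using assms(2) by (simp add: transversal_of_def)
  with 0 show ?case by (simp add: same_orbit_refl[OF M.pseudogroup_G])
next
  case (Suc n)
  then obtain y where y: "(z, y) \<in> baker_rel ^^ n" "(y, w) \<in> baker_rel" by auto
  then have "same_orbit M.G (Suc 0, y) (Suc 0, w)"
    using same_orbit_baker by (auto simp: baker_rel_def)
  with Suc.IH[OF y(1)] show ?case by (rule M_orbit_trans)
qed

lemma transversal_of_subset: "transversal_of k \<subseteq> square"
  using split_squares_subset by (auto simp: transversal_of_def)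

lemma transitive_M4: "topologically_transitive M.X M.G"
  unfolding topologically_transitive_def
proof (intro allI impI, elim conjE)
  fix V W assume V: "openin M.X V" "V \<noteq> {}" and W: "openin M.X W" "W \<noteq> {}"
  obtain i z j w where iz: "(i, z) \<in> V" and jw: "(j, w) \<in> W" using V(2) W(2) by auto
  have i: "i < 16" "z \<in> transversal_of (i mod 4)" and j: "j < 16" "w \<in> transversal_of (j mod 4)"
    using iz jw V(1) W(1) unfolding M.openin_X by auto
  have op: "open {z. (i, z) \<in> V}" "open {w. (j, w) \<in> W}"
    using V(1) W(1) i(1) j(1) unfolding M.openin_X by auto
  obtain e where e: "0 < e" "ball z e \<subseteq> {z. (i, z) \<in> V}"
    using openE[OF op(1), of z] iz by auto
  obtain e' where e': "0 < e'" "ball w e' \<subseteq> {w. (j, w) \<in> W}"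
    using openE[OF op(2), of w] jw by auto
  have "z \<in> square" "w \<in> square" "0 < min e e'"
    using i(2) j(2) transversal_of_subset e(1) e'(1) by auto
  then obtain n z' w' where n: "(z', w') \<in> baker_rel ^^ n" "dist z' z < min e e'" "dist w' w < min e e'"
    by (rule baker_transitive)
  have "z' \<in> ball z e" "w' \<in> ball w e'" using n(2,3) by (simp_all add: dist_commute)
  then have V': "(i, z') \<in> V" and W': "(j, w') \<in> W" using e(2) e'(2) by auto
  have z': "z' \<in> transversal_of (i mod 4)" and w': "w' \<in> transversal_of (j mod 4)"
    using V' W' V(1) W(1) unfolding M.openin_X by auto
  have "same_orbit M.G (i, z') (j, w')"
    using same_orbit_at_1[OF i(1) z'] same_orbit_at_1[OF j(1) w']
      same_orbit_baker_power[OF n(1)] z' transversal_of_subset M_orbit_trans M_orbit_sym by blast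
  then obtain g where g: "g \<in> M.G" "g (i, z') = Some (j, w')" unfolding same_orbit_def by blast
  show "\<exists>g\<in>M.G. \<exists>x\<in>V \<inter> dom g. the (g x) \<in> W"
    using g V' W' by (intro bexI[of _ g] bexI[of _ "(i, z')"]) auto
qed

lemma passage_cycles:
  assumes "baker_cycles F" "z \<in> gate k k'"
  shows "passage k k' z \<in> F \<longleftrightarrow> z \<in> F"
proof -
  have F: "baker y \<in> F \<longleftrightarrow> y \<in> F" if "y \<in> vsplit_square" for y
    using assms(1) that by (auto simp: baker_cycles_def)
  consider "k = 0 \<and> k' = 1" | "k = 1 \<and> k' = 0" | "\<not> (k = 0 \<and> k' = 1)" "\<not> (k = 1 \<and> k' = 0)" by blast
  then show ?thesis
  proof cases
    case 1
    then show ?thesis using F[of z] assms(2) by (simp add: passage_def gate_def)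
  next
    case 2
    then have "z \<in> hsplit_square" using assms(2) by (simp add: gate_def)
    then show ?thesis using F[OF unbaker_in] baker_unbaker 2 by (simp add: passage_def)
  next
    case 3
    then show ?thesis by (auto simp: passage_def)
  qed
qed

lemma saturated_cycles:
  assumes "baker_cycles F" shows "M.saturated (\<lambda>i. F)"
  unfolding M.saturated_def
proof (intro conjI ballI)
  fix i :: nat
  show "F \<subseteq> transversal_of (i mod 4)"
    using assms split_squares_subset by (auto simp: baker_cycles_def transversal_of_def)
  fix j p assume "i \<in> {..<16}" "j \<in> {..<16}" "p \<in> patch i \<inter> patch j"
  then have ij: "i < 16" "j < 16" "p \<in> patch i" "p \<in> patch j" by auto
  have "snd (patch_chart i p) \<in> gate (i mod 4) (j mod 4)"
    using patch_chart_overlap(1)[OF ij] by (auto simp: overlap_def)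
  from passage_cycles[OF assms this]
  show "snd (patch_chart i p) \<in> F \<longleftrightarrow> snd (patch_chart j p) \<in> F"
    using patch_chart_overlap(2)[OF ij] by (simp add: coordinate_change_def)
qed

definition core_box :: "(real^2) set" where
  "core_box = cbox (pt2 (-1) (-1)) (pt2 1 1)"

lemma mem_core_box: "pt2 a b \<in> core_box \<longleftrightarrow> \<bar>a\<bar> \<le> 1 \<and> \<bar>b\<bar> \<le> 1"
  by (auto simp: core_box_def mem_box_cart forall_2 abs_le_iff)

text \<open>A point over a periodic orbit can be seen from any semicircle that contains \<open>w\<close>, in particular
  from one where the tangent is at most \<open>1\<close>, because the orbit avoids both walls.\<close>

lemma cycles_core_cover:
  assumes F: "baker_cycles F" and p: "p \<in> patch i" "snd (patch_chart i p) \<in> F"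
  obtains j where "j < 16" "p \<in> patch j" "fst (patch_chart j p) \<in> core_box"
proof -
  obtain w v s where pw: "p = pack w v s" "w \<in> semicircle (i mod 4)" "v \<in> semicircle (i div 4)"
    "s \<in> stored_range (i mod 4) w"
    using p(1) unfolding patch_def by (elim CollectE exE conjE)
  have r: "retrieved (i mod 4) w s \<in> F" using p(2) by (simp add: patch_chart_def pw(1) unpack)
  have Fsub: "F \<subseteq> vsplit_square \<inter> hsplit_square" and Finv: "\<And>z. z \<in> vsplit_square \<Longrightarrow> baker z \<in> F \<longleftrightarrow> z \<in> F"
    using F by (auto simp: baker_cycles_def)
  have "s = stored (i mod 4) w (retrieved (i mod 4) w s)" using stored_retrieved[OF pw(4)] by simp
  moreover have "stored (i mod 4) w y \<in> F" if "y \<in> F" for y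
    using that Finv[of y] Fsub by (auto simp: stored_def)
  ultimately have "s \<in> F" using r by metis
  obtain k where k: "k < 4" "w \<in> semicircle k" "\<bar>slope k w\<bar> \<le> 1"
    using quarter_cover[OF norm_semicircle[OF pw(2)]] .
  obtain l where l: "l < 4" "v \<in> semicircle l" "\<bar>slope l v\<bar> \<le> 1"
    using quarter_cover[OF norm_semicircle[OF pw(3)]] .
  have e: "(k + 4 * l) mod 4 = k" "(k + 4 * l) div 4 = l" using k l by auto
  have "s \<in> stored_range k w"
    using \<open>s \<in> F\<close> Fsub split_squares_subset by (auto simp: stored_range_def)
  then have "p \<in> patch (k + 4 * l)" unfolding pw(1) pack_in_patch e using k l by simp
  moreover have "fst (patch_chart (k + 4 * l) p) \<in> core_box"
    unfolding patch_chart_def e pw(1) unpack using k l by (simp add: mem_core_box)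
  moreover have "k + 4 * l < 16" using k l by simp
  ultimately show ?thesis using that by blast
qed

lemma dense_compact_leaves_M4: "dense_compact_leaves M4 {..<16} patch M.T patch_chart"
proof (rule M.dense_compact_leavesI[where K = "\<lambda>_. core_box"])
  show "compact core_box" by (simp add: core_box_def)
  fix i :: nat and z :: "real^2" and e :: real
  assume "i \<in> {..<16}" "z \<in> transversal_of (i mod 4)" "0 < e"
  then have "z \<in> square" using transversal_of_subset by auto
  then obtain F w where F: "baker_cycles F" "w \<in> F" "dist w z < e"
    using dense_baker_cycles \<open>0 < e\<close> by metis
  show "\<exists>F w. M.saturated F \<and> (\<forall>j\<in>{..<16}. finite (F j)) \<and> w \<in> F i \<and> dist w z < e \<and>
      (\<forall>j\<in>{..<16}. \<forall>p\<in>patch j. snd (patch_chart j p) \<in> F j \<longrightarrow>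
        (\<exists>k\<in>{..<16}. p \<in> patch k \<and> fst (patch_chart k p) \<in> core_box))"
  proof (intro exI[of _ "\<lambda>_. F"] exI[of _ w] conjI ballI impI)
    show "M.saturated (\<lambda>_. F)" by (rule saturated_cycles[OF F(1)])
    show "finite F" using F(1) by (simp add: baker_cycles_def)
    show "\<exists>k\<in>{..<16}. p \<in> patch k \<and> fst (patch_chart k p) \<in> core_box"
      if "p \<in> patch j" "snd (patch_chart j p) \<in> F" for j p
      using cycles_core_cover[OF F(1) that] by (metis lessThan_iff)
  qed (use F in simp_all)
qed

lemma not_sensitive_M4: "\<not> sensitive_foliation {..<16} patch M.T patch_chart"
proof (rule M.not_sensitiveI[where \<rho> = "\<lambda>z. z$1 * z$2"])
  show "continuous_on (transversal_of (i mod 4)) (\<lambda>z. z$1 * z$2)" for i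
    by (intro continuous_intros)
  show "0 < z$1 * z$2" if "z \<in> transversal_of (i mod 4)" for i z
    using subsetD[OF transversal_of_subset that] by (simp add: square_def)
  fix c :: real assume "0 < c"
  then obtain F where F: "baker_cycles F" "F \<noteq> {}" "\<And>z. z \<in> F \<Longrightarrow> z$1 * z$2 < c"
    using small_baker_cycles[of c] by metis
  show "\<exists>F. M.saturated F \<and> (\<exists>i\<in>{..<16}. F i \<noteq> {}) \<and> (\<forall>i\<in>{..<16}. \<forall>z\<in>F i. z$1 * z$2 < c)"
    using F saturated_cycles[OF F(1)]
    by (intro exI[of _ "\<lambda>_. F"] conjI ballI bexI[of _ 0]) simp_all
qed

theorem theorem1p16:
  shows "\<exists>(M :: point4 topology) (\<A> :: (point4 set \<times> (point4 \<Rightarrow> real^4)) set)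
            (I :: nat set) (U :: nat \<Rightarrow> point4 set) (Z :: nat \<Rightarrow> point2 topology)
            (\<B> :: nat \<Rightarrow> (point2 set \<times> (point2 \<Rightarrow> real^2)) set)
            (\<phi> :: nat \<Rightarrow> point4 \<Rightarrow> (real^2) \<times> point2).
           smooth_4_manifold M \<A> \<and>
           smooth_foliated_atlas M \<A> I U Z \<B> \<phi> \<and>
           transversally_affine I U Z \<B> \<phi> \<and>
           topologically_transitive_foliation I U Z \<phi> \<and>
           dense_compact_leaves M I U Z \<phi> \<and>
           \<not> sensitive_foliation I U Z \<phi>"
proof (intro exI conjI)
  show "smooth_4_manifold M4 M.joined_charts"
    unfolding smooth_4_manifold_def
    using Hausdorff_M4 M.second_countable_glued M.smooth_atlas_joined_charts by simp
  show "smooth_foliated_atlas M4 M.joined_charts {..<16} patch M.T (\<lambda>i. {(transversal_of (i mod 4), id)}) patch_chart"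
    by (rule M.smooth_foliated_atlas_glued)
  show "transversally_affine {..<16} patch M.T (\<lambda>i. {(transversal_of (i mod 4), id)}) patch_chart"
    by (rule M.transversally_affine_glued)
  show "topologically_transitive_foliation {..<16} patch M.T patch_chart"
    unfolding topologically_transitive_foliation_def by (rule transitive_M4)
  show "dense_compact_leaves M4 {..<16} patch M.T patch_chart"
    by (rule dense_compact_leaves_M4)
  show "\<not> sensitive_foliation {..<16} patch M.T patch_chart"
    by (rule not_sensitive_M4)
qed

end
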